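(* Let $M$ be a compact manifold of real dimension $2n$ and $(M,g,I,J,b)$ a generalized Kähler structure on $(M,H_0)$ with corresponding generalized complex structures $(\mathbb I,\mathbb J)$, and let $\mathrm{vol}$ be a $(g,I,J)$-adapted volume form. Let $\mathbb T$ be the compact torus generated by $X=\mathrm{div}_{\mathrm{vol}}(\pi_{\mathbb J})$. Suppose that $\mathbb J$ is of generically symplectic type and that $b$ is $\mathbb T$-invariant. Then $(\mathbb I,\mathbb J,\mathrm{vol})$ is adapted, i.e. $L_{\mathrm{div}_{\mathrm{vol}}(\mathbb J)}\mathbb I=0$.
   Context: $E=TM\oplus T^*M$ has pairing $\langle X+\xi,Y+\eta\rangle=\frac12(\eta(X)+\xi(Y))$ and bracket $[X+\xi,Y+\eta]_{H_0}=[X,Y]+L_X\eta-i_Yd\xi+i_Yi_XH_0$, $H_0$ a closed 3-form. $E\otimes\mathbb C$ acts on complex forms by $(X+\xi)\cdot\alpha=i_X\alpha+\xi\wedge\alpha$; $d_{H_0}\alpha=d\alpha-H_0\wedge\alpha$; Mukai pairing $(\alpha,\beta)=[\alpha\wedge\sigma(\beta)]_{\rm top}$, $\sigma$ being reversal of decomposable forms. Infinitesimal automorphisms $X+B\in\mathfrak{aut}(M,H_0)$ ($d(i_XH_0+B)=0$) act on sections of $E$ by $L_{X+B}(Y+\eta)=[X,Y]+L_X\eta-i_YB$ and on $\mathrm{End}(E)$ by Leibniz; $\Psi(X+\xi)=X+d\xi-i_XH_0$. Bihermitian generalized Kähler data $(g,I,J,b)$: $g$ a metric, $b$ a 2-form,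 $I,J$ $g$-orthogonal complex structures with $-d_I^c\omega_I=H_0+db=d^c_J\omega_J$, $\omega_I=gI$, $\omega_J=gJ$, $d^c=\sqrt{-1}(\bar\partial-\partial)$. The corresponding commuting generalized complex structures are $$\mathbb I=\tfrac12e^b\begin{pmatrix}I+J&-(\omega_I^{-1}-\omega_J^{-1})\\ \omega_I-\omega_J&-(I^*+J^* )\end{pmatrix}e^{-b},\quad \mathbb J=\tfrac12e^b\begin{pmatrix}I-J&-(\omega_I^{-1}+\omega_J^{-1})\\ \omega_I+\omega_J&-(I^*-J^* )\end{pmatrix}e^{-b},$$ $e^b(X+\xi)=X+\xi+b(X,\cdot)$. $\pi_{\mathbb J}=\frac12(I+J)g^{-1}:T^*M\to TM$ is the Poisson tensor of $\mathbb J$; $\mathbb J$ is of generically symplectic type if $\pi_{\mathbb J}$ is nondegenerate on an open dense subset of $M$. $\mathrm{div}_{\mathrm{vol}}(\pi_{\mathbb J})$ is the vector field $X$ with $d(i_{\pi_{\mathbb J}}\mathrm{vol})=i_X\mathrm{vol}$, where $i_{\pi_{\mathbb J}(\alpha)}\mathrm{vol}=\alpha\wedge i_{\pi_{\mathbb J}}\mathrm{vol}$ for 1-forms $\alpha$. $\mathrm{vol}$ is $(g,I,J)$-adapted if $L_Xg=0$, $L_XI=L_XJ=0$. The torus generated by $X$ is the closure of its flow in $\mathrm{Isom}(g)$. $\mathrm{div}_{\mathrm{vol}}(\mathbb J)\in\mathfrak{aut}(M,H_0)$: if $\psi$ is a local pure spinor of $\mathbb J$ (annihilator the $\sqrt{-1}$-eigenbundle)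 with $(\psi,\bar\psi)=(2\sqrt{-1})^n\mathrm{vol}$ and $e$ the unique real section of $E$ with $d_{H_0}\psi=\frac{\sqrt{-1}}2e\cdot\psi$, then $\mathrm{div}_{\mathrm{vol}}(\mathbb J):=\Psi(e)$ (globally defined, independent of $\psi$). *)

theory Defs
  imports "HOL-Analysis.Analysis"
begin

section \<open>Smooth maps and smooth manifolds\<close>

primrec Ck_on :: "nat \<Rightarrow> 'v::real_normed_vector set \<Rightarrow> ('v \<Rightarrow> 'w::real_normed_vector) \<Rightarrow> bool" where
  "Ck_on 0 S f \<longleftrightarrow> continuous_on S f"
| "Ck_on (Suc k) S f \<longleftrightarrow> (\<forall>x\<in>S. f differentiable (at x)) \<and>
     (\<forall>v. Ck_on k S (\<lambda>x. frechet_derivative f (at x) v))"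

text \<open>Only used for open \<open>S\<close>.\<close>
definition smooth_on :: "'v::real_normed_vector set \<Rightarrow> ('v \<Rightarrow> 'w::real_normed_vector) \<Rightarrow> bool" where
  "smooth_on S f \<longleftrightarrow> (\<forall>k. Ck_on k S f)"

type_synonym ('a, 'm) chart = "'a set \<times> ('a \<Rightarrow> real^'m)"

abbreviation dom :: "('a, 'm) chart \<Rightarrow> 'a set" where "dom c \<equiv> fst c"
abbreviation coord :: "('a, 'm) chart \<Rightarrow> 'a \<Rightarrow> real^'m" where "coord c \<equiv> snd c"

definition img :: "('a, 'm) chart \<Rightarrow> (real^'m) set" where
  "img c = coord c ` dom c"

definition param :: "('a, 'm) chart \<Rightarrow> real^'m \<Rightarrow> 'a" where
  "param c = inv_into (dom c) (coord c)"

definition chart_rep :: "('a, 'm) chart \<Rightarrow> ('a, 'm) chart \<Rightarrow> ('a \<Rightarrow> 'a) \<Rightarrow> real^'m \<Rightarrow> real^'m" where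
  "chart_rep c c' f = coord c' \<circ> f \<circ> param c"

definition tangent_map ::
  "('a, 'm::finite) chart \<Rightarrow> ('a, 'm) chart \<Rightarrow> ('a \<Rightarrow> 'a) \<Rightarrow> 'a \<Rightarrow> real^'m \<Rightarrow> real^'m" where
  "tangent_map c c' f p = frechet_derivative (chart_rep c c' f) (at (coord c p))"

definition smooth_atlas :: "('a::{t2_space, second_countable_topology}, 'm::finite) chart set \<Rightarrow> bool" where
  "smooth_atlas A \<longleftrightarrow>
     (\<Union>c\<in>A. dom c) = UNIV \<and>
     (\<forall>c\<in>A. open (dom c) \<and> open (img c) \<and> homeomorphism (dom c) (img c) (coord c) (param c)) \<and>
     (\<forall>c\<in>A. \<forall>c'\<in>A. smooth_on (coord c ` (dom c \<inter> dom c')) (chart_rep c c' id))"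

definition smooth_map :: "('a::topological_space, 'm::finite) chart set \<Rightarrow> ('a \<Rightarrow> 'a) \<Rightarrow> bool" where
  "smooth_map A f \<longleftrightarrow> continuous_on UNIV f \<and>
     (\<forall>c\<in>A. \<forall>c'\<in>A. smooth_on (coord c ` (dom c \<inter> f -` dom c')) (chart_rep c c' f))"

section \<open>Exterior algebra and calculus in a coordinate domain\<close>

text \<open>
  A form of mixed degree on \<open>real^'m\<close> is a function on lists of vectors; its restriction to lists
  of length \<open>k\<close> is its component of degree \<open>k\<close>.  A field assigns such a form to every point of
  a coordinate domain.
\<close>
type_synonym ('m, 'k) form = "(real^'m) list \<Rightarrow> 'k"

definition alternating_form :: "('m::finite, 'k::real_vector) form \<Rightarrow> bool" where
  "alternating_form \<alpha> \<longleftrightarrow>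
     (\<forall>us ws. linear (\<lambda>v. \<alpha> (us @ v # ws))) \<and>
     (\<forall>us v ws zs. \<alpha> (us @ v # ws @ v # zs) = 0)"

definition k_form :: "nat \<Rightarrow> ('m::finite, 'k::real_vector) form \<Rightarrow> bool" where
  "k_form k \<alpha> \<longleftrightarrow> alternating_form \<alpha> \<and> (\<forall>vs. length vs \<noteq> k \<longrightarrow> \<alpha> vs = 0)"

text \<open>A covector is stored through its components.\<close>
definition form1 :: "real^'m::finite \<Rightarrow> ('m, real) form" where
  "form1 \<xi> vs = (if length vs = 1 then \<xi> \<bullet> hd vs else 0)"

definition covector :: "('m::finite, real) form \<Rightarrow> real^'m" where
  "covector \<alpha> = (\<chi> j. \<alpha> [axis j 1])"

text \<open>A matrix \<open>K\<close> read as a map from vectors to covectors gives the bilinear form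
  \<open>(u, v) \<mapsto> (K u)(v)\<close>.\<close>
definition bilin :: "real^'m::finite^'m \<Rightarrow> ('m, real) form" where
  "bilin K vs = (if length vs = 2 then (K *v (vs ! 0)) \<bullet> (vs ! 1) else 0)"

definition cplx :: "('m, real) form \<Rightarrow> ('m, complex) form" where
  "cplx \<alpha> vs = complex_of_real (\<alpha> vs)"

definition interior_prod :: "real^'m \<Rightarrow> ('m, 'k) form \<Rightarrow> ('m, 'k) form" where
  "interior_prod u \<alpha> vs = \<alpha> (u # vs)"

text \<open>The sum over shuffles, with the sign of the permutation which moves the positions in \<open>S\<close>
  to the front; there are no factorial factors.\<close>
definition wedge :: "('m, 'k::comm_ring_1) form \<Rightarrow> ('m, 'k) form \<Rightarrow> ('m, 'k) form" where
  "wedge \<alpha> \<beta> vs = (\<Sum>S\<in>Pow {..<length vs}.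
     (-1) ^ card {(i, j). i < j \<and> j < length vs \<and> i \<notin> S \<and> j \<in> S} *
     \<alpha> (nths vs S) * \<beta> (nths vs (- S)))"

text \<open>Reversal of decomposable forms.\<close>
definition reversal :: "('m, 'k) form \<Rightarrow> ('m, 'k) form" where
  "reversal \<alpha> vs = \<alpha> (rev vs)"

definition mukai :: "('m::finite, 'k::comm_ring_1) form \<Rightarrow> ('m, 'k) form \<Rightarrow> ('m, 'k) form" where
  "mukai \<alpha> \<beta> vs = (if length vs = CARD('m) then wedge \<alpha> (reversal \<beta>) vs else 0)"

definition ext_d ::
  "(real^'m::finite \<Rightarrow> ('m, 'k::real_normed_vector) form) \<Rightarrow> real^'m \<Rightarrow> ('m, 'k) form" where
  "ext_d \<alpha> x vs = (\<Sum>i<length vs. (-1) ^ i *\<^sub>R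
     frechet_derivative (\<lambda>y. \<alpha> y (take i vs @ drop (Suc i) vs)) (at x) (vs ! i))"

definition lie_bracket ::
  "(real^'m::finite \<Rightarrow> real^'m) \<Rightarrow> (real^'m \<Rightarrow> real^'m) \<Rightarrow> real^'m \<Rightarrow> real^'m" where
  "lie_bracket X Y x = frechet_derivative Y (at x) (X x) - frechet_derivative X (at x) (Y x)"

text \<open>The Lie derivative of a covariant tensor, evaluated on constant coordinate fields \<open>v\<close>, for which
  \<open>[X, v] = - DX(v)\<close>.\<close>
definition lie_cov ::
  "(real^'m::finite \<Rightarrow> real^'m) \<Rightarrow> (real^'m \<Rightarrow> ('m, real) form) \<Rightarrow> real^'m \<Rightarrow> ('m, real) form" where
  "lie_cov X \<tau> x vs = frechet_derivative (\<lambda>y. \<tau> y vs) (at x) (X x) +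
     (\<Sum>i<length vs. \<tau> x (vs[i := frechet_derivative X (at x) (vs ! i)]))"

definition lie_End_zero_on ::
  "(real^'m::finite) set \<Rightarrow> (real^'m \<Rightarrow> real^'m) \<Rightarrow> (real^'m \<Rightarrow> real^'m^'m) \<Rightarrow> bool" where
  "lie_End_zero_on S X K \<longleftrightarrow> (\<forall>Y. smooth_on S Y \<longrightarrow>
     (\<forall>x\<in>S. lie_bracket X (\<lambda>y. K y *v Y y) x - K x *v lie_bracket X Y x = 0))"

section \<open>Complex structures and the operator \<open>d\<^sup>c\<close>\<close>

definition integrable_complex_on ::
  "(real^'m::finite) set \<Rightarrow> (real^'m \<Rightarrow> real^'m^'m) \<Rightarrow> bool" where
  "integrable_complex_on S I \<longleftrightarrow>
     (\<forall>x\<in>S. I x ** I x = - mat 1) \<and>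
     (\<forall>Y Z. smooth_on S Y \<and> smooth_on S Z \<longrightarrow> (\<forall>x\<in>S.
        lie_bracket (\<lambda>y. I y *v Y y) (\<lambda>y. I y *v Z y) x
        - I x *v lie_bracket (\<lambda>y. I y *v Y y) Z x
        - I x *v lie_bracket Y (\<lambda>y. I y *v Z y) x
        - lie_bracket Y Z x = 0))"

text \<open>The complex multilinear extension of a form; the pair \<open>(u, w)\<close> stands for \<open>u + \<i> w\<close>.\<close>
fun cext :: "('m, complex) form \<Rightarrow> ((real^'m) \<times> (real^'m)) list \<Rightarrow> complex" where
  "cext \<alpha> [] = \<alpha> []"
| "cext \<alpha> ((u, w) # zs) = cext (\<lambda>vs. \<alpha> (u # vs)) zs + \<i> * cext (\<lambda>vs. \<alpha> (w # vs)) zs"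

text \<open>\<open>v = v\<^sup>1\<^sup>0 + v\<^sup>0\<^sup>1\<close> with \<open>v\<^sup>1\<^sup>0 = (v - \<i> I v) / 2\<close> and \<open>v\<^sup>0\<^sup>1 = (v + \<i> I v) / 2\<close>.\<close>
definition vec10 :: "real^'m::finite^'m \<Rightarrow> real^'m \<Rightarrow> (real^'m) \<times> (real^'m)" where
  "vec10 I v = ((1/2) *\<^sub>R v, - ((1/2) *\<^sub>R (I *v v)))"

definition vec01 :: "real^'m::finite^'m \<Rightarrow> real^'m \<Rightarrow> (real^'m) \<times> (real^'m)" where
  "vec01 I v = ((1/2) *\<^sub>R v, (1/2) *\<^sub>R (I *v v))"

text \<open>The component of type \<open>(p, q)\<close>: expand \<open>\<alpha>(v\<^sub>1\<^sup>1\<^sup>0 + v\<^sub>1\<^sup>0\<^sup>1, \<dots>)\<close> and keep the terms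
  with exactly \<open>p\<close> arguments of type \<open>(1, 0)\<close>.\<close>
definition type_part ::
  "real^'m::finite^'m \<Rightarrow> nat \<Rightarrow> nat \<Rightarrow> ('m, complex) form \<Rightarrow> ('m, complex) form" where
  "type_part I p q \<alpha> vs = (if length vs = p + q then
     (\<Sum>S | S \<subseteq> {..<length vs} \<and> card S = p.
        cext \<alpha> (map (\<lambda>i. if i \<in> S then vec10 I (vs ! i) else vec01 I (vs ! i)) [0..<length vs]))
     else 0)"

definition del ::
  "(real^'m::finite \<Rightarrow> real^'m^'m) \<Rightarrow> (real^'m \<Rightarrow> ('m, complex) form) \<Rightarrow> real^'m \<Rightarrow> ('m, complex) form" where
  "del I \<alpha> x vs = (\<Sum>p<length vs. let q = length vs - Suc p in
     type_part (I x) (Suc p) q (ext_d (\<lambda>y. type_part (I y) p q (\<alpha> y)) x) vs)"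

definition delbar ::
  "(real^'m::finite \<Rightarrow> real^'m^'m) \<Rightarrow> (real^'m \<Rightarrow> ('m, complex) form) \<Rightarrow> real^'m \<Rightarrow> ('m, complex) form" where
  "delbar I \<alpha> x vs = (\<Sum>p<length vs. let q = length vs - Suc p in
     type_part (I x) p (Suc q) (ext_d (\<lambda>y. type_part (I y) p q (\<alpha> y)) x) vs)"

definition dc ::
  "(real^'m::finite \<Rightarrow> real^'m^'m) \<Rightarrow> (real^'m \<Rightarrow> ('m, complex) form) \<Rightarrow> real^'m \<Rightarrow> ('m, complex) form" where
  "dc I \<alpha> x vs = \<i> * (delbar I \<alpha> x vs - del I \<alpha> x vs)"

section \<open>Tensor fields on a manifold\<close>

text \<open>
  A tensor field on a manifold with atlas \<open>A\<close> is given by its coordinate expression in every chart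
  \<open>c\<close>, as a function on the open set \<open>img c\<close>, subject to the transformation law.
\<close>

definition vector_field :: "('a, 'm::finite) chart set \<Rightarrow> (('a, 'm) chart \<Rightarrow> real^'m \<Rightarrow> real^'m) \<Rightarrow> bool" where
  "vector_field A X \<longleftrightarrow>
     (\<forall>c\<in>A. smooth_on (img c) (X c)) \<and>
     (\<forall>c\<in>A. \<forall>c'\<in>A. \<forall>p\<in>dom c \<inter> dom c'.
        X c' (coord c' p) = tangent_map c c' id p (X c (coord c p)))"

definition End_field :: "('a, 'm::finite) chart set \<Rightarrow> (('a, 'm) chart \<Rightarrow> real^'m \<Rightarrow> real^'m^'m) \<Rightarrow> bool" where
  "End_field A K \<longleftrightarrow>
     (\<forall>c\<in>A. smooth_on (img c) (K c)) \<and>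
     (\<forall>c\<in>A. \<forall>c'\<in>A. \<forall>p\<in>dom c \<inter> dom c'. \<forall>v.
        K c' (coord c' p) *v tangent_map c c' id p v = tangent_map c c' id p (K c (coord c p) *v v))"

text \<open>\<open>f\<^sup>* \<tau> = \<tau>\<close> for a covariant tensor \<open>\<tau>\<close>.  For \<open>f = id\<close> this is the transformation law of \<open>\<tau>\<close>.\<close>
definition preserves ::
  "('a, 'm::finite) chart set \<Rightarrow> ('a \<Rightarrow> 'a) \<Rightarrow> (('a, 'm) chart \<Rightarrow> real^'m \<Rightarrow> ('m, 'k) form) \<Rightarrow> bool" where
  "preserves A f \<tau> \<longleftrightarrow> (\<forall>c\<in>A. \<forall>c'\<in>A. \<forall>p\<in>dom c \<inter> f -` dom c'. \<forall>vs.
     \<tau> c' (coord c' (f p)) (map (tangent_map c c' f p) vs) = \<tau> c (coord c p) vs)"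

definition form_field ::
  "('a, 'm::finite) chart set \<Rightarrow> nat \<Rightarrow> (('a, 'm) chart \<Rightarrow> real^'m \<Rightarrow> ('m, real) form) \<Rightarrow> bool" where
  "form_field A k \<alpha> \<longleftrightarrow>
     (\<forall>c\<in>A. \<forall>x\<in>img c. k_form k (\<alpha> c x)) \<and>
     (\<forall>c\<in>A. \<forall>vs. smooth_on (img c) (\<lambda>x. \<alpha> c x vs)) \<and>
     preserves A id \<alpha>"

definition closed_form ::
  "('a, 'm::finite) chart set \<Rightarrow> (('a, 'm) chart \<Rightarrow> real^'m \<Rightarrow> ('m, real) form) \<Rightarrow> bool" where
  "closed_form A \<alpha> \<longleftrightarrow> (\<forall>c\<in>A. \<forall>x\<in>img c. \<forall>vs. ext_d (\<alpha> c) x vs = 0)"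

definition volume_form ::
  "('a, 'm::finite) chart set \<Rightarrow> (('a, 'm) chart \<Rightarrow> real^'m \<Rightarrow> ('m, real) form) \<Rightarrow> bool" where
  "volume_form A vol \<longleftrightarrow> form_field A CARD('m) vol \<and>
     (\<forall>c\<in>A. \<forall>x\<in>img c. \<exists>vs. vol c x vs \<noteq> 0)"

text \<open>The metric is stored as the matrix of \<open>TM \<rightarrow> T\<^sup>*M\<close>.\<close>
definition riemannian_metric :: "('a, 'm::finite) chart set \<Rightarrow> (('a, 'm) chart \<Rightarrow> real^'m \<Rightarrow> real^'m^'m) \<Rightarrow> bool" where
  "riemannian_metric A g \<longleftrightarrow>
     (\<forall>c\<in>A. smooth_on (img c) (g c)) \<and>
     (\<forall>c\<in>A. \<forall>x\<in>img c. transpose (g c x) = g c x \<and> (\<forall>v. v \<noteq> 0 \<longrightarrow> (g c x *v v) \<bullet> v > 0)) \<and>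
     preserves A id (\<lambda>c x. bilin (g c x))"

definition hermitian_complex_structure ::
  "('a, 'm::finite) chart set \<Rightarrow> (('a, 'm) chart \<Rightarrow> real^'m \<Rightarrow> real^'m^'m) \<Rightarrow>
   (('a, 'm) chart \<Rightarrow> real^'m \<Rightarrow> real^'m^'m) \<Rightarrow> bool" where
  "hermitian_complex_structure A g I \<longleftrightarrow>
     End_field A I \<and>
     (\<forall>c\<in>A. integrable_complex_on (img c) (I c)) \<and>
     (\<forall>c\<in>A. \<forall>x\<in>img c. \<forall>u v. (g c x *v (I c x *v u)) \<bullet> (I c x *v v) = (g c x *v u) \<bullet> v)"

text \<open>\<open>\<omega>\<^sub>I = g I\<close>, as a map from vectors to covectors and as a \<open>2\<close>-form.\<close>
definition generalized_kaehler ::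
  "('a, 'm::finite) chart set \<Rightarrow> (('a, 'm) chart \<Rightarrow> real^'m \<Rightarrow> ('m, real) form) \<Rightarrow>
   (('a, 'm) chart \<Rightarrow> real^'m \<Rightarrow> real^'m^'m) \<Rightarrow> (('a, 'm) chart \<Rightarrow> real^'m \<Rightarrow> real^'m^'m) \<Rightarrow>
   (('a, 'm) chart \<Rightarrow> real^'m \<Rightarrow> real^'m^'m) \<Rightarrow> (('a, 'm) chart \<Rightarrow> real^'m \<Rightarrow> ('m, real) form) \<Rightarrow> bool" where
  "generalized_kaehler A H0 g I J b \<longleftrightarrow>
     riemannian_metric A g \<and>
     hermitian_complex_structure A g I \<and>
     hermitian_complex_structure A g J \<and>
     form_field A 2 b \<and>
     (\<forall>c\<in>A. \<forall>x\<in>img c. \<forall>vs.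
        - dc (I c) (\<lambda>y. cplx (bilin (g c y ** I c y))) x vs
            = complex_of_real (H0 c x vs + ext_d (b c) x vs) \<and>
        dc (J c) (\<lambda>y. cplx (bilin (g c y ** J c y))) x vs
            = complex_of_real (H0 c x vs + ext_d (b c) x vs))"

section \<open>The generalized tangent bundle\<close>

text \<open>Fibres of \<open>TM \<oplus> T\<^sup>*M\<close> and of its complexification in a chart.\<close>
type_synonym 'm gt = "(real^'m) \<times> (real^'m)"
type_synonym 'm cgt = "(complex^'m) \<times> (complex^'m)"

definition complexify :: "'m::finite gt \<Rightarrow> 'm cgt" where
  "complexify e = ((\<chi> i. complex_of_real (fst e $ i)), (\<chi> i. complex_of_real (snd e $ i)))"

definition Re_gt :: "'m::finite cgt \<Rightarrow> 'm gt" where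
  "Re_gt e = ((\<chi> i. Re (fst e $ i)), (\<chi> i. Re (snd e $ i)))"

definition Im_gt :: "'m::finite cgt \<Rightarrow> 'm gt" where
  "Im_gt e = ((\<chi> i. Im (fst e $ i)), (\<chi> i. Im (snd e $ i)))"

definition cscale :: "complex \<Rightarrow> 'm::finite cgt \<Rightarrow> 'm cgt" where
  "cscale z e = (z *s fst e, z *s snd e)"

definition complexify_End :: "('m::finite gt \<Rightarrow> 'm gt) \<Rightarrow> 'm cgt \<Rightarrow> 'm cgt" where
  "complexify_End F e = complexify (F (Re_gt e)) + cscale \<i> (complexify (F (Im_gt e)))"

definition cform1 :: "complex^'m::finite \<Rightarrow> ('m, complex) form" where
  "cform1 \<xi> vs = (if length vs = 1 then (\<Sum>j\<in>UNIV. \<xi> $ j * complex_of_real (hd vs $ j)) else 0)"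

text \<open>\<open>(X + \<xi>) \<cdot> \<alpha> = i\<^sub>X \<alpha> + \<xi> \<and> \<alpha>\<close>, complex linear in \<open>X + \<xi>\<close>.\<close>
definition clifford :: "'m::finite cgt \<Rightarrow> ('m, complex) form \<Rightarrow> ('m, complex) form" where
  "clifford e \<alpha> vs =
     interior_prod (fst (Re_gt e)) \<alpha> vs + \<i> * interior_prod (fst (Im_gt e)) \<alpha> vs
     + wedge (cform1 (snd e)) \<alpha> vs"

definition twisted_d ::
  "(real^'m::finite \<Rightarrow> ('m, real) form) \<Rightarrow> (real^'m \<Rightarrow> ('m, complex) form) \<Rightarrow> real^'m \<Rightarrow> ('m, complex) form" where
  "twisted_d H \<alpha> x vs = ext_d \<alpha> x vs - wedge (cplx (H x)) (\<alpha> x) vs"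

definition exp_b :: "('m::finite, real) form \<Rightarrow> 'm gt \<Rightarrow> 'm gt" where
  "exp_b b e = (fst e, snd e + covector (interior_prod (fst e) b))"

definition block ::
  "real^'m::finite^'m \<Rightarrow> real^'m^'m \<Rightarrow> real^'m^'m \<Rightarrow> real^'m^'m \<Rightarrow> 'm gt \<Rightarrow> 'm gt" where
  "block P Q R S e = (P *v fst e + Q *v snd e, R *v fst e + S *v snd e)"

text \<open>\<open>transpose I\<close> is the matrix of \<open>I\<^sup>*\<close> on covectors.\<close>
definition gcs_I ::
  "real^'m::finite^'m \<Rightarrow> real^'m^'m \<Rightarrow> real^'m^'m \<Rightarrow> ('m, real) form \<Rightarrow> 'm gt \<Rightarrow> 'm gt" where
  "gcs_I g I J b e = exp_b b ((1/2) *\<^sub>R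
     block (I + J) (- (matrix_inv (g ** I) - matrix_inv (g ** J)))
           (g ** I - g ** J) (- (transpose I + transpose J))
       (exp_b (\<lambda>vs. - b vs) e))"

definition gcs_J ::
  "real^'m::finite^'m \<Rightarrow> real^'m^'m \<Rightarrow> real^'m^'m \<Rightarrow> ('m, real) form \<Rightarrow> 'm gt \<Rightarrow> 'm gt" where
  "gcs_J g I J b e = exp_b b ((1/2) *\<^sub>R
     block (I - J) (- (matrix_inv (g ** I) + matrix_inv (g ** J)))
           (g ** I + g ** J) (- (transpose I - transpose J))
       (exp_b (\<lambda>vs. - b vs) e))"

text \<open>The action of \<open>X + B\<close> on sections of \<open>TM \<oplus> T\<^sup>*M\<close>, and the vanishing of its action (by the Leibniz
  rule) on an endomorphism field.\<close>
definition aut_action ::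
  "(real^'m::finite \<Rightarrow> real^'m) \<Rightarrow> (real^'m \<Rightarrow> ('m, real) form) \<Rightarrow> (real^'m \<Rightarrow> 'm gt) \<Rightarrow> real^'m \<Rightarrow> 'm gt" where
  "aut_action X B s x =
     (lie_bracket X (\<lambda>y. fst (s y)) x,
      covector (lie_cov X (\<lambda>y. form1 (snd (s y))) x) - covector (interior_prod (fst (s x)) (B x)))"

definition aut_action_End_zero ::
  "('a, 'm::finite) chart set \<Rightarrow> (('a, 'm) chart \<Rightarrow> real^'m \<Rightarrow> real^'m) \<Rightarrow>
   (('a, 'm) chart \<Rightarrow> real^'m \<Rightarrow> ('m, real) form) \<Rightarrow> (('a, 'm) chart \<Rightarrow> real^'m \<Rightarrow> 'm gt \<Rightarrow> 'm gt) \<Rightarrow> bool" where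
  "aut_action_End_zero A X B F \<longleftrightarrow> (\<forall>c\<in>A. \<forall>s. smooth_on (img c) s \<longrightarrow>
     (\<forall>x\<in>img c. aut_action (X c) (B c) (\<lambda>y. F c y (s y)) x - F c x (aut_action (X c) (B c) s x) = 0))"

section \<open>Divergences\<close>

definition poisson_J :: "real^'m::finite^'m \<Rightarrow> real^'m^'m \<Rightarrow> real^'m^'m \<Rightarrow> real^'m^'m" where
  "poisson_J g I J = (1/2) *\<^sub>R ((I + J) ** matrix_inv g)"

definition generically_symplectic ::
  "('a::topological_space, 'm::finite) chart set \<Rightarrow> (('a, 'm) chart \<Rightarrow> real^'m \<Rightarrow> real^'m^'m) \<Rightarrow> bool" where
  "generically_symplectic A P \<longleftrightarrow> (\<exists>W. open W \<and> closure W = UNIV \<and>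
     (\<forall>c\<in>A. \<forall>p\<in>W \<inter> dom c. invertible (P c (coord c p))))"

text \<open>\<open>\<beta>\<close> is \<open>i\<^sub>\<pi> vol\<close>, for the bivector given by the map \<open>P\<close> from covectors to vectors.\<close>
definition is_div_bivector ::
  "('a, 'm::finite) chart set \<Rightarrow> (('a, 'm) chart \<Rightarrow> real^'m \<Rightarrow> ('m, real) form) \<Rightarrow>
   (('a, 'm) chart \<Rightarrow> real^'m \<Rightarrow> real^'m^'m) \<Rightarrow> (('a, 'm) chart \<Rightarrow> real^'m \<Rightarrow> real^'m) \<Rightarrow> bool" where
  "is_div_bivector A vol P X \<longleftrightarrow> vector_field A X \<and>
     (\<exists>\<beta>. form_field A (CARD('m) - 2) \<beta> \<and>
       (\<forall>c\<in>A. \<forall>x\<in>img c.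
         (\<forall>a vs. interior_prod (P c x *v a) (vol c x) vs = wedge (form1 a) (\<beta> c x) vs) \<and>
         (\<forall>vs. ext_d (\<beta> c) x vs = interior_prod (X c x) (vol c x) vs)))"

definition adapted_volume ::
  "('a, 'm::finite) chart set \<Rightarrow> (('a, 'm) chart \<Rightarrow> real^'m \<Rightarrow> real^'m^'m) \<Rightarrow>
   (('a, 'm) chart \<Rightarrow> real^'m \<Rightarrow> real^'m^'m) \<Rightarrow> (('a, 'm) chart \<Rightarrow> real^'m \<Rightarrow> real^'m^'m) \<Rightarrow>
   (('a, 'm) chart \<Rightarrow> real^'m \<Rightarrow> ('m, real) form) \<Rightarrow> bool" where
  "adapted_volume A g I J vol \<longleftrightarrow> volume_form A vol \<and>
     (\<forall>X. is_div_bivector A vol (\<lambda>c x. poisson_J (g c x) (I c x) (J c x)) X \<longrightarrow>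
       (\<forall>c\<in>A. (\<forall>x\<in>img c. \<forall>vs. lie_cov (X c) (\<lambda>y. bilin (g c y)) x vs = 0) \<and>
              lie_End_zero_on (img c) (X c) (I c) \<and> lie_End_zero_on (img c) (X c) (J c)))"

text \<open>A smooth field of pure spinors on \<open>W\<close> whose annihilator is the \<open>\<i>\<close>-eigenbundle of \<open>F\<close>.\<close>
definition pure_spinor_on ::
  "(real^'m::finite) set \<Rightarrow> (real^'m \<Rightarrow> 'm gt \<Rightarrow> 'm gt) \<Rightarrow> (real^'m \<Rightarrow> ('m, complex) form) \<Rightarrow> bool" where
  "pure_spinor_on W F \<psi> \<longleftrightarrow>
     (\<forall>vs. smooth_on W (\<lambda>x. \<psi> x vs)) \<and>
     (\<forall>x\<in>W. alternating_form (\<psi> x) \<and>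
        {e. \<forall>vs. clifford e (\<psi> x) vs = 0} = {e. complexify_End (F x) e = cscale \<i> e})"

text \<open>The map \<open>\<Psi>(X + \<xi>) = X + d\<xi> - i\<^sub>X H\<close>.\<close>
definition Psi ::
  "(real^'m::finite \<Rightarrow> ('m, real) form) \<Rightarrow> (real^'m \<Rightarrow> 'm gt) \<Rightarrow> real^'m \<Rightarrow> (real^'m) \<times> ('m, real) form" where
  "Psi H e x = (fst (e x),
     \<lambda>vs. ext_d (\<lambda>y. form1 (snd (e y))) x vs - interior_prod (fst (e x)) (H x) vs)"

text \<open>\<open>Y + B\<close> is the divergence of the generalized complex structure \<open>F\<close>: locally it is \<open>\<Psi>(e)\<close>, for
  some normalized local pure spinor \<open>\<psi>\<close> and the real section \<open>e\<close> determined by it.  One spinor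
  near each point suffices, since \<open>\<Psi>(e)\<close> does not depend on the choice of \<open>\<psi>\<close>.\<close>
definition is_div_gcs ::
  "nat \<Rightarrow> ('a, 'm::finite) chart set \<Rightarrow> (('a, 'm) chart \<Rightarrow> real^'m \<Rightarrow> ('m, real) form) \<Rightarrow>
   (('a, 'm) chart \<Rightarrow> real^'m \<Rightarrow> ('m, real) form) \<Rightarrow> (('a, 'm) chart \<Rightarrow> real^'m \<Rightarrow> 'm gt \<Rightarrow> 'm gt) \<Rightarrow>
   (('a, 'm) chart \<Rightarrow> real^'m \<Rightarrow> real^'m) \<Rightarrow> (('a, 'm) chart \<Rightarrow> real^'m \<Rightarrow> ('m, real) form) \<Rightarrow> bool" where
  "is_div_gcs n A H0 vol F Y B \<longleftrightarrow>
     (\<forall>c\<in>A. \<forall>x\<in>img c. \<exists>W \<psi> e.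
        open W \<and> x \<in> W \<and> W \<subseteq> img c \<and>
        pure_spinor_on W (F c) \<psi> \<and>
        (\<forall>y\<in>W. \<forall>vs. mukai (\<psi> y) (\<lambda>us. cnj (\<psi> y us)) vs = (2 * \<i>) ^ n * complex_of_real (vol c y vs)) \<and>
        smooth_on W e \<and>
        (\<forall>y\<in>W. \<forall>vs. twisted_d (H0 c) \<psi> y vs = (\<i> / 2) * clifford (complexify (e y)) (\<psi> y) vs) \<and>
        (\<forall>y\<in>W. (Y c y, B c y) = Psi (H0 c) e y))"

section \<open>The torus generated by a Killing field\<close>

text \<open>The global flow of \<open>X\<close>, a smooth one-parameter group of transformations.\<close>
definition is_flow ::
  "('a::topological_space, 'm::finite) chart set \<Rightarrow> (('a, 'm) chart \<Rightarrow> real^'m \<Rightarrow> real^'m) \<Rightarrow>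
   (real \<Rightarrow> 'a \<Rightarrow> 'a) \<Rightarrow> bool" where
  "is_flow A X \<Phi> \<longleftrightarrow>
     continuous_on UNIV (\<lambda>(t, p). \<Phi> t p) \<and>
     (\<forall>c\<in>A. \<forall>c'\<in>A. smooth_on {(t, x). x \<in> img c \<and> \<Phi> t (param c x) \<in> dom c'}
        (\<lambda>(t, x). chart_rep c c' (\<Phi> t) x)) \<and>
     \<Phi> 0 = id \<and> (\<forall>s t. \<Phi> (s + t) = \<Phi> s \<circ> \<Phi> t) \<and>
     (\<forall>c\<in>A. \<forall>p\<in>dom c. ((\<lambda>t. coord c (\<Phi> t p)) has_vector_derivative X c (coord c p)) (at 0))"

definition Isom ::
  "('a::topological_space, 'm::finite) chart set \<Rightarrow> (('a, 'm) chart \<Rightarrow> real^'m \<Rightarrow> real^'m^'m) \<Rightarrow> ('a \<Rightarrow> 'a) set" where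
  "Isom A g = {f. bij f \<and> smooth_map A f \<and> smooth_map A (inv f) \<and>
     preserves A f (\<lambda>c x. bilin (g c x))}"

definition compact_open_topology :: "('a::topological_space \<Rightarrow> 'a) topology" where
  "compact_open_topology = topology_generated_by {{f. f ` K \<subseteq> U} | K U. compact K \<and> open U}"

text \<open>The closure of the flow in \<open>Isom A g\<close> with the compact-open topology.\<close>
definition torus_generated ::
  "('a::topological_space, 'm::finite) chart set \<Rightarrow> (('a, 'm) chart \<Rightarrow> real^'m \<Rightarrow> real^'m^'m) \<Rightarrow>
   (real \<Rightarrow> 'a \<Rightarrow> 'a) \<Rightarrow> ('a \<Rightarrow> 'a) set" where
  "torus_generated A g \<Phi> = subtopology compact_open_topology (Isom A g) closure_of range \<Phi>"

end

theory Submission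
  imports Defs
begin

text \<open>
  Write \<open>I', J'\<close> for the two generalized complex structures and \<open>\<pi>\<close> for the Poisson tensor of \<open>J'\<close>.
  Where \<open>\<pi>\<close> is invertible, the \<open>\<i>\<close>-eigenbundle of \<open>J'\<close> is \<open>{Z - i\<^sub>Z \<beta>}\<close> for a complex \<open>2\<close>-form
  \<open>\<beta> = K + \<i> \<Omega>\<close> that is algebraic in \<open>g, I, J, b\<close>, with \<open>\<Omega> = - \<pi>\<^bsup>-1\<^esup>\<close>; so a pure spinor is
  \<open>\<psi> = f e\<^sup>\<beta>\<close>, and the equation \<open>d\<^sub>H \<psi> = (\<i>/2) (Y + \<eta>) \<cdot> \<psi>\<close> says \<open>d \<beta> = H\<close> and
  \<open>df = (\<i>/2) (i\<^sub>Y \<beta> + \<eta>) f\<close>.  The real part of the second equation is \<open>d log |f|\<^sup>2 = - i\<^sub>Y \<Omega>\<close>.  The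
  normalization identifies \<open>(2 \<i>)\<^sup>n vol\<close> with the top component of \<open>|f|\<^sup>2 e\<^bsup>2 \<i> \<Omega>\<^esup>\<close>, and as \<open>\<Omega>\<close> is closed
  this makes \<open>Y\<close> the divergence \<open>X\<close> of \<open>\<pi>\<close>.  The imaginary part gives \<open>d \<eta> = - d (i\<^sub>Y K)\<close>, so the \<open>2\<close>-form
  \<open>d \<eta> - i\<^sub>Y H\<close> of \<open>div J'\<close> is \<open>- L\<^sub>Y K\<close>, which vanishes because \<open>X\<close> preserves \<open>g, I, J\<close> and, by invariance
  under the flow, \<open>b\<close>.  By density and continuity \<open>div J' = X\<close> everywhere, and \<open>L\<^sub>X I' = 0\<close> since \<open>I'\<close> is built
  from \<open>g, I, J, b\<close>.  The flow of \<open>X\<close> lies in the torus because it consists of isometries.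
\<close>

section \<open>Calculus of smooth maps\<close>

text \<open>No exponential or power of a form is ever built. The form f e^\<beta> is characterized
  by its scalar part f and the rule i_z \<psi> = (i_z \<beta>) wedge \<psi> for all vectors z. With
  forms as functions on lists this rule is a recursion on the argument list, so identities between
  such forms reduce to degree 0; and it says exactly that z - i_z \<beta> annihilates \<psi>.

  The passage from the normalization to Y = X is a Pfaffian computation in disguise. The top
  component of |f|^2 e^(2i \<Omega>) is, up to a constant, |f|^2 times the Pfaffian of \<Omega>,
  whose logarithmic derivative is half the trace of the inverse of \<Omega> times the derivative of
  \<Omega>. Since \<Omega> is closed, \<pi> has divergence zero for the Liouville volume; so only
  the derivative of |f|^2 survives, and \<pi> turns it back into Y.

  No branch of log f is chosen: the closedness of df / f comes from the symmetry of the second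
  derivatives of f. On the global side, the torus lies in the isometries of the whole manifold, so
  the infinitesimal invariance of g has to be integrated along orbits that may leave every
  chart.\<close>

lemma smooth_on_differentiable: "smooth_on S f \<Longrightarrow> x \<in> S \<Longrightarrow> f differentiable (at x)"
  unfolding smooth_on_def by (metis Ck_on.simps(2))

lemma smooth_on_continuous_on: "smooth_on S f \<Longrightarrow> continuous_on S f"
  unfolding smooth_on_def by (metis Ck_on.simps(1))

lemma smooth_on_frechet_derivative:
  "smooth_on S f \<Longrightarrow> smooth_on S (\<lambda>x. frechet_derivative f (at x) v)"
  unfolding smooth_on_def by (metis Ck_on.simps(2))

lemma smooth_on_subset: "smooth_on S f \<Longrightarrow> T \<subseteq> S \<Longrightarrow> smooth_on T f"
proof -
  have "Ck_on k S f \<Longrightarrow> T \<subseteq> S \<Longrightarrow> Ck_on k T f" for k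
    by (induction k arbitrary: f) (auto intro: continuous_on_subset)
  then show "smooth_on S f \<Longrightarrow> T \<subseteq> S \<Longrightarrow> smooth_on T f"
    unfolding smooth_on_def by blast
qed

lemma smooth_on_const: "smooth_on S (\<lambda>x. c)"
proof -
  have "Ck_on k S (\<lambda>x. c)" for k
    by (induction k arbitrary: c) auto
  then show ?thesis unfolding smooth_on_def by blast
qed

lemma has_derivative_frechet:
  "f differentiable (at x) \<Longrightarrow> (f has_derivative frechet_derivative f (at x)) (at x)"
  by (simp add: frechet_derivative_works)

lemma frechet_derivative_eqI:
  "(f has_derivative f') (at x) \<Longrightarrow> frechet_derivative f (at x) = f'"
  by (metis frechet_derivative_at)

text \<open>No differentiability is assumed: \<open>frechet_derivative\<close> is a choice among the
  derivatives at the point, and which maps are derivatives depends only on the germ of the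
  function.\<close>

lemma frechet_derivative_cong_open:
  assumes "open S" "x \<in> S" "\<And>y. y \<in> S \<Longrightarrow> f y = g y"
  shows "frechet_derivative f (at x) = frechet_derivative g (at x)"
proof -
  have "(f has_derivative D) (at x) \<longleftrightarrow> (g has_derivative D) (at x)" for D
    by (metis assms has_derivative_transform_within_open)
  then show ?thesis unfolding frechet_derivative_def by simp
qed

lemma differentiable_cong_open:
  assumes "open S" "x \<in> S" "\<And>y. y \<in> S \<Longrightarrow> f y = g y" "f differentiable (at x)"
  shows "g differentiable (at x)"
  using assms unfolding differentiable_def by (metis has_derivative_transform_within_open)

lemma Ck_on_cong:
  assumes "open S" "\<And>y. y \<in> S \<Longrightarrow> f y = g y" "Ck_on k S f"
  shows "Ck_on k S g"
  using assms(2,3)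
proof (induction k arbitrary: f g)
  case 0
  then show ?case by (metis Ck_on.simps(1) continuous_on_cong)
next
  case (Suc k)
  have "g differentiable (at x)" if "x \<in> S" for x
    using differentiable_cong_open[OF assms(1) that, of f g] Suc.prems that by simp
  moreover have "Ck_on k S (\<lambda>x. frechet_derivative g (at x) v)" for v
    by (rule Suc.IH[of "\<lambda>x. frechet_derivative f (at x) v"])
      (use Suc.prems frechet_derivative_cong_open[OF assms(1), of _ f g] in auto)
  ultimately show ?case by simp
qed

text \<open>This serves to freeze the time variable of a flow. The derivative of the composite in
  direction \<open>v\<close> is again such a composite, with \<open>f\<close> replaced by its
  derivative in direction \<open>L v\<close>; so the induction on the order runs over all
  \<open>f\<close>.\<close>

lemma smooth_on_affine:
  assumes "smooth_on S f" "open T" "bounded_linear L" "\<And>x. x \<in> T \<Longrightarrow> c + L x \<in> S"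
  shows "smooth_on T (\<lambda>x. f (c + L x))"
proof -
  have der: "((\<lambda>x. f (c + L x)) has_derivative (\<lambda>v. frechet_derivative f (at (c + L x)) (L v))) (at x)"
    if "f differentiable (at (c + L x))" for f :: "'a \<Rightarrow> 'b" and x
  proof -
    have "((\<lambda>x. c + L x) has_derivative L) (at x)"
      using bounded_linear_imp_has_derivative[OF assms(3)] by (auto intro!: derivative_eq_intros)
    from diff_chain_at[OF this has_derivative_frechet[OF that]] show ?thesis
      by (simp add: o_def)
  qed
  have "Ck_on k T (\<lambda>x. f (c + L x))" if "Ck_on k S f" for k
    using that
  proof (induction k arbitrary: f)
    case 0
    have "continuous_on T (\<lambda>x. c + L x)"
      by (intro continuous_intros linear_continuous_on assms(3))
    with 0 show ?case
      using assms(4) by (auto intro!: continuous_on_compose2[of S f T])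
  next
    case (Suc k)
    have d: "f differentiable (at (c + L x))" if "x \<in> T" for x
      using Suc.prems assms(4)[OF that] by simp
    have "Ck_on k T (\<lambda>x. frechet_derivative (\<lambda>x. f (c + L x)) (at x) v)" for v
    proof (rule Ck_on_cong[OF assms(2)])
      show "Ck_on k T (\<lambda>x. frechet_derivative f (at (c + L x)) (L v))"
        using Suc.IH[of "\<lambda>z. frechet_derivative f (at z) (L v)"] Suc.prems by simp
    qed (simp add: frechet_derivative_eqI[OF der[OF d]])
    then show ?case using differentiableI[OF der[OF d]] by simp
  qed
  then show ?thesis using assms(1) unfolding smooth_on_def by blast
qed

section \<open>Symmetry of second derivatives\<close>

lemma mixed_partials_real:
  fixes F :: "real \<Rightarrow> real \<Rightarrow> real"
  assumes "d > 0"
    and F1: "\<And>s t. \<bar>s\<bar> < d \<Longrightarrow> \<bar>t\<bar> < d \<Longrightarrow> ((\<lambda>s. F s t) has_real_derivative F1 s t) (at s)"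
    and F2: "\<And>s t. \<bar>s\<bar> < d \<Longrightarrow> \<bar>t\<bar> < d \<Longrightarrow> ((\<lambda>t. F s t) has_real_derivative F2 s t) (at t)"
    and F12: "\<And>s t. \<bar>s\<bar> < d \<Longrightarrow> \<bar>t\<bar> < d \<Longrightarrow> ((\<lambda>t. F1 s t) has_real_derivative F12 s t) (at t)"
    and F21: "\<And>s t. \<bar>s\<bar> < d \<Longrightarrow> \<bar>t\<bar> < d \<Longrightarrow> ((\<lambda>s. F2 s t) has_real_derivative F21 s t) (at s)"
    and c12: "isCont (\<lambda>z. F12 (fst z) (snd z)) (0, 0)"
    and c21: "isCont (\<lambda>z. F21 (fst z) (snd z)) (0, 0)"
  shows "F12 0 0 = F21 0 0"
proof (rule ccontr)
  assume ne: "F12 0 0 \<noteq> F21 0 0"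
  define \<epsilon> where "\<epsilon> = \<bar>F12 0 0 - F21 0 0\<bar> / 2"
  have "\<epsilon> > 0" using ne by (simp add: \<epsilon>_def)
  from c12[unfolded continuous_at_eps_delta, rule_format, OF this] obtain d1 where d1: "d1 > 0"
    "\<And>z. dist z (0, 0) < d1 \<Longrightarrow> dist (F12 (fst z) (snd z)) (F12 0 0) < \<epsilon>" by auto
  from c21[unfolded continuous_at_eps_delta, rule_format, OF \<open>\<epsilon> > 0\<close>] obtain d2 where d2: "d2 > 0"
    "\<And>z. dist z (0, 0) < d2 \<Longrightarrow> dist (F21 (fst z) (snd z)) (F21 0 0) < \<epsilon>" by auto
  \<comment> \<open>With a third of each radius, the square of side \<open>r\<close> stays inside
    the domain of the partial derivatives, and its interior points lie in both neighbourhoods of the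
    origin given by continuity.\<close>
  define r where "r = min d (min d1 d2) / 3"
  have r: "r > 0" "3 * r \<le> d" "3 * r \<le> d1" "3 * r \<le> d2"
    using \<open>d > 0\<close> d1 d2 by (auto simp: r_def)
  have small: "dist (s, t) (0, 0) < 3 * r" if "0 < s" "s < r" "0 < t" "t < r" for s t :: real
  proof -
    have "dist (s, t) (0, 0) \<le> \<bar>s\<bar> + \<bar>t\<bar>"
      using sqrt_sum_squares_le_sum_abs[of s t] by (simp add: dist_Pair_Pair)
    also have "\<dots> < 3 * r" using that by simp
    finally show ?thesis .
  qed
  \<comment> \<open>The second difference of \<open>F\<close> over the square is evaluated twice by
    the mean value theorem, once differencing in \<open>s\<close> first and once in \<open>t\<close>
    first. This gives \<open>F12\<close> and \<open>F21\<close> the same value at two possibly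
    different interior points.\<close>
  have "\<exists>s>0. s < r \<and> (F r r - F r 0) - (F 0 r - F 0 0) = (r - 0) * (F1 s r - F1 s 0)"
    using r by (intro MVT2) (auto intro!: derivative_intros F1)
  then obtain s where s: "0 < s" "s < r" "(F r r - F r 0) - (F 0 r - F 0 0) = r * (F1 s r - F1 s 0)"
    by auto
  have "\<exists>t>0. t < r \<and> F1 s r - F1 s 0 = (r - 0) * F12 s t"
    using r s by (intro MVT2) (auto intro!: F12)
  then obtain t where t: "0 < t" "t < r" "F1 s r - F1 s 0 = r * F12 s t" by auto
  have "\<exists>t>0. t < r \<and> (F r r - F 0 r) - (F r 0 - F 0 0) = (r - 0) * (F2 r t - F2 0 t)"
    using r by (intro MVT2) (auto intro!: derivative_intros F2)
  then obtain t' where t': "0 < t'" "t' < r" "(F r r - F 0 r) - (F r 0 - F 0 0) = r * (F2 r t' - F2 0 t')"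
    by auto
  have "\<exists>s>0. s < r \<and> F2 r t' - F2 0 t' = (r - 0) * F21 s t'"
    using r t' by (intro MVT2) (auto intro!: F21)
  then obtain s' where s': "0 < s'" "s' < r" "F2 r t' - F2 0 t' = r * F21 s' t'" by auto
  have "r * (r * F12 s t) = r * (r * F21 s' t')"
    unfolding t(3)[symmetric] s'(3)[symmetric] s(3)[symmetric] t'(3)[symmetric] by simp
  then have eq: "F12 s t = F21 s' t'" using r by simp
  have "dist (F12 s t) (F12 0 0) < \<epsilon>" using d1(2)[of "(s, t)"] small[of s t] s t r by simp
  moreover have "dist (F21 s' t') (F21 0 0) < \<epsilon>" using d2(2)[of "(s', t')"] small[of s' t'] s' t' r by simp
  ultimately have "2 * \<epsilon> > \<bar>(F12 s t - F21 0 0) - (F12 s t - F12 0 0)\<bar>"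
    using abs_triangle_ineq4[of "F12 s t - F21 0 0" "F12 s t - F12 0 0"] eq by (simp add: dist_real_def)
  then show False by (simp add: \<epsilon>_def)
qed

lemma symmetric_second_derivative:
  fixes f :: "'v::real_normed_vector \<Rightarrow> 'w::euclidean_space"
  assumes "smooth_on S f" "open S" "x \<in> S"
  shows "frechet_derivative (\<lambda>y. frechet_derivative f (at y) u) (at x) v =
         frechet_derivative (\<lambda>y. frechet_derivative f (at y) v) (at x) u"
proof (rule euclidean_eqI)
  fix b :: 'w assume "b \<in> Basis"
  \<comment> \<open>Restriction to the plane through \<open>x\<close> spanned by \<open>u\<close>
    and \<open>v\<close>, and to one component of the values, reduces the claim to real functions of
    two real variables.\<close>
  define p where "p s t = x + s *\<^sub>R u + t *\<^sub>R v" for s t :: real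
  have "continuous_on UNIV (\<lambda>z. p (fst z) (snd z))"
    unfolding p_def by (intro continuous_intros)
  then have "open ((\<lambda>z. p (fst z) (snd z)) -` S)"
    using assms(2) by (simp add: open_vimage)
  moreover have "(0, 0) \<in> (\<lambda>z. p (fst z) (snd z)) -` S" using assms(3) by (simp add: p_def)
  ultimately obtain e where e: "e > 0" "ball (0, 0) e \<subseteq> (\<lambda>z. p (fst z) (snd z)) -` S"
    by (meson open_contains_ball)
  define d where "d = e / 2"
  have "d > 0" using e by (simp add: d_def)
  have pS: "p s t \<in> S" if "\<bar>s\<bar> < d" "\<bar>t\<bar> < d" for s t
  proof -
    have "dist (0, 0) (s, t) \<le> \<bar>s\<bar> + \<bar>t\<bar>"
      using sqrt_sum_squares_le_sum_abs[of s t] by (simp add: dist_Pair_Pair)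
    then have "(s, t) \<in> ball (0, 0) e" using that by (simp add: d_def)
    then show ?thesis using e by auto
  qed
  have ds: "((\<lambda>s. h (p s t) \<bullet> b) has_real_derivative frechet_derivative h (at (p s t)) u \<bullet> b) (at s)"
    and dt: "((\<lambda>t. h (p s t) \<bullet> b) has_real_derivative frechet_derivative h (at (p s t)) v \<bullet> b) (at t)"
    if "smooth_on S h" "\<bar>s\<bar> < d" "\<bar>t\<bar> < d" for h :: "'v \<Rightarrow> 'w" and s t
  proof -
    note h = has_derivative_frechet[OF smooth_on_differentiable[OF that(1) pS[OF that(2,3)]]]
    have lin: "frechet_derivative h (at (p s t)) (c *\<^sub>R w) = c *\<^sub>R frechet_derivative h (at (p s t)) w" for c w
      by (rule linear_scale[OF has_derivative_linear[OF h]])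
    have "((\<lambda>s. p s t) has_derivative (\<lambda>c. c *\<^sub>R u)) (at s)"
      unfolding p_def by (auto intro!: derivative_eq_intros)
    from has_derivative_inner_left[OF has_derivative_compose[OF this h]]
    show "((\<lambda>s. h (p s t) \<bullet> b) has_real_derivative frechet_derivative h (at (p s t)) u \<bullet> b) (at s)"
      by (simp add: has_field_derivative_def lin mult_commute_abs)
    have "((\<lambda>t. p s t) has_derivative (\<lambda>c. c *\<^sub>R v)) (at t)"
      unfolding p_def by (auto intro!: derivative_eq_intros)
    from has_derivative_inner_left[OF has_derivative_compose[OF this h]]
    show "((\<lambda>t. h (p s t) \<bullet> b) has_real_derivative frechet_derivative h (at (p s t)) v \<bullet> b) (at t)"
      by (simp add: has_field_derivative_def lin mult_commute_abs)
  qed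
  have cont: "isCont (\<lambda>z. h (p (fst z) (snd z)) \<bullet> b) (0, 0)" if "smooth_on S h" for h :: "'v \<Rightarrow> 'w"
  proof -
    have "isCont h (p 0 0)"
      using smooth_on_differentiable[OF that pS[of 0 0]] \<open>d > 0\<close>
      by (simp add: differentiable_imp_continuous_within)
    moreover have "isCont (\<lambda>z. p (fst z) (snd z)) (0, 0)"
      unfolding p_def by (intro continuous_intros)
    ultimately have "isCont (\<lambda>z. h (p (fst z) (snd z))) (0, 0)"
      using isCont_o2[of "(0, 0)" "\<lambda>z. p (fst z) (snd z)" h] by simp
    then show ?thesis by (intro continuous_intros)
  qed
  note su = smooth_on_frechet_derivative[OF assms(1), of u]
  note sv = smooth_on_frechet_derivative[OF assms(1), of v]
  let ?D = "\<lambda>h w s t. frechet_derivative h (at (p s t)) w \<bullet> b"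
  let ?fu = "\<lambda>y. frechet_derivative f (at y) u" and ?fv = "\<lambda>y. frechet_derivative f (at y) v"
  have "?D ?fu v 0 0 = ?D ?fv u 0 0"
  proof (rule mixed_partials_real[OF \<open>d > 0\<close>, where F = "\<lambda>s t. f (p s t) \<bullet> b"
        and ?F1.0 = "?D f u" and ?F2.0 = "?D f v" and ?F12.0 = "?D ?fu v" and ?F21.0 = "?D ?fv u"])
    show "isCont (\<lambda>z. ?D ?fu v (fst z) (snd z)) (0, 0)"
      by (rule cont[OF smooth_on_frechet_derivative[OF su]])
    show "isCont (\<lambda>z. ?D ?fv u (fst z) (snd z)) (0, 0)"
      by (rule cont[OF smooth_on_frechet_derivative[OF sv]])
  qed (fact ds[OF assms(1)] dt[OF assms(1)] dt[OF su] ds[OF sv])+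
  then show "frechet_derivative (\<lambda>y. frechet_derivative f (at y) u) (at x) v \<bullet> b =
        frechet_derivative (\<lambda>y. frechet_derivative f (at y) v) (at x) u \<bullet> b"
    by (simp add: p_def)
qed

section \<open>Wedge products and exponentials of two-forms\<close>

lemma wedge_Nil [simp]: "wedge \<alpha> \<beta> [] = \<alpha> [] * \<beta> []"
  by (simp add: wedge_def)

text \<open>This is the rule that contraction with a vector is an antiderivation. The shuffles are
  split by whether position 0 lies in \<open>S\<close>. If it does, it is in no inversion; if it
  does not, it forms one inversion with each element of \<open>S\<close>, which yields the sign of
  the degree of \<alpha>.\<close>

lemma wedge_Cons:
  "wedge \<alpha> \<beta> (v # vs) = wedge (\<lambda>us. \<alpha> (v # us)) \<beta> vs
     + wedge (\<lambda>us. (-1) ^ length us * \<alpha> us) (\<lambda>us. \<beta> (v # us)) vs"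
proof -
  define n where "n = length vs"
  define N where "N m S = {(i, j). i < j \<and> j < m \<and> i \<notin> S \<and> j \<in> S}" for m and S :: "nat set"
  define t where "t S = (-1) ^ card (N (Suc n) S) * \<alpha> (nths (v # vs) S) * \<beta> (nths (v # vs) (- S))" for S
  have fin: "finite (N m S)" for m S
    by (rule finite_subset[of _ "{..<m} \<times> {..<m}"]) (auto simp: N_def)
  have P: "Pow {..<Suc n} = image Suc ` Pow {..<n} \<union> insert 0 ` image Suc ` Pow {..<n}"
    unfolding lessThan_Suc_eq_insert_0 Pow_insert
    by (metis image_Pow_surj)
  have inj: "inj_on (image Suc) (Pow {..<n})" "inj_on (insert 0) (image Suc ` Pow {..<n})"
    by (auto simp: inj_on_def)
  have "wedge \<alpha> \<beta> (v # vs) = sum t (Pow {..<Suc n})"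
    by (simp add: wedge_def t_def N_def n_def)
  also have "\<dots> = sum t (image Suc ` Pow {..<n}) + sum t (insert 0 ` image Suc ` Pow {..<n})"
    unfolding P by (rule sum.union_disjoint) auto
  also have "\<dots> = (\<Sum>T\<in>Pow {..<n}. t (Suc ` T)) + (\<Sum>T\<in>Pow {..<n}. t (insert 0 (Suc ` T)))"
    using inj by (simp add: sum.reindex)
  also have "(\<Sum>T\<in>Pow {..<n}. t (insert 0 (Suc ` T))) = wedge (\<lambda>us. \<alpha> (v # us)) \<beta> vs"
  proof -
    have "N (Suc n) (insert 0 (Suc ` T)) = map_prod Suc Suc ` N n T" for T
    proof (rule set_eqI)
      fix z :: "nat \<times> nat"
      obtain i j where "z = (i, j)" by fastforce
      then show "z \<in> N (Suc n) (insert 0 (Suc ` T)) \<longleftrightarrow> z \<in> map_prod Suc Suc ` N n T"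
        by (cases i; cases j) (auto simp: N_def image_iff)
    qed
    then have "card (N (Suc n) (insert 0 (Suc ` T))) = card (N n T)" for T
      by (auto intro!: card_image simp: inj_on_def)
    moreover have "{j. Suc j \<in> insert 0 (Suc ` T)} = T" "{j. Suc j \<in> - insert 0 (Suc ` T)} = - T" for T
      by auto
    ultimately show ?thesis
      by (auto simp: wedge_def t_def N_def n_def nths_Cons intro!: sum.cong)
  qed
  also have "(\<Sum>T\<in>Pow {..<n}. t (Suc ` T)) =
      wedge (\<lambda>us. (-1) ^ length us * \<alpha> us) (\<lambda>us. \<beta> (v # us)) vs"
  proof -
    have "card (N (Suc n) (Suc ` T)) = card (N n T) + card T" if "T \<subseteq> {..<n}" for T
    proof -
      have "N (Suc n) (Suc ` T) = map_prod Suc Suc ` N n T \<union> Pair 0 ` Suc ` T"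
      proof (rule set_eqI)
        fix z :: "nat \<times> nat"
        obtain i j where "z = (i, j)" by fastforce
        then show "z \<in> N (Suc n) (Suc ` T) \<longleftrightarrow> z \<in> map_prod Suc Suc ` N n T \<union> Pair 0 ` Suc ` T"
          using that by (cases i; cases j) (auto simp: N_def image_iff)
      qed
      moreover have "finite T" using that finite_subset by blast
      then have "finite (Pair (0::nat) ` Suc ` T)" by blast
      moreover have "map_prod Suc Suc ` N n T \<inter> Pair 0 ` Suc ` T = {}" by auto
      moreover have "card (map_prod Suc Suc ` N n T) = card (N n T)"
        by (rule card_image) (auto simp: inj_on_def)
      moreover have "card (Pair (0::nat) ` Suc ` T) = card T"
        by (simp add: card_image inj_on_def)
      ultimately show ?thesis using fin by (simp add: card_Un_disjoint)
    qed
    moreover have "length (nths vs T) = card T" if "T \<subseteq> {..<n}" for T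
      using that by (auto simp: length_nths n_def intro!: arg_cong[where f=card])
    moreover have "{j. Suc j \<in> Suc ` T} = T" "{j. Suc j \<in> - Suc ` T} = - T" for T
      by auto
    ultimately show ?thesis
      by (auto simp: wedge_def t_def N_def n_def nths_Cons power_add mult_ac intro!: sum.cong)
  qed
  finally show ?thesis by (simp add: add.commute)
qed

lemma wedge_zero_left [simp]: "wedge (\<lambda>us. 0) \<beta> vs = 0"
  by (simp add: wedge_def)

lemma wedge_uminus_left: "wedge (\<lambda>us. - \<alpha> us) \<beta> vs = - wedge \<alpha> \<beta> vs"
  by (simp add: wedge_def sum_negf)

lemma wedge_uminus_right: "wedge \<alpha> (\<lambda>us. - \<beta> us) vs = - wedge \<alpha> \<beta> vs"
  by (simp add: wedge_def sum_negf)

lemma wedge_diff_left: "wedge (\<lambda>us. c * \<alpha> us - \<beta> us) \<gamma> vs = c * wedge \<alpha> \<gamma> vs - wedge \<beta> \<gamma> vs"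
  by (simp add: wedge_def sum_distrib_left sum_subtractf algebra_simps)

lemma wedge_diff_right: "wedge \<gamma> (\<lambda>us. c * \<alpha> us - \<beta> us) vs = c * wedge \<gamma> \<alpha> vs - wedge \<gamma> \<beta> vs"
  by (simp add: wedge_def sum_distrib_left sum_subtractf algebra_simps)

text \<open>The product with a one-form, written through the antiderivation rule for contraction.
  Neither \<xi> has to be linear nor \<alpha> alternating, so its algebra is proved by induction on
  the argument list for arbitrary functions.\<close>

fun wedge1 :: "('v \<Rightarrow> 'k::comm_ring_1) \<Rightarrow> ('v list \<Rightarrow> 'k) \<Rightarrow> 'v list \<Rightarrow> 'k" where
  "wedge1 \<xi> \<alpha> [] = 0"
| "wedge1 \<xi> \<alpha> (v # vs) = \<xi> v * \<alpha> vs - wedge1 \<xi> (\<lambda>us. \<alpha> (v # us)) vs"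

lemma wedge1_add: "wedge1 \<xi> (\<lambda>us. \<alpha> us + \<beta> us) vs = wedge1 \<xi> \<alpha> vs + wedge1 \<xi> \<beta> vs"
  by (induction vs arbitrary: \<alpha> \<beta>) (auto simp: algebra_simps)

lemma wedge1_cmult: "wedge1 \<xi> (\<lambda>us. c * \<alpha> us) vs = c * wedge1 \<xi> \<alpha> vs"
  by (induction vs arbitrary: \<alpha>) (auto simp: algebra_simps)

lemma wedge1_uminus: "wedge1 \<xi> (\<lambda>us. - \<alpha> us) vs = - wedge1 \<xi> \<alpha> vs"
  using wedge1_cmult[of \<xi> "-1" \<alpha> vs] by simp

lemma wedge1_diff: "wedge1 \<xi> (\<lambda>us. \<alpha> us - \<beta> us) vs = wedge1 \<xi> \<alpha> vs - wedge1 \<xi> \<beta> vs"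
  by (induction vs arbitrary: \<alpha> \<beta>) (auto simp: algebra_simps)

lemma wedge1_sum: "wedge1 \<xi> (\<lambda>us. \<Sum>j\<in>A. \<alpha> j us) vs = (\<Sum>j\<in>A. wedge1 \<xi> (\<alpha> j) vs)"
  by (induction vs arbitrary: \<alpha>) (auto simp: sum_distrib_left sum_subtractf)

lemma wedge1_add_left: "wedge1 (\<lambda>v. \<xi> v + \<eta> v) \<alpha> vs = wedge1 \<xi> \<alpha> vs + wedge1 \<eta> \<alpha> vs"
  by (induction vs arbitrary: \<alpha>) (auto simp: algebra_simps)

lemma wedge1_cmult_left: "wedge1 (\<lambda>v. c * \<xi> v) \<alpha> vs = c * wedge1 \<xi> \<alpha> vs"
  by (induction vs arbitrary: \<alpha>) (auto simp: algebra_simps)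

lemma wedge1_sum_left: "wedge1 (\<lambda>v. \<Sum>j\<in>A. \<xi> j v) \<alpha> vs = (\<Sum>j\<in>A. wedge1 (\<xi> j) \<alpha> vs)"
  by (induction vs arbitrary: \<alpha>) (auto simp: sum_distrib_right sum_subtractf)

lemma wedge1_anticommute: "wedge1 \<xi> (wedge1 \<eta> \<alpha>) vs = - wedge1 \<eta> (wedge1 \<xi> \<alpha>) vs"
  by (induction vs arbitrary: \<alpha>) (auto simp: wedge1_diff wedge1_cmult)

lemma wedge_scalar_left:
  "(\<And>us. us \<noteq> [] \<Longrightarrow> \<alpha> us = 0) \<Longrightarrow> wedge \<alpha> \<beta> vs = \<alpha> [] * \<beta> vs"
proof (induction vs arbitrary: \<alpha> \<beta>)
  case (Cons v vs)
  have "wedge (\<lambda>us. (-1) ^ length us * \<alpha> us) (\<lambda>us. \<beta> (v # us)) vs = \<alpha> [] * \<beta> (v # vs)"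
    by (subst Cons.IH) (use Cons.prems in auto)
  then show ?case by (simp add: wedge_Cons Cons.prems)
qed simp

lemma wedge_degree_one:
  assumes "\<And>us. length us \<noteq> 1 \<Longrightarrow> \<alpha> us = 0"
  shows "wedge \<alpha> \<beta> vs = wedge1 (\<lambda>v. \<alpha> [v]) \<beta> vs"
  using assms
proof (induction vs arbitrary: \<alpha> \<beta>)
  case (Cons v vs)
  have "(\<lambda>us. (-1) ^ length us * \<alpha> us) = (\<lambda>us. - \<alpha> us)"
  proof
    show "(-1) ^ length us * \<alpha> us = - \<alpha> us" for us
      using Cons.prems[of us] by (cases "length us = 1") auto
  qed
  moreover have "wedge (\<lambda>us. \<alpha> (v # us)) \<beta> vs = \<alpha> [v] * \<beta> vs"
    by (subst wedge_scalar_left) (use Cons.prems in auto)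
  ultimately show ?case
    by (simp add: wedge_Cons wedge_uminus_left Cons.IH[OF Cons.prems])
qed simp

lemma wedge_wedge1_left:
  fixes \<alpha> \<beta> :: "('m::finite, 'k::comm_ring_1) form"
  shows "wedge (wedge1 \<xi> \<alpha>) \<beta> vs = wedge1 \<xi> (wedge \<alpha> \<beta>) vs"
proof (induction vs arbitrary: \<alpha> \<beta>)
  case (Cons v vs)
  have sgn: "(\<lambda>us. (-1) ^ length us * wedge1 \<xi> \<alpha> us) = (\<lambda>us. - wedge1 \<xi> (\<lambda>us. (-1) ^ length us * \<alpha> us) us)"
    for \<alpha> :: "('m, 'k) form"
  proof
    show "(-1) ^ length us * wedge1 \<xi> \<alpha> us = - wedge1 \<xi> (\<lambda>us. (-1) ^ length us * \<alpha> us) us" for us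
    proof (induction us arbitrary: \<alpha>)
      case (Cons a us)
      show ?case using Cons.IH[of "\<lambda>us. \<alpha> (a # us)"] by (simp add: wedge1_uminus algebra_simps)
    qed simp
  qed
  show ?case
    by (simp add: wedge_Cons sgn wedge_uminus_left wedge_diff_left wedge1_add Cons.IH)
qed simp

text \<open>Moving the one-form to the front past \<alpha> costs the sign of the degree of \<alpha>.
  The grading involution on the left cancels it, and this is also the shape in which \<alpha>
  appears in \<open>wedge_Cons\<close>.\<close>

lemma wedge_wedge1_right:
  fixes \<alpha> \<beta> :: "('m::finite, 'k::comm_ring_1) form"
  shows "wedge (\<lambda>us. (-1) ^ length us * \<alpha> us) (wedge1 \<xi> \<beta>) vs = wedge1 \<xi> (wedge \<alpha> \<beta>) vs"
proof (induction vs arbitrary: \<alpha> \<beta>)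
  case (Cons v vs)
  have h: "(-1) ^ length us * ((-1) ^ length us * a) = a" for us :: "(real^'m) list" and a :: 'k
    by (simp flip: mult.assoc power_mult_distrib)
  have "wedge \<alpha> (wedge1 \<xi> (\<lambda>us. \<beta> (v # us))) vs
      = wedge1 \<xi> (wedge (\<lambda>us. (-1) ^ length us * \<alpha> us) (\<lambda>us. \<beta> (v # us))) vs"
    using Cons.IH[of "\<lambda>us. (-1) ^ length us * \<alpha> us" "\<lambda>us. \<beta> (v # us)"] by (simp add: h)
  with Cons.IH[of "\<lambda>us. \<alpha> (v # us)" \<beta>] show ?case
    by (simp add: wedge_Cons h wedge_diff_right wedge_uminus_left wedge1_add)
qed simp

lemma wedge1_snoc:
  "wedge1 \<xi> \<alpha> (vs @ [v]) = wedge1 \<xi> (\<lambda>us. \<alpha> (us @ [v])) vs + (-1) ^ length vs * \<xi> v * \<alpha> vs"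
  by (induction vs arbitrary: \<alpha>) (auto simp: algebra_simps)

lemma wedge1_rev: "wedge1 \<xi> \<alpha> (rev vs) = - ((-1) ^ length vs * wedge1 \<xi> (\<lambda>us. \<alpha> (rev us)) vs)"
  by (induction vs arbitrary: \<alpha>) (auto simp: wedge1_snoc algebra_simps)

text \<open>Here one sees that \<alpha> is evaluated only on lists shorter by one, which drives the
  inductions on length, and that the sum has the shape of \<open>ext_d\<close>.\<close>

lemma wedge1_nth:
  "wedge1 \<xi> \<alpha> vs = (\<Sum>i<length vs. (-1) ^ i * \<xi> (vs ! i) * \<alpha> (take i vs @ drop (Suc i) vs))"
  by (induction vs arbitrary: \<alpha>)
    (auto simp: sum.lessThan_Suc_shift sum_negf simp del: sum.lessThan_Suc)

text \<open>A form satisfying this recursion is \<open>\<alpha> [] e\<^sup>\<beta>\<close>.\<close>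
lemma exp_recursion_unique:
  assumes "\<And>z vs. \<alpha> (z # vs) = wedge1 (\<beta> z) \<alpha> vs" and "\<alpha> [] = 0"
  shows "\<alpha> vs = 0"
proof (induction "length vs" arbitrary: vs rule: less_induct)
  case less
  show ?case
  proof (cases vs)
    case (Cons z us)
    then show ?thesis
      using less by (auto simp: assms(1) wedge1_nth intro!: sum.neutral)
  qed (use assms in simp)
qed

section \<open>Alternating forms and their values on coordinate bases\<close>

lemma alternating_linear: "alternating_form \<alpha> \<Longrightarrow> linear (\<lambda>v. \<alpha> (us @ v # ws))"
  by (simp add: alternating_form_def)

lemma alternating_repeat: "alternating_form \<alpha> \<Longrightarrow> \<alpha> (us @ v # ws @ v # zs) = 0"
  by (simp add: alternating_form_def)

lemma alternating_not_distinct: "alternating_form \<alpha> \<Longrightarrow> \<not> distinct vs \<Longrightarrow> \<alpha> vs = 0"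
  using not_distinct_decomp[of vs] by (auto simp: alternating_repeat)

lemma alternating_swap:
  assumes "alternating_form \<alpha>"
  shows "\<alpha> (us @ v # w # ws) = - \<alpha> (us @ w # v # ws)"
proof -
  have z: "\<alpha> (us @ u # u # ws) = 0" for u
    using alternating_repeat[OF assms, of us u "[]" ws] by simp
  have l1: "\<alpha> (us @ (v + w) # z # ws) = \<alpha> (us @ v # z # ws) + \<alpha> (us @ w # z # ws)" for z
    using linear_add[OF alternating_linear[OF assms, of us "z # ws"]] .
  have l2: "\<alpha> (us @ z # (v + w) # ws) = \<alpha> (us @ z # v # ws) + \<alpha> (us @ z # w # ws)" for z
    using linear_add[OF alternating_linear[OF assms, of "us @ [z]" ws]] by simp
  have "\<alpha> (us @ v # w # ws) + \<alpha> (us @ w # v # ws) = 0"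
    using z[of "v + w"] unfolding l1 l2 z[of v] z[of w] by (simp add: add.commute)
  then show ?thesis by (simp add: eq_neg_iff_add_eq_0)
qed

lemma alternating_move:
  assumes "alternating_form (\<alpha> :: ('m::finite, 'k::real_normed_algebra_1) form)"
  shows "\<alpha> (us @ v # ws @ zs) = (-1) ^ length ws * \<alpha> (us @ ws @ v # zs)"
proof (induction ws arbitrary: us)
  case (Cons w ws)
  show ?case
    using alternating_swap[OF assms, of us v w "ws @ zs"] Cons.IH[of "us @ [w]"] by simp
qed simp

lemma has_derivative_wedge1:
  fixes \<xi> :: "'a::real_normed_vector \<Rightarrow> 'v \<Rightarrow> 'k::real_normed_field"
  assumes "\<And>v. ((\<lambda>y. \<xi> y v) has_derivative \<xi>' v) (at x)"
    and "\<And>us. ((\<lambda>y. \<alpha> y us) has_derivative \<alpha>' us) (at x)"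
  shows "((\<lambda>y. wedge1 (\<xi> y) (\<alpha> y) vs) has_derivative
    (\<lambda>h. wedge1 (\<lambda>v. \<xi>' v h) (\<alpha> x) vs + wedge1 (\<xi> x) (\<lambda>us. \<alpha>' us h) vs)) (at x)"
  using assms(2)
proof (induction vs arbitrary: \<alpha> \<alpha>')
  case (Cons v vs)
  show ?case
    using has_derivative_diff[OF has_derivative_mult[OF assms(1)[of v] Cons.prems[of vs]]
        Cons.IH[of "\<lambda>y us. \<alpha> y (v # us)" "\<lambda>us. \<alpha>' (v # us)", OF Cons.prems]]
    by (simp add: algebra_simps)
qed simp

lemma vec_basis_sum: "(\<Sum>j\<in>UNIV. (v :: real^'m::finite) $ j *\<^sub>R axis j 1) = v"
  using basis_expansion[of v] by (simp add: scalar_mult_eq_scaleR)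

lemma linear_basis_sum:
  fixes f :: "real^'m::finite \<Rightarrow> 'k::real_vector"
  assumes "linear f"
  shows "f v = (\<Sum>j\<in>UNIV. v $ j *\<^sub>R f (axis j 1))"
proof -
  have "f v = f (\<Sum>j\<in>UNIV. v $ j *\<^sub>R axis j 1)" by (simp only: vec_basis_sum)
  also have "\<dots> = (\<Sum>j\<in>UNIV. v $ j *\<^sub>R f (axis j 1))"
    by (simp only: linear_sum[OF assms] linear_scale[OF assms])
  finally show ?thesis .
qed

text \<open>Only vanishing is carried along a permutation of the arguments, so signs of permutations
  need not be tracked. The prefix \<open>us\<close> collects the entries that are already in
  place.\<close>

lemma alternating_mset:
  fixes \<alpha> :: "('m::finite, 'k::real_normed_field) form"
  assumes "alternating_form \<alpha>"
  shows "mset xs = mset ys \<Longrightarrow> \<alpha> (us @ xs) = 0 \<Longrightarrow> \<alpha> (us @ ys) = 0"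
proof (induction xs arbitrary: us ys)
  case (Cons x xs)
  then have "x \<in> set ys" by (metis list.set_intros(1) mset_eq_setD)
  then obtain p q where ys: "ys = p @ x # q" by (meson split_list)
  with Cons.prems have "mset xs = mset (p @ q)" by simp
  with Cons.IH[of "p @ q" "us @ [x]"] Cons.prems have "\<alpha> (us @ x # p @ q) = 0" by simp
  then show ?case using alternating_move[OF assms, of us x p q] ys by simp
qed simp

definition axes :: "'m::finite list \<Rightarrow> (real^'m) list" where
  "axes ks = map (\<lambda>k. axis k 1) ks"

lemma distinct_axes: "distinct (axes ks) \<longleftrightarrow> distinct ks"
  by (auto simp: axes_def distinct_map inj_on_def axis_eq_axis)

lemma length_axes [simp]: "length (axes ks) = length ks"
  by (simp add: axes_def)

text \<open>The arguments are expanded in the basis one after the other, the expanded ones forming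
  the prefix \<open>axes us\<close>. In the end the indices either repeat or permute
  \<open>ks\<close>, and both give 0.\<close>

lemma alternating_axes_eq_0:
  fixes \<alpha> :: "('m::finite, 'k::real_normed_field) form"
  assumes "alternating_form \<alpha>" "distinct ks" "set ks = UNIV" "\<alpha> (axes ks) = 0"
    and "length vs = CARD('m)"
  shows "\<alpha> vs = 0"
proof -
  have "length us + length vs = CARD('m) \<Longrightarrow> \<alpha> (axes us @ vs) = 0" for us
  proof (induction vs arbitrary: us)
    case Nil
    show ?case
    proof (cases "distinct us")
      case True
      with Nil have "set us = UNIV"
        using card_subset_eq[of UNIV "set us"] distinct_card[of us] by simp
      with True assms have "mset ks = mset us"
        using set_eq_iff_mset_eq_distinct[of ks us] by simp
      then have "mset (axes ks) = mset (axes us)" by (simp add: axes_def)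
      from alternating_mset[OF assms(1) this, of "[]"] assms(4) show ?thesis by simp
    qed (use alternating_not_distinct[OF assms(1)] distinct_axes in auto)
  next
    case (Cons v vs)
    have "\<alpha> (axes us @ axis j 1 # vs) = 0" for j
      using Cons.IH[of "us @ [j]"] Cons.prems by (simp add: axes_def)
    then show ?case
      using linear_basis_sum[OF alternating_linear[OF assms(1), of "axes us" vs], of v] by simp
  qed
  from this[of "[]"] assms show ?thesis by (simp add: axes_def)
qed

text \<open>In the list the basis vector with index \<open>ks ! i\<close> is missing. Every other
  component of \<open>z\<close> repeats an entry, and moving the surviving one to its place costs
  \<open>i\<close> transpositions. This reads off components of \<open>z\<close> from the
  contraction of a top form.\<close>

lemma alternating_axes_replace:
  fixes \<alpha> :: "('m::finite, real) form"
  assumes "alternating_form \<alpha>" "distinct ks" "set ks = UNIV" "i < length ks"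
  shows "\<alpha> (z # take i (axes ks) @ drop (Suc i) (axes ks)) = (-1) ^ i * z $ (ks ! i) * \<alpha> (axes ks)"
proof -
  let ?R = "take i (axes ks) @ drop (Suc i) (axes ks)"
  have nth: "axes ks ! i = axis (ks ! i) 1" using assms(4) by (simp add: axes_def)
  have len: "i < length (axes ks)" using assms(4) by simp
  have zero: "\<alpha> (axis j 1 # ?R) = 0" if "j \<noteq> ks ! i" for j
  proof (rule alternating_not_distinct[OF assms(1)])
    have "axis j 1 \<in> set (axes ks)" using assms(3) by (auto simp: axes_def)
    moreover have "axis j 1 \<noteq> axes ks ! i" using that nth by (simp add: axis_eq_axis)
    moreover have "set (axes ks) = insert (axes ks ! i) (set ?R)"
      using arg_cong[where f=set, OF id_take_nth_drop[OF len]] by (simp only: set_append list.set) blast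
    ultimately have "axis j 1 \<in> set ?R" by blast
    then show "\<not> distinct (axis j 1 # ?R)" by simp
  qed
  have "\<alpha> (axis (ks ! i) 1 # ?R) = (-1) ^ i * \<alpha> (take i (axes ks) @ axes ks ! i # drop (Suc i) (axes ks))"
    using alternating_move[OF assms(1), of "[]" "axis (ks ! i) 1" "take i (axes ks)" "drop (Suc i) (axes ks)"]
      assms(4) nth by simp
  then have one: "\<alpha> (axis (ks ! i) 1 # ?R) = (-1) ^ i * \<alpha> (axes ks)"
    by (simp only: id_take_nth_drop[OF len, symmetric])
  have "\<alpha> (z # ?R) = (\<Sum>j\<in>UNIV. z $ j * \<alpha> (axis j 1 # ?R))"
    using linear_basis_sum[OF alternating_linear[OF assms(1), of "[]" ?R], of z] by simp
  also have "\<dots> = (\<Sum>j\<in>{ks ! i}. z $ j * \<alpha> (axis j 1 # ?R))"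
    by (rule sum.mono_neutral_right) (use zero in auto)
  finally show ?thesis by (simp add: one)
qed

section \<open>The divergence of a bivector in coordinates\<close>

lemma ext_d_wedge1:
  fixes \<alpha> :: "real^'m::finite \<Rightarrow> ('m, real) form"
  assumes "\<And>us. (\<lambda>y. \<alpha> y us) differentiable (at x)"
  shows "ext_d \<alpha> x vs =
    (\<Sum>j\<in>UNIV. wedge1 (\<lambda>v. v $ j) (\<lambda>us. frechet_derivative (\<lambda>y. \<alpha> y us) (at x) (axis j 1)) vs)"
proof -
  have "(-1) ^ i *\<^sub>R frechet_derivative (\<lambda>y. \<alpha> y us) (at x) v =
      (\<Sum>j\<in>UNIV. (-1) ^ i * v $ j * frechet_derivative (\<lambda>y. \<alpha> y us) (at x) (axis j 1))" for us v i
    unfolding linear_basis_sum[OF linear_frechet_derivative[OF assms[of us]], of v]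
    by (simp add: sum_distrib_left mult.assoc)
  then have "ext_d \<alpha> x vs = (\<Sum>i<length vs. \<Sum>j\<in>UNIV. (-1) ^ i * (vs ! i) $ j *
      frechet_derivative (\<lambda>y. \<alpha> y (take i vs @ drop (Suc i) vs)) (at x) (axis j 1))"
    unfolding ext_d_def by (intro sum.cong refl)
  then show ?thesis by (subst (asm) sum.swap) (simp add: wedge1_nth)
qed

text \<open>Since d \<gamma> is the sum of the products of dx^j with the j-th partial derivative of
  \<gamma>, and dx^j is constant, the differentiated object is dx^j wedge \<gamma>, which is the
  contraction of \<open>vol\<close> with the j-th column of \<open>P\<close>. Evaluation on the axes
  without the k-th one isolates the row \<open>k\<close>.\<close>

lemma divergence_formula:
  fixes vol \<gamma> :: "real^'m::finite \<Rightarrow> ('m, real) form" and P :: "real^'m \<Rightarrow> real^'m^'m"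
  assumes "open S" "x \<in> S" and alt: "\<And>y. y \<in> S \<Longrightarrow> alternating_form (vol y)"
    and dv: "(\<lambda>y. vol y (axes ks)) differentiable (at x)"
    and dP: "\<And>j. (\<lambda>y. P y $ k $ j) differentiable (at x)"
    and diff: "\<And>us. (\<lambda>y. \<gamma> y us) differentiable (at x)"
    and eq: "\<And>y a vs. y \<in> S \<Longrightarrow> interior_prod (P y *v a) (vol y) vs = wedge (form1 a) (\<gamma> y) vs"
    and dg: "\<And>vs. ext_d \<gamma> x vs = interior_prod X (vol x) vs"
    and ks: "distinct ks" "set ks = UNIV"
  shows "vol x (axes ks) * X $ k =
    (\<Sum>j\<in>UNIV. frechet_derivative (\<lambda>y. vol y (axes ks) * P y $ k $ j) (at x) (axis j 1))"
proof -
  obtain i where i: "i < length ks" "ks ! i = k"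
    using ks(2) by (metis UNIV_I in_set_conv_nth)
  let ?R = "take i (axes ks) @ drop (Suc i) (axes ks)"
  have w: "wedge (form1 a) \<alpha> vs = wedge1 (\<lambda>v. a \<bullet> v) \<alpha> vs" for a and \<alpha> :: "('m, real) form" and vs
    by (subst wedge_degree_one) (auto simp: form1_def)
  have "(-1) ^ i * (vol x (axes ks) * X $ k) = ext_d \<gamma> x ?R"
    using alternating_axes_replace[OF alt[OF assms(2)] ks i(1), of X] i
    by (simp add: dg interior_prod_def)
  also have "\<dots> = (\<Sum>j\<in>UNIV. frechet_derivative (\<lambda>y. wedge1 (\<lambda>v. v $ j) (\<gamma> y) ?R) (at x) (axis j 1))"
  proof -
    have "((\<lambda>y. wedge1 (\<lambda>v. v $ j) (\<gamma> y) ?R) has_derivative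
      (\<lambda>h. wedge1 (\<lambda>v. v $ j) (\<lambda>us. frechet_derivative (\<lambda>y. \<gamma> y us) (at x) h) ?R)) (at x)" for j
      using has_derivative_wedge1[of "\<lambda>y v. v $ j" "\<lambda>v h. 0" x \<gamma>
          "\<lambda>us. frechet_derivative (\<lambda>y. \<gamma> y us) (at x)" ?R] has_derivative_frechet[OF diff]
      by (simp add: wedge1_cmult_left[of 0, simplified])
    from frechet_derivative_eqI[OF this] show ?thesis by (simp add: ext_d_wedge1[OF diff])
  qed
  also have "\<dots> = (\<Sum>j\<in>UNIV. frechet_derivative (\<lambda>y. (-1) ^ i * (vol y (axes ks) * P y $ k $ j)) (at x) (axis j 1))"
  proof -
    have "wedge1 (\<lambda>v. v $ j) (\<gamma> y) ?R = (-1) ^ i * (vol y (axes ks) * P y $ k $ j)" if "y \<in> S" for y j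
    proof -
      have "(P y *v axis j 1) $ k = P y $ k $ j"
        by (simp add: matrix_vector_mul_component inner_axis)
      moreover have "wedge1 (\<lambda>v. v $ j) (\<gamma> y) ?R = wedge (form1 (axis j 1)) (\<gamma> y) ?R"
        by (simp add: w inner_axis' )
      ultimately show ?thesis
        using alternating_axes_replace[OF alt[OF that] ks i(1), of "P y *v axis j 1"] i
        by (simp add: eq[OF that, symmetric] interior_prod_def)
    qed
    then show ?thesis
      by (intro sum.cong[OF refl] fun_cong[OF frechet_derivative_cong_open[OF assms(1,2)]])
  qed
  also have "\<dots> = (-1) ^ i * (\<Sum>j\<in>UNIV. frechet_derivative (\<lambda>y. vol y (axes ks) * P y $ k $ j) (at x) (axis j 1))"
  proof -
    have "frechet_derivative (\<lambda>y. (-1) ^ i * h y) (at x) v = (-1) ^ i * frechet_derivative h (at x) v"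
      if "h differentiable (at x)" for h :: "real^'m \<Rightarrow> real" and v
      by (rule fun_cong[OF frechet_derivative_eqI[OF has_derivative_mult_right[OF has_derivative_frechet[OF that]]]])
    from this[OF differentiable_mult[OF dv dP]] show ?thesis by (simp only: sum_distrib_left)
  qed
  finally show ?thesis by simp
qed

text \<open>\<open>\<partial>(e\<^sup>\<beta>) = \<partial>\<beta> \<and> e\<^sup>\<beta>\<close>, where the action of the \<open>2\<close>-form \<open>\<partial>\<beta>\<close> is written as
  \<open>\<Sum>\<^sub>j e\<^sup>j \<and> i\<^bsub>e\<^sub>j\<^esub> \<partial>\<beta> / 2\<close>.\<close>
lemma exp_recursion_derivative:
  fixes \<phi> :: "real^'m::finite \<Rightarrow> (real^'m) list \<Rightarrow> complex"
  assumes "open U" "x \<in> U"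
    and rec: "\<And>y z vs. y \<in> U \<Longrightarrow> \<phi> y (z # vs) = wedge1 (\<beta> y z) (\<phi> y) vs"
    and d\<phi>: "\<And>vs. ((\<lambda>y. \<phi> y vs) has_derivative \<phi>' vs) (at x)"
    and d\<beta>: "\<And>z v. ((\<lambda>y. \<beta> y z v) has_derivative \<beta>' z v) (at x)"
    and lin: "\<And>v. linear (\<lambda>z. \<beta>' z v h)"
    and anti: "\<And>z v. \<beta>' v z h = - \<beta>' z v h"
    and nz: "\<phi> x [] \<noteq> 0"
  shows "\<phi>' vs h = \<phi>' [] h / \<phi> x [] * \<phi> x vs + 1/2 * (\<Sum>j\<in>UNIV.
     wedge1 (\<lambda>v. of_real (v $ j)) (wedge1 (\<lambda>v. \<beta>' (axis j 1) v h) (\<phi> x)) vs)"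
proof -
  define b where "b z v = \<beta>' z v h" for z v
  define e where "e j v = complex_of_real (v $ j)" for j and v :: "real^'m"
  define \<Lambda> where "\<Lambda> \<alpha> vs = 1/2 * (\<Sum>j\<in>UNIV. wedge1 (e j) (wedge1 (b (axis j 1)) \<alpha>) vs)" for \<alpha> vs
  have rec': "\<phi>' (z # vs) h = wedge1 (b z) (\<phi> x) vs + wedge1 (\<beta> x z) (\<lambda>us. \<phi>' us h) vs" for z vs
  proof -
    have "((\<lambda>y. \<phi> y (z # vs)) has_derivative
       (\<lambda>h. wedge1 (\<lambda>v. \<beta>' z v h) (\<phi> x) vs + wedge1 (\<beta> x z) (\<lambda>us. \<phi>' us h) vs)) (at x)"
      by (rule has_derivative_transform_within_open[OF has_derivative_wedge1[OF d\<beta> d\<phi>] assms(1,2)])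
        (simp add: rec)
    from fun_cong[OF has_derivative_unique[OF this d\<phi>], of h] show ?thesis by (simp add: b_def[abs_def])
  qed
  have bz: "b z v = (\<Sum>j\<in>UNIV. e j z * b (axis j 1) v)" for z v
    using linear_basis_sum[OF lin[of v], of z] by (simp add: b_def e_def scaleR_conv_of_real)
  \<comment> \<open>Contraction with \<open>z\<close> hits either factor of the 2-form. Both terms
    equal \<open>b z\<close> wedge \<alpha>, by linearity and by antisymmetry of \<open>b\<close>
    respectively, and so absorb the factor 1/2.\<close>
  have \<Lambda>_Cons: "\<Lambda> \<alpha> (z # vs) = wedge1 (b z) \<alpha> vs + \<Lambda> (\<lambda>us. \<alpha> (z # us)) vs" for \<alpha> z vs
  proof -
    have 1: "(\<Sum>j\<in>UNIV. e j z * wedge1 (b (axis j 1)) \<alpha> vs) = wedge1 (b z) \<alpha> vs"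
    proof -
      have "b z = (\<lambda>v. \<Sum>j\<in>UNIV. e j z * b (axis j 1) v)" by (rule ext) (rule bz)
      then have "wedge1 (b z) \<alpha> vs = wedge1 (\<lambda>v. \<Sum>j\<in>UNIV. e j z * b (axis j 1) v) \<alpha> vs" by (rule arg_cong)
      then show ?thesis by (simp only: wedge1_sum_left wedge1_cmult_left)
    qed
    have 2: "(\<Sum>j\<in>UNIV. b (axis j 1) z * wedge1 (e j) \<alpha> vs) = - wedge1 (b z) \<alpha> vs"
    proof -
      have "(\<Sum>j\<in>UNIV. b (axis j 1) z * wedge1 (e j) \<alpha> vs)
          = wedge1 (\<lambda>v. \<Sum>j\<in>UNIV. e j v * b (axis j 1) z) \<alpha> vs"
        unfolding mult.commute[of "e _ _"] by (simp only: wedge1_sum_left wedge1_cmult_left)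
      also have "(\<lambda>v. \<Sum>j\<in>UNIV. e j v * b (axis j 1) z) = (\<lambda>v. - 1 * b z v)"
      proof
        fix v
        have "(\<Sum>j\<in>UNIV. e j v * b (axis j 1) z) = b v z" by (rule bz[symmetric])
        also have "\<dots> = - 1 * b z v" using anti[of v z] by (simp add: b_def)
        finally show "(\<Sum>j\<in>UNIV. e j v * b (axis j 1) z) = - 1 * b z v" .
      qed
      finally show ?thesis by (simp only: wedge1_cmult_left) simp
    qed
    show ?thesis
      by (simp add: \<Lambda>_def wedge1_diff wedge1_cmult sum_subtractf sum.distrib 1 2)
  qed
  have \<Lambda>_wedge1: "\<Lambda> (wedge1 \<xi> \<alpha>) vs = wedge1 \<xi> (\<Lambda> \<alpha>) vs" for \<xi> \<alpha> vs
  proof -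
    have "wedge1 (e j) (wedge1 (b (axis j 1)) (wedge1 \<xi> \<alpha>)) vs
        = wedge1 \<xi> (wedge1 (e j) (wedge1 (b (axis j 1)) \<alpha>)) vs" for j
    proof -
      have "wedge1 (b (axis j 1)) (wedge1 \<xi> \<alpha>) = (\<lambda>us. - wedge1 \<xi> (wedge1 (b (axis j 1)) \<alpha>) us)"
        using wedge1_anticommute[of "b (axis j 1)" \<xi> \<alpha>] by auto
      then show ?thesis
        using wedge1_anticommute[of "e j" \<xi> "wedge1 (b (axis j 1)) \<alpha>" vs] by (simp add: wedge1_uminus)
    qed
    then show ?thesis unfolding \<Lambda>_def wedge1_cmult wedge1_sum by simp
  qed
  define c where "c = \<phi>' [] h / \<phi> x []"
  \<comment> \<open>The difference of the two sides. It inherits the recursion of \<phi> because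
    \<Lambda>, being the product with a 2-form, commutes with products with one-forms;
    \<open>c\<close> is chosen so that \<open>D\<close> vanishes in degree 0.\<close>
  define D where "D vs = \<phi>' vs h - c * \<phi> x vs - \<Lambda> (\<phi> x) vs" for vs
  have "D (z # vs) = wedge1 (\<beta> x z) D vs" for z vs
  proof -
    have "(\<lambda>us. \<phi> x (z # us)) = wedge1 (\<beta> x z) (\<phi> x)" using rec[OF assms(2)] by auto
    then have "\<Lambda> (\<phi> x) (z # vs) = wedge1 (b z) (\<phi> x) vs + wedge1 (\<beta> x z) (\<Lambda> (\<phi> x)) vs"
      by (simp add: \<Lambda>_Cons \<Lambda>_wedge1)
    then show ?thesis
      unfolding D_def by (simp add: wedge1_diff wedge1_cmult rec' rec[OF assms(2)])
  qed
  moreover have "D [] = 0" unfolding D_def c_def \<Lambda>_def using nz by simp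
  ultimately have "D vs = 0" by (rule exp_recursion_unique)
  then have "\<phi>' vs h = c * \<phi> x vs + \<Lambda> (\<phi> x) vs" by (simp add: D_def algebra_simps)
  then show ?thesis by (simp only: c_def \<Lambda>_def b_def[abs_def] e_def[abs_def])
qed

text \<open>This replaces the formula for the derivative of a Pfaffian. The vectors
  \<open>Z j\<close> solve i_(Z j) \<beta> = \<partial>\<beta>(e_j), so the product of \<phi> with
  \<partial>\<beta>(e_j) is the contraction of \<phi> with \<open>Z j\<close>. On top forms,
  contraction with \<open>Z j\<close> followed by the product with e^j is multiplication by the j-th
  component of \<open>Z j\<close>; hence half the trace appears.\<close>

lemma exp_top_derivative:
  fixes \<phi> :: "real^'m::finite \<Rightarrow> (real^'m) list \<Rightarrow> complex"
  assumes "open U" "x \<in> U"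
    and rec: "\<And>y z vs. y \<in> U \<Longrightarrow> \<phi> y (z # vs) = wedge1 (\<beta> y z) (\<phi> y) vs"
    and d\<phi>: "\<And>vs. ((\<lambda>y. \<phi> y vs) has_derivative \<phi>' vs) (at x)"
    and d\<beta>: "\<And>z v. ((\<lambda>y. \<beta> y z v) has_derivative \<beta>' z v) (at x)"
    and lin: "\<And>v. linear (\<lambda>z. \<beta>' z v h)"
    and anti: "\<And>z v. \<beta>' v z h = - \<beta>' z v h"
    and nz: "\<phi> x [] \<noteq> 0"
    and top: "\<And>vs. length vs = CARD('m) \<Longrightarrow> \<phi> x vs = \<kappa> * complex_of_real (\<alpha> vs)"
    and alt: "alternating_form \<alpha>"
    and Z: "\<And>j v. \<beta>' (axis j 1) v h = \<beta> x (Z j) v"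
    and ks: "distinct ks" "set ks = UNIV"
  shows "\<phi>' (axes ks) h = (\<phi>' [] h / \<phi> x [] + of_real (1/2 * (\<Sum>j\<in>UNIV. Z j $ j))) * \<phi> x (axes ks)"
proof -
  have len: "length ks = CARD('m)" using ks by (metis distinct_card)
  have bij: "bij_betw ((!) ks) {..<length ks} UNIV"
    using bij_betw_nth[OF ks(1) refl refl] ks(2) by simp
  have "wedge1 (\<lambda>v. of_real (v $ j)) (wedge1 (\<lambda>v. \<beta>' (axis j 1) v h) (\<phi> x)) (axes ks)
      = of_real (Z j $ j) * \<phi> x (axes ks)" for j
  proof -
    have "wedge1 (\<lambda>v. of_real (v $ j)) (wedge1 (\<lambda>v. \<beta>' (axis j 1) v h) (\<phi> x)) (axes ks) =
      (\<Sum>i<length ks. (-1) ^ i * of_real (axes ks ! i $ j) * \<phi> x (Z j # take i (axes ks) @ drop (Suc i) (axes ks)))"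
      unfolding wedge1_nth[of "\<lambda>v. of_real (v $ j)"] by (simp add: Z rec[OF assms(2)])
    also have "\<dots> = (\<Sum>i<length ks. of_real (if ks ! i = j then Z j $ (ks ! i) else 0) * \<phi> x (axes ks))"
    proof (intro sum.cong refl)
      fix i assume "i \<in> {..<length ks}"
      then have i: "i < length ks" by simp
      have "\<phi> x (Z j # take i (axes ks) @ drop (Suc i) (axes ks))
          = (-1) ^ i * of_real (Z j $ (ks ! i)) * \<phi> x (axes ks)"
        using i len alternating_axes_replace[OF alt ks i, of "Z j"] by (simp add: top)
      moreover have "(axes ks ! i) $ j = (if ks ! i = j then 1 else 0)"
        using i by (simp add: axes_def axis_def)
      ultimately show "(-1) ^ i * of_real (axes ks ! i $ j) * \<phi> x (Z j # take i (axes ks) @ drop (Suc i) (axes ks))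
          = of_real (if ks ! i = j then Z j $ (ks ! i) else 0) * \<phi> x (axes ks)"
        by (simp flip: mult.assoc power_mult_distrib)
    qed
    also have "\<dots> = (\<Sum>l\<in>UNIV. of_real (if l = j then Z j $ l else 0) * \<phi> x (axes ks))"
      by (rule sum.reindex_bij_betw[OF bij])
    also have "\<dots> = of_real (Z j $ j) * \<phi> x (axes ks)"
      by (simp add: if_distrib if_distribR sum.delta cong: if_cong)
    finally show ?thesis .
  qed
  moreover have "\<phi>' (axes ks) h = \<phi>' [] h / \<phi> x [] * \<phi> x (axes ks) + 1/2 * (\<Sum>j\<in>UNIV.
     wedge1 (\<lambda>v. of_real (v $ j)) (wedge1 (\<lambda>v. \<beta>' (axis j 1) v h) (\<phi> x)) (axes ks))"
    by (rule exp_recursion_derivative[OF assms(1,2) rec d\<phi> d\<beta> lin anti nz])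
  ultimately show ?thesis
    by (simp add: distrib_right sum_distrib_right)
qed

section \<open>Lie derivatives of matrix fields\<close>

lemma matrix_mult_distribs:
  fixes A B :: "real^'n::finite^'m::finite" and C D :: "real^'k::finite^'n"
  shows matrix_mult_add_left: "(A + B) ** C = A ** C + B ** C"
    and matrix_mult_diff_left: "(A - B) ** C = A ** C - B ** C"
    and matrix_mult_diff_right: "A ** (C - D) = A ** C - A ** D"
    and matrix_mult_uminus_left: "(- A) ** C = - (A ** C)"
    and matrix_mult_uminus_right: "A ** (- C) = - (A ** C)"
    and matrix_mult_scaleR_left: "(c *\<^sub>R A) ** C = c *\<^sub>R (A ** C)"
    and matrix_mult_scaleR_right: "A ** (c *\<^sub>R C) = c *\<^sub>R (A ** C)"
  by (simp_all add: matrix_matrix_mult_def vec_eq_iff sum.distrib sum_subtractf sum_negf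
      sum_distrib_left algebra_simps)

lemma matrix_vector_mult_uminus:
  fixes A :: "real^'n::finite^'m::finite"
  shows matrix_vector_mult_uminus_left: "(- A) *v v = - (A *v v)"
    and matrix_vector_mult_uminus_right: "A *v (- v) = - (A *v v)"
  by (simp_all add: matrix_vector_mult_def vec_eq_iff sum_negf)

lemma bounded_bilinear_matrix_vector_mult:
  "bounded_bilinear (\<lambda>(A :: real^'n::finite^'m::finite) v. A *v v)"
  by (auto simp: bilinear_conv_bounded_bilinear[symmetric] bilinear_def matrix_vector_right_distrib
      matrix_vector_mult_add_rdistrib scaleR_matrix_vector_assoc[symmetric] matrix_vector_mult_scaleR
      intro!: linearI)

lemma bounded_bilinear_matrix_matrix_mult:
  "bounded_bilinear (\<lambda>(A :: real^'n::finite^'m::finite) (B :: real^'k::finite^'n). A ** B)"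
  by (auto simp: bilinear_conv_bounded_bilinear[symmetric] bilinear_def matrix_add_ldistrib
      matrix_mult_distribs
      intro!: linearI)

section \<open>Differentiability of the inverse matrix\<close>

lemma differentiable_vec_nth:
  fixes f :: "'a::real_normed_vector \<Rightarrow> 'b::euclidean_space^'m::finite"
  assumes "\<And>i. (\<lambda>y. f y $ i) differentiable (at x)"
  shows "f differentiable (at x)"
proof (rule differentiable_componentwise_within[THEN iffD2], rule ballI)
  fix u :: "'b^'m" assume "u \<in> Basis"
  then obtain i v where u: "u = axis i v" "v \<in> Basis" by (auto simp: Basis_vec_def)
  have "(\<lambda>y. f y $ i \<bullet> v) differentiable (at x)"
    using assms[of i] by (intro differentiable_inner) auto
  then show "(\<lambda>y. f y \<bullet> u) differentiable (at x)" by (simp add: u inner_axis)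
qed

lemma differentiable_nth:
  fixes f :: "'a::real_normed_vector \<Rightarrow> 'b::real_normed_vector^'m::finite"
  assumes "f differentiable (at x)"
  shows "(\<lambda>y. f y $ i) differentiable (at x)"
  using assms bounded_linear.has_derivative[OF bounded_linear_vec_nth]
  unfolding differentiable_def by blast

lemma differentiable_prod:
  fixes f :: "'i \<Rightarrow> 'a::real_normed_vector \<Rightarrow> real"
  shows "(\<And>i. i \<in> A \<Longrightarrow> f i differentiable (at x)) \<Longrightarrow> (\<lambda>y. \<Prod>i\<in>A. f i y) differentiable (at x)"
  by (induction A rule: infinite_finite_induct) auto

lemma differentiable_det:
  fixes M :: "'a::real_normed_vector \<Rightarrow> real^'m::finite^'m"
  assumes "\<And>i j. (\<lambda>y. M y $ i $ j) differentiable (at x)"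
  shows "(\<lambda>y. det (M y)) differentiable (at x)"
  unfolding det_def
  by (intro differentiable_sum ballI differentiable_mult differentiable_const differentiable_prod assms)
    (simp add: finite_permutations)

lemma matrix_inv_right:
  fixes A :: "real^'m::finite^'m"
  assumes "invertible A" shows "A ** matrix_inv A = mat 1"
  using assms someI_ex[of "\<lambda>A'. A ** A' = mat 1 \<and> A' ** A = mat 1"]
  unfolding matrix_inv_def invertible_def by blast

lemma matrix_inv_left:
  fixes A :: "real^'m::finite^'m"
  assumes "invertible A" shows "matrix_inv A ** A = mat 1"
  using matrix_inv_right[OF assms] matrix_left_right_inverse by blast

text \<open>Cramer's rule for the column \<open>l\<close> of the inverse. It exhibits the entries as
  quotients of polynomials in the entries of \<open>A\<close>, which gives
  differentiability.\<close>

lemma matrix_inv_nth: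
  fixes A :: "real^'m::finite^'m"
  assumes "invertible A"
  shows "matrix_inv A $ k $ l = det (\<chi> i j. if j = k then axis l 1 $ i else A $ i $ j) / det A"
proof -
  have "A *v (matrix_inv A *v axis l 1) = axis l 1"
    by (simp add: matrix_vector_mul_assoc matrix_inv_right[OF assms])
  then have "matrix_inv A *v axis l 1 = (\<chi> k. det (\<chi> i j. if j = k then axis l 1 $ i else A $ i $ j) / det A)"
    using cramer[of A] assms invertible_det_nz[of A] by blast
  from arg_cong[where f="\<lambda>v. v $ k", OF this] show ?thesis
    by (simp add: matrix_vector_mul_component inner_axis)
qed

lemma differentiable_matrix_inv:
  fixes M :: "'a::real_normed_vector \<Rightarrow> real^'m::finite^'m"
  assumes "open S" "x \<in> S" "\<And>y. y \<in> S \<Longrightarrow> invertible (M y)" "M differentiable (at x)"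
  shows "(\<lambda>y. matrix_inv (M y)) differentiable (at x)"
proof (intro differentiable_vec_nth)
  fix k l
  have e: "(\<lambda>y. M y $ i $ j) differentiable (at x)" for i j
    by (intro differentiable_nth assms)
  have "(\<lambda>y. det (\<chi> i j. if j = k then axis l 1 $ i else M y $ i $ j) / det (M y)) differentiable (at x)"
  proof (intro differentiable_divide differentiable_det e)
    show "(\<lambda>y. (\<chi> i j. if j = k then axis l 1 $ i else M y $ i $ j) $ i $ j) differentiable (at x)" for i j
      by (cases "j = k") (auto intro: e)
    show "det (M x) \<noteq> 0" using assms invertible_det_nz by blast
  qed
  then show "(\<lambda>y. matrix_inv (M y) $ k $ l) differentiable (at x)"
    by (rule differentiable_cong_open[OF assms(1,2), rotated]) (simp add: matrix_inv_nth assms(3))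
qed

text \<open>The operator \<open>\<partial>\<^sub>\<xi> - M\<close>; it is the Lie derivative along \<open>X\<close> for \<open>\<xi> = X\<close>, where \<open>M\<close>
  is \<open>DX\<close> on vectors and \<open>- (DX)\<^sup>T\<close> on covectors.\<close>
definition lie_along ::
  "real^'m::finite \<Rightarrow> real^'m^'m \<Rightarrow> (real^'m \<Rightarrow> real^'m) \<Rightarrow> real^'m \<Rightarrow> real^'m \<Rightarrow> bool" where
  "lie_along \<xi> M Z x w \<longleftrightarrow> (\<exists>Z'. (Z has_derivative Z') (at x) \<and> w = Z' \<xi> - M *v Z x)"

text \<open>Vanishing Lie derivative of a bundle map, where \<open>M\<close> and \<open>M'\<close>
  are the infinitesimal actions on source and target. One notion covers endomorphisms of the tangent
  bundle, metrics and 2-forms as maps to covectors, and bivectors as maps to vectors.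
  Differentiability is part of it.\<close>

definition lie_inv ::
  "real^'m::finite \<Rightarrow> real^'m^'m \<Rightarrow> real^'m^'m \<Rightarrow> (real^'m \<Rightarrow> real^'m^'m) \<Rightarrow> real^'m \<Rightarrow> bool" where
  "lie_inv \<xi> M' M K x \<longleftrightarrow> (\<exists>K'. (K has_derivative K') (at x) \<and> K' \<xi> = M' ** K x - K x ** M)"

lemma lie_along_cong:
  assumes "lie_along \<xi> M Z x w" "open S" "x \<in> S" "\<And>y. y \<in> S \<Longrightarrow> Z y = Z2 y"
  shows "lie_along \<xi> M Z2 x w"
  using assms(1) assms(4)[OF assms(3)] has_derivative_transform_within_open[OF _ assms(2-4)]
  unfolding lie_along_def by force

lemma lie_along_add:
  "lie_along \<xi> M Y x v \<Longrightarrow> lie_along \<xi> M Z x w \<Longrightarrow> lie_along \<xi> M (\<lambda>y. Y y + Z y) x (v + w)"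
  unfolding lie_along_def
  by (elim exE conjE, intro exI conjI, erule (1) has_derivative_add) (simp add: matrix_vector_right_distrib)

lemma lie_along_diff:
  "lie_along \<xi> M Y x v \<Longrightarrow> lie_along \<xi> M Z x w \<Longrightarrow> lie_along \<xi> M (\<lambda>y. Y y - Z y) x (v - w)"
  unfolding lie_along_def
  by (elim exE conjE, intro exI conjI, erule (1) has_derivative_diff) (simp add: matrix_vector_mult_diff_distrib)

lemma lie_along_scaleR:
  "lie_along \<xi> M Z x w \<Longrightarrow> lie_along \<xi> M (\<lambda>y. c *\<^sub>R Z y) x (c *\<^sub>R w)"
  unfolding lie_along_def
  by (elim exE conjE, intro exI conjI, erule has_derivative_scaleR_right)
    (simp add: matrix_vector_mult_scaleR scaleR_diff_right)

lemma lie_along_mult: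
  assumes "lie_inv \<xi> M' M K x" "lie_along \<xi> M Z x w"
  shows "lie_along \<xi> M' (\<lambda>y. K y *v Z y) x (K x *v w)"
proof -
  from assms obtain K' Z' where K: "(K has_derivative K') (at x)" "K' \<xi> = M' ** K x - K x ** M"
    and Z: "(Z has_derivative Z') (at x)" "w = Z' \<xi> - M *v Z x"
    by (auto simp: lie_inv_def lie_along_def)
  show ?thesis unfolding lie_along_def
    by (intro exI conjI, rule bounded_bilinear.FDERIV[OF bounded_bilinear_matrix_vector_mult K(1) Z(1)])
      (simp add: K(2) Z(2) matrix_vector_mult_diff_distrib matrix_vector_mult_diff_rdistrib matrix_vector_mul_assoc)
qed

lemma lie_inv_add:
  "lie_inv \<xi> M' M K x \<Longrightarrow> lie_inv \<xi> M' M L x \<Longrightarrow> lie_inv \<xi> M' M (\<lambda>y. K y + L y) x"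
  unfolding lie_inv_def
  by (elim exE conjE, intro exI conjI, erule (1) has_derivative_add) (simp add: matrix_add_ldistrib matrix_mult_distribs)

lemma lie_inv_diff:
  "lie_inv \<xi> M' M K x \<Longrightarrow> lie_inv \<xi> M' M L x \<Longrightarrow> lie_inv \<xi> M' M (\<lambda>y. K y - L y) x"
  unfolding lie_inv_def
  by (elim exE conjE, intro exI conjI, erule (1) has_derivative_diff) (simp add: matrix_mult_distribs)

lemma lie_inv_scaleR:
  "lie_inv \<xi> M' M K x \<Longrightarrow> lie_inv \<xi> M' M (\<lambda>y. c *\<^sub>R K y) x"
  unfolding lie_inv_def
  by (elim exE conjE, intro exI conjI, erule has_derivative_scaleR_right)
    (simp add: matrix_mult_distribs scaleR_diff_right)

lemma lie_inv_mult:
  assumes "lie_inv \<xi> M2 M1 K x" "lie_inv \<xi> M1 M0 L x"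
  shows "lie_inv \<xi> M2 M0 (\<lambda>y. K y ** L y) x"
proof -
  from assms obtain K' L' where K: "(K has_derivative K') (at x)" "K' \<xi> = M2 ** K x - K x ** M1"
    and L: "(L has_derivative L') (at x)" "L' \<xi> = M1 ** L x - L x ** M0"
    by (auto simp: lie_inv_def)
  show ?thesis unfolding lie_inv_def
    by (intro exI conjI, rule bounded_bilinear.FDERIV[OF bounded_bilinear_matrix_matrix_mult K(1) L(1)])
      (simp add: K(2) L(2) matrix_mult_distribs matrix_mul_assoc)
qed

lemma lie_inv_transpose:
  assumes "lie_inv \<xi> M' M K x"
  shows "lie_inv \<xi> (- transpose M) (- transpose M') (\<lambda>y. transpose (K y)) x"
proof -
  from assms obtain K' where K: "(K has_derivative K') (at x)" "K' \<xi> = M' ** K x - K x ** M"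
    by (auto simp: lie_inv_def)
  have "linear (transpose :: real^'a^'a \<Rightarrow> _)"
    by (intro linearI) (auto simp: transpose_def vec_eq_iff)
  then have "bounded_linear (transpose :: real^'a^'a \<Rightarrow> _)" by (rule linear_conv_bounded_linear[THEN iffD1])
  from bounded_linear.has_derivative[OF this K(1)] show ?thesis unfolding lie_inv_def
  proof (intro exI conjI)
    have d: "transpose (A - B) = transpose A - transpose B" for A B :: "real^'a^'a"
      by (auto simp: transpose_def vec_eq_iff)
    show "transpose (K' \<xi>) = - transpose M ** transpose (K x) - transpose (K x) ** - transpose M'"
      by (simp add: K(2) d matrix_mult_distribs matrix_transpose_mul)
  qed
qed

lemma lie_inv_matrix_inv:
  assumes "lie_inv \<xi> M' M K x" "open S" "x \<in> S" "\<And>y. y \<in> S \<Longrightarrow> invertible (K y)"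
  shows "lie_inv \<xi> M M' (\<lambda>y. matrix_inv (K y)) x"
proof -
  from assms obtain K' where K: "(K has_derivative K') (at x)" "K' \<xi> = M' ** K x - K x ** M"
    by (auto simp: lie_inv_def)
  let ?L = "\<lambda>y. matrix_inv (K y)"
  let ?L' = "frechet_derivative ?L (at x)"
  have L: "(?L has_derivative ?L') (at x)"
    by (rule has_derivative_frechet[OF differentiable_matrix_inv[OF assms(2-4) differentiableI[OF K(1)]]])
  have inv: "K x ** ?L x = mat 1" "?L x ** K x = mat 1"
    using matrix_inv_left matrix_inv_right assms by auto
  \<comment> \<open>The derivative of the inverse along \<xi> is found by differentiating the
    constant product of \<open>K\<close> with its inverse.\<close>
  have "((\<lambda>y. mat 1) has_derivative (\<lambda>h. K x ** ?L' h + K' h ** ?L x)) (at x)"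
    by (rule has_derivative_transform_within_open[OF
          bounded_bilinear.FDERIV[OF bounded_bilinear_matrix_matrix_mult K(1) L] assms(2,3)])
      (simp add: matrix_inv_right assms(4))
  from fun_cong[OF has_derivative_unique[OF this has_derivative_const], of \<xi>]
  have "K x ** ?L' \<xi> + K' \<xi> ** ?L x = 0" by simp
  then have "?L x ** (K x ** ?L' \<xi> + K' \<xi> ** ?L x) = 0" by simp
  then have "?L' \<xi> = - (?L x ** (K' \<xi> ** ?L x))"
    by (simp add: matrix_add_ldistrib matrix_mul_assoc inv eq_neg_iff_add_eq_0)
  also have "\<dots> = M ** ?L x - ?L x ** M'"
  proof -
    have "(M' ** K x - K x ** M) ** ?L x = M' - K x ** M ** ?L x"
      using inv by (simp add: matrix_mult_distribs matrix_mul_assoc[symmetric])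
    moreover have "?L x ** (M' - K x ** M ** ?L x) = ?L x ** M' - M ** ?L x"
      by (simp add: matrix_mult_distribs matrix_mul_assoc inv)
    ultimately show ?thesis by (simp add: K(2))
  qed
  finally show ?thesis using L unfolding lie_inv_def by blast
qed

text \<open>The first argument of the form indexes columns, so that multiplication by
  \<open>u\<close> gives the covector i_u b, the same convention as in \<open>bilin\<close>.\<close>

definition form_matrix :: "('m::finite, real) form \<Rightarrow> real^'m^'m" where
  "form_matrix b = (\<chi> i j. b [axis j 1, axis i 1])"

lemma form_matrix_mult: "alternating_form b \<Longrightarrow> form_matrix b *v u = covector (interior_prod u b)"
proof -
  assume b: "alternating_form b"
  have "b [u, axis i 1] = (\<Sum>j\<in>UNIV. u $ j * b [axis j 1, axis i 1])" for i
    using linear_basis_sum[OF alternating_linear[OF b, of "[]" "[axis i 1]"], of u] by simp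
  then show ?thesis
    by (simp add: vec_eq_iff form_matrix_def covector_def interior_prod_def matrix_vector_mult_def mult.commute)
qed

lemma form_matrix_inner:
  assumes "alternating_form b"
  shows "b [u, v] = (form_matrix b *v u) \<bullet> v"
proof -
  have "b [u, v] = (\<Sum>j\<in>UNIV. v $ j *\<^sub>R b [u, axis j 1])"
    using linear_basis_sum[OF alternating_linear[OF assms, of "[u]" "[]"], of v] by simp
  then show ?thesis
    by (simp add: form_matrix_mult[OF assms] covector_def interior_prod_def inner_vec_def mult.commute)
qed

lemma exp_b_eq: "alternating_form b \<Longrightarrow> exp_b b e = (fst e, snd e + form_matrix b *v fst e)"
  by (simp add: exp_b_def form_matrix_mult)

lemma exp_b_uminus_eq:
  assumes "alternating_form b"
  shows "exp_b (\<lambda>vs. - b vs) e = (fst e, snd e - form_matrix b *v fst e)"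
  unfolding exp_b_def form_matrix_mult[OF assms]
  by (simp add: covector_def interior_prod_def vec_eq_iff)

text \<open>The structure is composed of invariant maps by sums, products and inverses, so it
  commutes with the Lie derivative. A section and its Lie derivative are followed through the
  composition separately in the tangent and the cotangent part.\<close>

lemma gcs_I_lie_along:
  fixes g I J :: "real^'m::finite \<Rightarrow> real^'m^'m" and b :: "real^'m \<Rightarrow> ('m, real) form"
  assumes S: "open S" "x \<in> S" "\<And>y. y \<in> S \<Longrightarrow> invertible (g y ** I y)" "\<And>y. y \<in> S \<Longrightarrow> invertible (g y ** J y)"
    and b: "\<And>y. y \<in> S \<Longrightarrow> alternating_form (b y)"
    and inv: "lie_inv \<xi> (- transpose N) N g x" "lie_inv \<xi> N N I x" "lie_inv \<xi> N N J x"
      "lie_inv \<xi> (- transpose N) N (\<lambda>y. form_matrix (b y)) x"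
    and s: "lie_along \<xi> N (\<lambda>y. fst (s y)) x w1" "lie_along \<xi> (- transpose N) (\<lambda>y. snd (s y)) x w2"
  shows "lie_along \<xi> N (\<lambda>y. fst (gcs_I (g y) (I y) (J y) (b y) (s y))) x
           (fst (gcs_I (g x) (I x) (J x) (b x) (w1, w2)))"
    and "lie_along \<xi> (- transpose N) (\<lambda>y. snd (gcs_I (g y) (I y) (J y) (b y) (s y))) x
           (snd (gcs_I (g x) (I x) (J x) (b x) (w1, w2)))"
proof -
  have tI: "lie_inv \<xi> (- transpose N) (- transpose N) (\<lambda>y. transpose (I y)) x"
    and tJ: "lie_inv \<xi> (- transpose N) (- transpose N) (\<lambda>y. transpose (J y)) x"
    by (intro lie_inv_transpose inv)+
  have wI: "lie_inv \<xi> N (- transpose N) (\<lambda>y. matrix_inv (g y ** I y)) x"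
    by (rule lie_inv_matrix_inv[OF lie_inv_mult[OF inv(1,2)] S(1,2,3)])
  have wJ: "lie_inv \<xi> N (- transpose N) (\<lambda>y. matrix_inv (g y ** J y)) x"
    by (rule lie_inv_matrix_inv[OF lie_inv_mult[OF inv(1,3)] S(1,2,4)])
  note bs = lie_along_diff[OF s(2) lie_along_mult[OF inv(4) s(1)]]
  \<comment> \<open>\<open>p\<close> and \<open>q\<close> are the two components before the outer
    factor e^b is applied; this factor only adds the contraction of \<open>b\<close> with
    \<open>p\<close> to the second one.\<close>
  define p where "p y z = (1/2) *\<^sub>R ((I y + J y) *v fst z
      - (matrix_inv (g y ** I y) - matrix_inv (g y ** J y)) *v (snd z - form_matrix (b y) *v fst z))" for y z
  define q where "q y z = (1/2) *\<^sub>R ((g y ** I y - g y ** J y) *v fst z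
      - (transpose (I y) + transpose (J y)) *v (snd z - form_matrix (b y) *v fst z))" for y z
  have eq: "gcs_I (g y) (I y) (J y) (b y) z = (p y z, q y z + form_matrix (b y) *v p y z)"
    if "y \<in> S" for y z
    unfolding gcs_I_def p_def q_def exp_b_eq[OF b[OF that]] exp_b_uminus_eq[OF b[OF that]]
    by (simp add: block_def matrix_vector_mult_uminus algebra_simps)
  have p: "lie_along \<xi> N (\<lambda>y. p y (s y)) x (p x (w1, w2))"
    unfolding p_def fst_conv snd_conv
    by (intro lie_along_scaleR lie_along_diff lie_along_mult lie_inv_add lie_inv_diff)
      (rule inv wI wJ s)+
  have q: "lie_along \<xi> (- transpose N) (\<lambda>y. q y (s y)) x (q x (w1, w2))"
    unfolding q_def fst_conv snd_conv
    by (intro lie_along_scaleR lie_along_diff lie_along_mult lie_inv_add lie_inv_diff lie_inv_mult)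
      (rule inv tI tJ s)+
  show "lie_along \<xi> N (\<lambda>y. fst (gcs_I (g y) (I y) (J y) (b y) (s y))) x
           (fst (gcs_I (g x) (I x) (J x) (b x) (w1, w2)))"
    unfolding eq[OF S(2)] fst_conv by (rule lie_along_cong[OF p S(1,2)]) (simp add: eq)
  show "lie_along \<xi> (- transpose N) (\<lambda>y. snd (gcs_I (g y) (I y) (J y) (b y) (s y))) x
           (snd (gcs_I (g x) (I x) (J x) (b x) (w1, w2)))"
    unfolding eq[OF S(2)] snd_conv
    by (rule lie_along_cong[OF lie_along_add[OF q lie_along_mult[OF inv(4) p]] S(1,2)]) (simp add: eq)
qed

lemma cnj_wedge1: "cnj (wedge1 \<xi> \<alpha> vs) = wedge1 (\<lambda>v. cnj (\<xi> v)) (\<lambda>us. cnj (\<alpha> us)) vs"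
  by (induction vs arbitrary: \<alpha>) auto

section \<open>Spinors of symplectic type\<close>

lemma has_derivative_Complex:
  assumes "(f has_derivative f') F" "(g has_derivative g') F"
  shows "((\<lambda>y. Complex (f y) (g y)) has_derivative (\<lambda>h. Complex (f' h) (g' h))) F"
  unfolding Complex_eq
  by (intro has_derivative_add has_derivative_mult_right has_derivative_of_real assms)

lemma has_derivative_matrix_inner:
  fixes K :: "'a::real_normed_vector \<Rightarrow> real^'n::finite^'m::finite"
  assumes "(K has_derivative K') F"
  shows "((\<lambda>y. (K y *v z) \<bullet> v) has_derivative (\<lambda>h. (K' h *v z) \<bullet> v)) F"
  by (intro has_derivative_inner_left assms bounded_linear.has_derivative[OF
        bounded_bilinear.bounded_linear_left[OF bounded_bilinear_matrix_vector_mult]])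

lemma inner_transpose_mult: "(transpose A *v u) \<bullet> v = u \<bullet> (A *v v)" for A :: "real^'n::finite^'m::finite"
  using dot_lmul_matrix[of u A v] vector_transpose_matrix[of u "transpose A"] by simp

lemma alternating_form_0:
  assumes "alternating_form \<alpha>" shows "\<alpha> (0 # vs) = 0"
  using linear_0[OF alternating_linear[OF assms, of "[]" vs]] by simp

text \<open>With \<open>P\<close> the negative inverse of \<Omega> and \<open>A j\<close> its j-th
  partial derivative, the left side is the sum of the j-th partial derivatives of
  \<open>P $ k $ j\<close>. The identity says that the bivector \<open>P\<close> has divergence zero
  for the Liouville volume of the closed form \<Omega>.\<close>

lemma twisted_trace_identity:
  fixes P :: "real^'m::finite^'m" and A :: "'m \<Rightarrow> real^'m^'m"
  assumes P: "\<And>i j. P $ j $ i = - P $ i $ j"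
    and closed: "\<And>i a b. A i $ b $ a - A a $ b $ i + A b $ a $ i = 0"
  shows "(\<Sum>j\<in>UNIV. (P ** A j ** P) $ k $ j) = 1/2 * (\<Sum>j\<in>UNIV. P $ k $ j * (\<Sum>l\<in>UNIV. (P ** A j) $ l $ l))"
proof -
  define T where "T = (\<Sum>j\<in>UNIV. (P ** A j ** P) $ k $ j)"
  have T1: "T = (\<Sum>a\<in>UNIV. \<Sum>b\<in>UNIV. \<Sum>j\<in>UNIV. P $ k $ a * P $ b $ j * A j $ a $ b)"
  proof -
    have "T = (\<Sum>j\<in>UNIV. \<Sum>b\<in>UNIV. \<Sum>a\<in>UNIV. P $ k $ a * P $ b $ j * A j $ a $ b)"
      unfolding T_def by (simp add: matrix_matrix_mult_def sum_distrib_left sum_distrib_right mult_ac)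
    also have "\<dots> = (\<Sum>j\<in>UNIV. \<Sum>a\<in>UNIV. \<Sum>b\<in>UNIV. P $ k $ a * P $ b $ j * A j $ a $ b)"
      by (rule sum.cong[OF refl]) (rule sum.swap)
    also have "\<dots> = (\<Sum>a\<in>UNIV. \<Sum>j\<in>UNIV. \<Sum>b\<in>UNIV. P $ k $ a * P $ b $ j * A j $ a $ b)"
      by (rule sum.swap)
    also have "\<dots> = (\<Sum>a\<in>UNIV. \<Sum>b\<in>UNIV. \<Sum>j\<in>UNIV. P $ k $ a * P $ b $ j * A j $ a $ b)"
      by (rule sum.cong[OF refl]) (rule sum.swap)
    finally show ?thesis .
  qed
  \<comment> \<open>A second expression for the same sum, obtained by renaming \<open>b\<close> and
    \<open>j\<close> and using that \<open>P\<close> is antisymmetric. Adding the two produces the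
    combination of \<open>A\<close> to which closedness applies.\<close>
  have T2: "T = (\<Sum>a\<in>UNIV. \<Sum>b\<in>UNIV. \<Sum>j\<in>UNIV. - (P $ k $ a * P $ b $ j * A b $ a $ j))"
  proof -
    have "T = (\<Sum>a\<in>UNIV. \<Sum>j\<in>UNIV. \<Sum>b\<in>UNIV. P $ k $ a * P $ b $ j * A j $ a $ b)"
      unfolding T1 by (rule sum.cong[OF refl]) (rule sum.swap)
    also have "\<dots> = (\<Sum>a\<in>UNIV. \<Sum>b\<in>UNIV. \<Sum>j\<in>UNIV. - (P $ k $ a * P $ b $ j * A b $ a $ j))"
    proof (intro sum.cong refl)
      show "P $ k $ a * P $ b $ j * A j $ a $ b = - (P $ k $ a * P $ j $ b * A j $ a $ b)" for a b j
        using P[of b j] by simp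
    qed
    finally show ?thesis .
  qed
  have "2 * T = (\<Sum>a\<in>UNIV. \<Sum>b\<in>UNIV. \<Sum>j\<in>UNIV. P $ k $ a * (P $ j $ b * A a $ b $ j))"
  proof -
    have "T + T = (\<Sum>a\<in>UNIV. \<Sum>b\<in>UNIV. \<Sum>j\<in>UNIV. P $ k $ a * P $ b $ j * A j $ a $ b
        + - (P $ k $ a * P $ b $ j * A b $ a $ j))"
      by (subst (1) T1, subst T2) (simp only: sum.distrib)
    also have "\<dots> = (\<Sum>a\<in>UNIV. \<Sum>b\<in>UNIV. \<Sum>j\<in>UNIV. P $ k $ a * (P $ j $ b * A a $ b $ j))"
    proof (intro sum.cong refl)
      fix a b j
      have "A a $ b $ j = A b $ a $ j - A j $ a $ b" using closed[of j a b] by simp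
      then show "P $ k $ a * P $ b $ j * A j $ a $ b + - (P $ k $ a * P $ b $ j * A b $ a $ j) =
          P $ k $ a * (P $ j $ b * A a $ b $ j)"
        using P[of b j] by (simp add: right_diff_distrib)
    qed
    finally show ?thesis by simp
  qed
  also have "\<dots> = (\<Sum>a\<in>UNIV. P $ k $ a * (\<Sum>l\<in>UNIV. (P ** A a) $ l $ l))"
    by (rule sum.cong[OF refl], subst sum.swap) (simp add: matrix_matrix_mult_def sum_distrib_left)
  finally show ?thesis unfolding T_def by simp
qed

text \<open>The situation on an open set where the Poisson tensor \<open>P\<close> is invertible.
  The bihermitian data enter only through the matrices \<open>P\<close>, \<open>K\<close> and
  \<Omega>; antisymmetry of these is not assumed but deduced from \<psi> being alternating.\<close>

locale symplectic_spinor =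
  fixes n :: nat and U :: "(real^'m::finite) set" and \<psi> :: "real^'m \<Rightarrow> ('m, complex) form"
    and P K \<Omega> :: "real^'m \<Rightarrow> real^'m^'m" and Y \<eta> :: "real^'m \<Rightarrow> real^'m"
    and H vol :: "real^'m \<Rightarrow> ('m, real) form"
  assumes open_U: "open U"
    and smooth_\<psi>: "\<And>vs. smooth_on U (\<lambda>x. \<psi> x vs)"
    and alt_\<psi>: "\<And>x. x \<in> U \<Longrightarrow> alternating_form (\<psi> x)"
    and rec_\<psi>: "\<And>x z vs. x \<in> U \<Longrightarrow> \<psi> x (z # vs) =
      wedge1 (\<lambda>v. Complex ((K x *v z) \<bullet> v) ((\<Omega> x *v z) \<bullet> v)) (\<psi> x) vs"
    and norm_\<psi>: "\<And>x vs. x \<in> U \<Longrightarrow>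
      mukai (\<psi> x) (\<lambda>us. cnj (\<psi> x us)) vs = (2 * \<i>) ^ n * complex_of_real (vol x vs)"
    and alt_vol: "\<And>x. x \<in> U \<Longrightarrow> alternating_form (vol x)"
    and vol_nonzero: "\<And>x. x \<in> U \<Longrightarrow> \<exists>vs. length vs = CARD('m) \<and> vol x vs \<noteq> 0"
    and twisted: "\<And>x vs. x \<in> U \<Longrightarrow> twisted_d H \<psi> x vs = (\<i> / 2) * clifford (complexify (Y x, \<eta> x)) (\<psi> x) vs"
    and form_H: "\<And>x. x \<in> U \<Longrightarrow> k_form 3 (H x)"
    and P_\<Omega>: "\<And>x. x \<in> U \<Longrightarrow> P x ** \<Omega> x = - mat 1"
    and diff_vol: "\<And>x vs. x \<in> U \<Longrightarrow> (\<lambda>x. vol x vs) differentiable (at x)"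
    and diff: "\<And>x. x \<in> U \<Longrightarrow> P differentiable (at x)" "\<And>x. x \<in> U \<Longrightarrow> K differentiable (at x)" "\<And>x. x \<in> U \<Longrightarrow> \<Omega> differentiable (at x)"
      "\<And>x. x \<in> U \<Longrightarrow> Y differentiable (at x)" "\<And>x. x \<in> U \<Longrightarrow> \<eta> differentiable (at x)"
begin

definition "\<beta> x z v = Complex ((K x *v z) \<bullet> v) ((\<Omega> x *v z) \<bullet> v)"

text \<open>The Mukai pairing of \<psi> with its conjugate before truncation to top degree. Keeping
  all degrees makes it an exponential with its own recursion.\<close>

definition "\<phi> x = wedge (\<psi> x) (reversal (\<lambda>us. cnj (\<psi> x us)))"

abbreviation D where "D f x \<equiv> frechet_derivative f (at x)"

lemma rec: "x \<in> U \<Longrightarrow> \<psi> x (z # vs) = wedge1 (\<beta> x z) (\<psi> x) vs"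
  by (simp add: rec_\<psi> \<beta>_def[abs_def])

lemma \<psi>_odd: "x \<in> U \<Longrightarrow> odd (length vs) \<Longrightarrow> \<psi> x vs = 0"
proof (induction "length vs" arbitrary: vs rule: less_induct)
  case less
  then show ?case
    by (cases vs) (auto simp: rec wedge1_nth intro!: sum.neutral)
qed

lemma \<phi>_top: "x \<in> U \<Longrightarrow> length vs = CARD('m) \<Longrightarrow> \<phi> x vs = (2 * \<i>) ^ n * complex_of_real (vol x vs)"
  using norm_\<psi>[of x vs] by (simp add: mukai_def \<phi>_def)

lemma \<psi>_Nil_nonzero:
  assumes "x \<in> U" shows "\<psi> x [] \<noteq> 0"
proof
  assume "\<psi> x [] = 0"
  with exp_recursion_unique[of "\<psi> x" "\<beta> x"] rec[OF assms] have "\<psi> x = (\<lambda>vs. 0)" by blast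
  then have "\<phi> x vs = 0" for vs by (simp add: \<phi>_def)
  with vol_nonzero[OF assms] \<phi>_top[OF assms] show False by force
qed

lemma \<psi>_two: "x \<in> U \<Longrightarrow> \<psi> x [z, w] = \<beta> x z w * \<psi> x []"
  by (simp add: rec)

lemma \<beta>_antisym:
  assumes "x \<in> U" shows "\<beta> x w z = - \<beta> x z w"
proof -
  have "\<psi> x [w, z] = - \<psi> x [z, w]"
    using alternating_swap[OF alt_\<psi>[OF assms], of "[]" w z "[]"] by simp
  then have "\<psi> x [] * (\<beta> x w z + \<beta> x z w) = 0"
    by (simp add: \<psi>_two[OF assms] algebra_simps)
  then show ?thesis using \<psi>_Nil_nonzero[OF assms] by (simp add: eq_neg_iff_add_eq_0)
qed

lemma K_antisym: "x \<in> U \<Longrightarrow> (K x *v w) \<bullet> z = - ((K x *v z) \<bullet> w)"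
  and \<Omega>_antisym: "x \<in> U \<Longrightarrow> (\<Omega> x *v w) \<bullet> z = - ((\<Omega> x *v z) \<bullet> w)"
  using \<beta>_antisym[of x w z] by (simp_all add: \<beta>_def complex_eq_iff)

lemma \<Omega>_P:
  assumes "x \<in> U" shows "\<Omega> x ** P x = - mat 1"
proof -
  have "(- P x) ** \<Omega> x = mat 1" by (simp add: matrix_mult_distribs P_\<Omega>[OF assms])
  then have "\<Omega> x ** (- P x) = mat 1" using matrix_left_right_inverse by blast
  then show ?thesis unfolding matrix_mult_distribs by (metis minus_minus)
qed

text \<open>Reversal turns the conjugate of e^\<beta> into the exponential of minus the conjugate of
  \<beta>, so the exponents combine to twice the imaginary part, 2i \<Omega>. The sign in
  \<open>wedge_Cons\<close> disappears because \<psi> has only even degrees.\<close>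

lemma \<phi>_rec:
  assumes "x \<in> U"
  shows "\<phi> x (z # vs) = wedge1 (\<lambda>v. 2 * \<i> * complex_of_real ((\<Omega> x *v z) \<bullet> v)) (\<phi> x) vs"
proof -
  define s where "s = reversal (\<lambda>us. cnj (\<psi> x us))"
  have even: "(\<lambda>us. (-1) ^ length us * \<psi> x us) = \<psi> x"
  proof
    show "(-1) ^ length us * \<psi> x us = \<psi> x us" for us
      using \<psi>_odd[OF assms, of us] by (cases "even (length us)") auto
  qed
  have s: "s (z # us) = - wedge1 (\<lambda>v. cnj (\<beta> x z v)) s us" for us
  proof -
    have sq: "(-1) ^ length us * ((-1) ^ length us * c) = c" for c :: complex
      by (simp flip: mult.assoc power_mult_distrib)
    have "\<psi> x (rev us @ [z]) = (-1) ^ length us * \<psi> x (z # rev us)"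
      using alternating_move[OF alt_\<psi>[OF assms], of "[]" z "rev us" "[]"] by (simp add: sq)
    also have "\<dots> = - wedge1 (\<beta> x z) (\<lambda>us. \<psi> x (rev us)) us"
      by (simp add: rec[OF assms] wedge1_rev sq)
    finally show ?thesis by (simp add: s_def reversal_def[abs_def] cnj_wedge1)
  qed
  have "\<phi> x (z # vs) = wedge (wedge1 (\<beta> x z) (\<psi> x)) s vs
      + wedge (\<lambda>us. (-1) ^ length us * \<psi> x us) (\<lambda>us. - wedge1 (\<lambda>v. cnj (\<beta> x z v)) s us) vs"
    unfolding \<phi>_def s_def[symmetric] wedge_Cons s by (simp only: rec[OF assms] eta_contract_eq)
  also have "\<dots> = wedge1 (\<beta> x z) (\<phi> x) vs + - 1 * wedge1 (\<lambda>v. cnj (\<beta> x z v)) (\<phi> x) vs"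
    by (simp add: wedge_wedge1_left wedge_uminus_right wedge_wedge1_right \<phi>_def s_def)
  also have "\<dots> = wedge1 (\<lambda>v. \<beta> x z v + - 1 * cnj (\<beta> x z v)) (\<phi> x) vs"
    by (simp only: wedge1_add_left wedge1_cmult_left)
  also have "(\<lambda>v. \<beta> x z v + - 1 * cnj (\<beta> x z v)) = (\<lambda>v. 2 * \<i> * complex_of_real ((\<Omega> x *v z) \<bullet> v))"
    by (auto simp: \<beta>_def complex_eq_iff)
  finally show ?thesis .
qed

lemma \<psi>_diff: "x \<in> U \<Longrightarrow> (\<lambda>x. \<psi> x vs) differentiable (at x)"
  by (rule smooth_on_differentiable[OF smooth_\<psi>])

lemma \<phi>_diff: "x \<in> U \<Longrightarrow> (\<lambda>x. \<phi> x vs) differentiable (at x)"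
proof -
  assume x: "x \<in> U"
  have "(\<lambda>x. cnj (\<psi> x us)) differentiable (at x)" for us
    using bounded_linear.has_derivative[OF bounded_linear_cnj has_derivative_frechet[OF \<psi>_diff[OF x]]]
    by (rule differentiableI)
  then show ?thesis
    unfolding \<phi>_def wedge_def reversal_def
    by (intro differentiable_sum ballI differentiable_mult differentiable_const \<psi>_diff[OF x]) auto
qed

section \<open>Logarithmic derivative of the scalar factor\<close>

definition "r x = - (1/2) *\<^sub>R (\<Omega> x *v Y x)"

definition "t x = (1/2) *\<^sub>R (K x *v Y x + \<eta> x)"

text \<open>The one-form (i/2)(i_Y \<beta> + \<eta>), with real part \<open>r\<close> and imaginary
  part \<open>t\<close>; it will be the logarithmic derivative of the scalar factor of
  \<psi>.\<close>

definition "\<theta> x v = Complex (r x \<bullet> v) (t x \<bullet> v)"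

lemma clifford_\<psi>:
  assumes "x \<in> U"
  shows "(\<i> / 2) * clifford (complexify (Y x, \<eta> x)) (\<psi> x) vs = wedge1 (\<theta> x) (\<psi> x) vs"
proof -
  have re: "Re_gt (complexify e) = e" "Im_gt (complexify e) = 0" for e :: "'m gt"
    by (simp_all add: Re_gt_def Im_gt_def complexify_def vec_eq_iff prod_eq_iff)
  have w: "wedge (cform1 \<xi>) \<alpha> vs = wedge1 (\<lambda>v. \<Sum>j\<in>UNIV. \<xi> $ j * complex_of_real (v $ j)) \<alpha> vs"
    for \<xi> and \<alpha> :: "('m, complex) form" and vs
    by (subst wedge_degree_one) (auto simp: cform1_def)
  have "clifford (complexify (Y x, \<eta> x)) (\<psi> x) vs = wedge1 (\<beta> x (Y x)) (\<psi> x) vs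
      + wedge1 (\<lambda>v. complex_of_real (\<eta> x \<bullet> v)) (\<psi> x) vs"
    unfolding clifford_def re w interior_prod_def rec[OF assms, of "Y x", symmetric]
    by (simp add: alternating_form_0[OF alt_\<psi>[OF assms]] complexify_def inner_vec_def)
  also have "(\<i> / 2) * \<dots> = wedge1 (\<lambda>v. (\<i> / 2) * (\<beta> x (Y x) v + complex_of_real (\<eta> x \<bullet> v))) (\<psi> x) vs"
    by (simp only: wedge1_cmult_left wedge1_add_left)
  also have "(\<lambda>v. (\<i> / 2) * (\<beta> x (Y x) v + complex_of_real (\<eta> x \<bullet> v))) = \<theta> x"
    by (auto simp: \<beta>_def \<theta>_def r_def t_def complex_eq_iff inner_add_left)
  finally show ?thesis .
qed

lemma H_degree: "x \<in> U \<Longrightarrow> length vs \<noteq> 3 \<Longrightarrow> cplx (H x) vs = 0"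
  using form_H[of x] by (simp add: k_form_def cplx_def)

text \<open>The part of degree one of the spinor equation, which the 3-form \<open>H\<close> does
  not reach.\<close>

lemma df:
  assumes "x \<in> U"
  shows "D (\<lambda>x. \<psi> x []) x v = \<theta> x v * \<psi> x []"
  using twisted[OF assms, of "[v]", unfolded clifford_\<psi>[OF assms]] H_degree[OF assms]
  by (simp add: twisted_d_def ext_d_def wedge_Cons)

lemma \<beta>_derivative:
  assumes "x \<in> U"
  shows "((\<lambda>y. \<beta> y z v) has_derivative
    (\<lambda>h. Complex ((D K x h *v z) \<bullet> v) ((D \<Omega> x h *v z) \<bullet> v))) (at x)"
  unfolding \<beta>_def
  by (intro has_derivative_Complex has_derivative_matrix_inner has_derivative_frechet diff assms)

text \<open>The part of degree three of the spinor equation. With f the scalar factor, d(f \<beta>)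
  has the term df wedge \<beta>, which cancels \<theta> wedge f \<beta> by \<open>df\<close>; then
  f, being nonzero, is divided out.\<close>

lemma d\<beta>:
  assumes "x \<in> U"
  shows "Complex ((D K x u *v v) \<bullet> w) ((D \<Omega> x u *v v) \<bullet> w)
    - Complex ((D K x v *v u) \<bullet> w) ((D \<Omega> x v *v u) \<bullet> w)
    + Complex ((D K x w *v u) \<bullet> v) ((D \<Omega> x w *v u) \<bullet> v) = complex_of_real (H x [u, v, w])"
proof -
  let ?f = "\<psi> x []" and ?B = "\<lambda>h z v. Complex ((D K x h *v z) \<bullet> v) ((D \<Omega> x h *v z) \<bullet> v)"
  have d2: "D (\<lambda>y. \<psi> y [z, v]) x h = \<beta> x z v * (\<theta> x h * ?f) + ?B h z v * ?f" for z v h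
  proof -
    have "D (\<lambda>y. \<psi> y [z, v]) x = D (\<lambda>y. \<beta> y z v * \<psi> y []) x"
      by (rule frechet_derivative_cong_open[OF open_U assms]) (rule \<psi>_two)
    also have "\<dots> = (\<lambda>h. \<beta> x z v * D (\<lambda>x. \<psi> x []) x h + ?B h z v * ?f)"
      by (rule frechet_derivative_eqI[OF has_derivative_mult[OF \<beta>_derivative[OF assms]
            has_derivative_frechet[OF \<psi>_diff[OF assms]]]])
    finally show ?thesis by (simp add: df[OF assms])
  qed
  have e: "ext_d \<psi> x [u, v, w] = D (\<lambda>y. \<psi> y [v, w]) x u - D (\<lambda>y. \<psi> y [u, w]) x v + D (\<lambda>y. \<psi> y [u, v]) x w"
    by (simp add: ext_d_def numeral_3_eq_3 lessThan_Suc)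
  have "wedge (cplx (H x)) (\<psi> x) [u, v, w] = complex_of_real (H x [u, v, w]) * ?f"
    using H_degree[OF assms] by (simp add: wedge_Cons) (simp add: cplx_def)
  then have "ext_d \<psi> x [u, v, w] = complex_of_real (H x [u, v, w]) * ?f + wedge1 (\<theta> x) (\<psi> x) [u, v, w]"
    using twisted[OF assms, of "[u, v, w]", unfolded clifford_\<psi>[OF assms]]
    by (simp only: twisted_d_def diff_eq_eq add.commute)
  then have "?f * (?B u v w - ?B v u w + ?B w u v) = ?f * complex_of_real (H x [u, v, w])"
    unfolding e d2 by (simp add: \<psi>_two[OF assms] algebra_simps)
  then show ?thesis using \<psi>_Nil_nonzero[OF assms] by simp
qed

lemma dK: "x \<in> U \<Longrightarrow> (D K x u *v v) \<bullet> w - (D K x v *v u) \<bullet> w + (D K x w *v u) \<bullet> v = H x [u, v, w]"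
  and d\<Omega>: "x \<in> U \<Longrightarrow> (D \<Omega> x u *v v) \<bullet> w - (D \<Omega> x v *v u) \<bullet> w + (D \<Omega> x w *v u) \<bullet> v = 0"
  using d\<beta>[of x u v w] by (simp_all add: complex_eq_iff)

lemma t_diff: "x \<in> U \<Longrightarrow> t differentiable (at x)"
  and r_diff: "x \<in> U \<Longrightarrow> r differentiable (at x)"
proof -
  assume x: "x \<in> U"
  have "(\<lambda>x. K x *v Y x) differentiable (at x)" "(\<lambda>x. \<Omega> x *v Y x) differentiable (at x)"
    using bounded_bilinear.FDERIV[OF bounded_bilinear_matrix_vector_mult] diff x
    unfolding differentiable_def by blast+
  then show "t differentiable (at x)" "r differentiable (at x)"
    unfolding t_def r_def using diff(5)[OF x]
    by (auto intro!: differentiable_scaleR differentiable_add)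
qed

text \<open>The second derivatives of the scalar factor f are symmetric, and df = \<theta> f. The
  terms quadratic in \<theta> are symmetric by themselves, so d \<theta> = 0, and the claim is its
  imaginary part.\<close>

lemma dt:
  assumes "x \<in> U"
  shows "D t x v \<bullet> u = D t x u \<bullet> v"
proof -
  let ?f = "\<psi> x []"
  have d: "D (\<lambda>y. D (\<lambda>x. \<psi> x []) y u) x v = (\<theta> x u * \<theta> x v + Complex (D r x v \<bullet> u) (D t x v \<bullet> u)) * ?f" for u v
  proof -
    have "((\<lambda>y. \<theta> y u) has_derivative (\<lambda>h. Complex (D r x h \<bullet> u) (D t x h \<bullet> u))) (at x)"
      unfolding \<theta>_def
      by (intro has_derivative_Complex has_derivative_inner_left has_derivative_frechet t_diff r_diff assms)
    from has_derivative_mult[OF this has_derivative_frechet[OF \<psi>_diff[OF assms, of "[]"]]]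
    have "D (\<lambda>y. \<theta> y u * \<psi> y []) x = (\<lambda>h. \<theta> x u * D (\<lambda>x. \<psi> x []) x h
        + Complex (D r x h \<bullet> u) (D t x h \<bullet> u) * ?f)"
      by (rule frechet_derivative_eqI)
    moreover have "D (\<lambda>y. D (\<lambda>x. \<psi> x []) y u) x = D (\<lambda>y. \<theta> y u * \<psi> y []) x"
      by (rule frechet_derivative_cong_open[OF open_U assms]) (rule df)
    ultimately show ?thesis by (simp add: df[OF assms] algebra_simps)
  qed
  have "(\<theta> x u * \<theta> x v + Complex (D r x v \<bullet> u) (D t x v \<bullet> u)) * ?f
      = (\<theta> x v * \<theta> x u + Complex (D r x u \<bullet> v) (D t x u \<bullet> v)) * ?f"
    using symmetric_second_derivative[OF smooth_\<psi> open_U assms, of "[]" u v] unfolding d .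
  then have "Complex (D r x v \<bullet> u) (D t x v \<bullet> u) = Complex (D r x u \<bullet> v) (D t x u \<bullet> v)"
    unfolding mult.commute[of "\<theta> x v" "\<theta> x u"]
    using \<psi>_Nil_nonzero[OF assms] by (simp only: mult_cancel_right add_left_cancel) simp
  then show ?thesis by simp
qed

lemma \<Omega>_derivative_antisym:
  assumes "x \<in> U"
  shows "(D \<Omega> x h *v w) \<bullet> z = - ((D \<Omega> x h *v z) \<bullet> w)"
proof -
  note d = has_derivative_matrix_inner[OF has_derivative_frechet[OF diff(3)[OF assms]]]
  have "((\<lambda>y. (\<Omega> y *v w) \<bullet> z) has_derivative (\<lambda>h. - ((D \<Omega> x h *v z) \<bullet> w))) (at x)"
    by (rule has_derivative_transform_within_open[OF has_derivative_minus[OF d] open_U assms])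
      (simp add: \<Omega>_antisym[of _ w z])
  from fun_cong[OF has_derivative_unique[OF d this]] show ?thesis .
qed

text \<open>The logarithmic derivative of the volume is that of |f|^2, which is twice the real part
  of \<theta>, plus that of the Pfaffian of \<Omega>. The constant (2i)^n occurs on both sides of
  the derived normalization and cancels.\<close>

lemma vol_derivative:
  assumes "x \<in> U" and ks: "distinct ks" "set ks = UNIV"
  shows "D (\<lambda>y. vol y (axes ks)) x h =
    (- ((\<Omega> x *v Y x) \<bullet> h) - 1/2 * (\<Sum>j\<in>UNIV. (P x ** D \<Omega> x h) $ j $ j)) * vol x (axes ks)"
proof -
  have len: "length (axes ks) = CARD('m)" using ks by (metis distinct_card length_axes)
  \<comment> \<open>The solution of \<open>\<Omega> x *v Z j = D \<Omega> x h *v axis j 1\<close>,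
    as \<open>- P x\<close> inverts \<open>\<Omega> x\<close>. The factor 2i of the exponent occurs
    on both sides and does not enter.\<close>
  define Z where "Z j = - (P x *v (D \<Omega> x h *v axis j 1))" for j
  have \<Omega>_Z: "\<Omega> x *v Z j = D \<Omega> x h *v axis j 1" for j
    by (simp add: Z_def matrix_vector_mult_uminus matrix_vector_mul_assoc matrix_mul_assoc \<Omega>_P[OF assms(1)])
      (simp add: matrix_vector_mul_assoc[symmetric] matrix_vector_mult_uminus)
  have Z_nth: "Z j $ j = - (P x ** D \<Omega> x h) $ j $ j" for j
    by (simp add: Z_def matrix_vector_mul_assoc matrix_vector_mul_component inner_axis)
  let ?\<beta> = "\<lambda>y z v. 2 * \<i> * complex_of_real ((\<Omega> y *v z) \<bullet> v)"
  let ?\<beta>' = "\<lambda>z v h. 2 * \<i> * complex_of_real ((D \<Omega> x h *v z) \<bullet> v)"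
  have nz: "\<phi> x [] \<noteq> 0" using \<psi>_Nil_nonzero[OF assms(1)] by (simp add: \<phi>_def reversal_def)
  have top: "D (\<lambda>y. \<phi> y (axes ks)) x h =
      (D (\<lambda>y. \<phi> y []) x h / \<phi> x [] + of_real (1/2 * (\<Sum>j\<in>UNIV. Z j $ j))) * \<phi> x (axes ks)"
  proof (rule exp_top_derivative[OF open_U assms(1) \<phi>_rec, where \<beta>' = ?\<beta>' and \<alpha> = "vol x" and \<kappa> = "(2 * \<i>) ^ n"])
    show "((\<lambda>y. \<phi> y vs) has_derivative D (\<lambda>y. \<phi> y vs) x) (at x)" for vs
      by (rule has_derivative_frechet[OF \<phi>_diff[OF assms(1)]])
    show "((\<lambda>y. ?\<beta> y z v) has_derivative ?\<beta>' z v) (at x)" for z v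
      by (intro has_derivative_mult_right has_derivative_of_real has_derivative_matrix_inner
          has_derivative_frechet diff assms)
    show "linear (\<lambda>z. ?\<beta>' z v h)" for v
      by (intro linearI) (auto simp: matrix_vector_right_distrib matrix_vector_mult_scaleR inner_add_left
          distrib_left scaleR_conv_of_real[where 'a = complex])
    show "?\<beta>' v z h = - ?\<beta>' z v h" for z v
      using \<Omega>_derivative_antisym[OF assms(1), of h v z] by simp
    show "?\<beta>' (axis j 1) v h = ?\<beta> x (Z j) v" for j v by (simp add: \<Omega>_Z)
  qed (use nz \<phi>_top[OF assms(1)] alt_vol[OF assms(1)] ks in auto)
  have "D (\<lambda>y. \<phi> y []) x h = (\<theta> x h + cnj (\<theta> x h)) * \<phi> x []"
  proof -
    note d = has_derivative_frechet[OF \<psi>_diff[OF assms(1), of "[]"]]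
    have "((\<lambda>y. \<psi> y [] * cnj (\<psi> y [])) has_derivative
        (\<lambda>h. \<psi> x [] * cnj (D (\<lambda>y. \<psi> y []) x h) + D (\<lambda>y. \<psi> y []) x h * cnj (\<psi> x []))) (at x)"
      by (rule has_derivative_mult[OF d bounded_linear.has_derivative[OF bounded_linear_cnj d]])
    from frechet_derivative_eqI[OF this] show ?thesis
      by (simp add: \<phi>_def reversal_def df[OF assms(1)] algebra_simps)
  qed
  note dnil = this
  have nil: "D (\<lambda>y. \<phi> y []) x h / \<phi> x [] = of_real (- ((\<Omega> x *v Y x) \<bullet> h))"
  proof -
    have "\<theta> x h + cnj (\<theta> x h) = of_real (- ((\<Omega> x *v Y x) \<bullet> h))"
      by (simp add: \<theta>_def r_def complex_eq_iff)
    with nz show ?thesis by (simp add: dnil)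
  qed
  have "D (\<lambda>y. \<phi> y (axes ks)) x = D (\<lambda>y. (2 * \<i>) ^ n * complex_of_real (vol y (axes ks))) x"
    by (rule frechet_derivative_cong_open[OF open_U assms(1)]) (rule \<phi>_top[OF _ len])
  also have "\<dots> = (\<lambda>h. (2 * \<i>) ^ n * complex_of_real (D (\<lambda>y. vol y (axes ks)) x h))"
    by (rule frechet_derivative_eqI[OF has_derivative_mult_right[OF has_derivative_of_real[OF
            has_derivative_frechet[OF diff_vol[OF assms(1)]]]]])
  finally have "(2 * \<i>) ^ n * complex_of_real (D (\<lambda>y. vol y (axes ks)) x h) =
     (2 * \<i>) ^ n * complex_of_real ((- ((\<Omega> x *v Y x) \<bullet> h) + 1/2 * (\<Sum>j\<in>UNIV. Z j $ j)) * vol x (axes ks))"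
    using top unfolding nil \<phi>_top[OF assms(1) len] by (simp add: algebra_simps)
  then have "D (\<lambda>y. vol y (axes ks)) x h =
      (- ((\<Omega> x *v Y x) \<bullet> h) + 1/2 * (\<Sum>j\<in>UNIV. Z j $ j)) * vol x (axes ks)"
    by (simp only: mult_cancel_left of_real_eq_iff power_eq_0_iff) simp
  then show ?thesis by (simp add: Z_nth sum_negf)
qed

lemma P_antisym:
  assumes "x \<in> U" shows "P x $ j $ i = - P x $ i $ j"
proof -
  have "transpose (\<Omega> x) $ k $ l = (- \<Omega> x) $ k $ l" for k l
    using \<Omega>_antisym[OF assms, of "axis k 1" "axis l 1"]
    by (simp add: inner_axis matrix_vector_mul_component transpose_def)
  then have t: "transpose (\<Omega> x) = - \<Omega> x" unfolding vec_eq_iff by blast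
  have "transpose (P x ** \<Omega> x) = - mat 1"
    unfolding P_\<Omega>[OF assms] by (auto simp: vec_eq_iff transpose_def mat_def)
  then have "\<Omega> x ** transpose (P x) = mat 1"
    unfolding matrix_transpose_mul t matrix_mult_distribs by simp
  then have "P x ** (\<Omega> x ** transpose (P x)) = P x" by simp
  then have "- transpose (P x) = P x"
    by (simp add: matrix_mul_assoc P_\<Omega>[OF assms] matrix_mult_distribs)
  from arg_cong[where f = "\<lambda>M. M $ j $ i", OF this] show ?thesis by (simp add: transpose_def)
qed

text \<open>The product rule in \<open>divergence_formula\<close> gives a term with derivatives of
  \<open>P\<close> and one with derivatives of the volume. The trace in the latter cancels the
  former, and what remains is - P \<Omega> Y = Y.\<close>

lemma div_eq:
  fixes \<gamma> :: "real^'m \<Rightarrow> ('m, real) form"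
  assumes x: "x \<in> U"
    and \<gamma>: "\<And>us. (\<lambda>y. \<gamma> y us) differentiable (at x)"
    and eq: "\<And>y a vs. y \<in> U \<Longrightarrow> interior_prod (P y *v a) (vol y) vs = wedge (form1 a) (\<gamma> y) vs"
    and d\<gamma>: "\<And>vs. ext_d \<gamma> x vs = interior_prod X (vol x) vs"
  shows "X = Y x"
proof -
  obtain ks :: "'m list" where ks: "set ks = UNIV" "distinct ks"
    using finite_distinct_list[OF finite, of "UNIV :: 'm set"] by blast
  let ?v = "\<lambda>y. vol y (axes ks)"
  have "?v x \<noteq> 0"
    using vol_nonzero[OF x] alternating_axes_eq_0[OF alt_vol[OF x] ks(2,1)] by blast
  \<comment> \<open>Differentiating \<open>P ** \<Omega> = - mat 1\<close> and multiplying by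
    \<open>P\<close> from the right.\<close>
  have dP: "D P x h = P x ** D \<Omega> x h ** P x" for h
  proof -
    have "((\<lambda>y. - mat 1) has_derivative (\<lambda>h. P x ** D \<Omega> x h + D P x h ** \<Omega> x)) (at x)"
      by (rule has_derivative_transform_within_open[OF bounded_bilinear.FDERIV[OF
              bounded_bilinear_matrix_matrix_mult has_derivative_frechet[OF diff(1)[OF x]]
              has_derivative_frechet[OF diff(3)[OF x]]] open_U x]) (simp add: P_\<Omega>)
    from fun_cong[OF has_derivative_unique[OF this has_derivative_const], of h]
    have "D P x h ** \<Omega> x = - (P x ** D \<Omega> x h)" by (simp add: eq_neg_iff_add_eq_0 add.commute)
    then have "D P x h ** \<Omega> x ** P x = - (P x ** D \<Omega> x h) ** P x" by simp
    moreover note \<Omega>_P[OF x]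
    ultimately show ?thesis by (simp add: matrix_mul_assoc[symmetric] matrix_mult_distribs)
  qed
  have dPn: "(\<lambda>y. P y $ k $ j) differentiable (at x)" for k j
    by (intro differentiable_nth diff x)
  have "X $ k = Y x $ k" for k
  proof -
    define A where "A j = D \<Omega> x (axis j 1)" for j
    have "?v x * X $ k = (\<Sum>j\<in>UNIV. D (\<lambda>y. ?v y * P y $ k $ j) x (axis j 1))"
      by (rule divergence_formula[OF open_U x alt_vol diff_vol[OF x] dPn \<gamma> eq d\<gamma> ks(2,1)])
    also have "\<dots> = (\<Sum>j\<in>UNIV. ?v x * (P x ** A j ** P x) $ k $ j + D ?v x (axis j 1) * P x $ k $ j)"
    proof (rule sum.cong[OF refl])
      fix j
      have "((\<lambda>y. P y $ k $ j) has_derivative (\<lambda>h. D P x h $ k $ j)) (at x)"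
        by (intro bounded_linear.has_derivative[OF bounded_linear_vec_nth] has_derivative_frechet diff x)
      from frechet_derivative_eqI[OF has_derivative_mult[OF has_derivative_frechet[OF diff_vol[OF x]] this]]
      show "D (\<lambda>y. ?v y * P y $ k $ j) x (axis j 1)
          = ?v x * (P x ** A j ** P x) $ k $ j + D ?v x (axis j 1) * P x $ k $ j"
        by (simp add: dP A_def)
    qed
    also have "\<dots> = ?v x * ((\<Sum>j\<in>UNIV. (P x ** A j ** P x) $ k $ j)
        - (\<Sum>j\<in>UNIV. P x $ k $ j * (\<Omega> x *v Y x) $ j)
        - 1/2 * (\<Sum>j\<in>UNIV. P x $ k $ j * (\<Sum>l\<in>UNIV. (P x ** A j) $ l $ l)))"
    proof -
      have "?v x * (P x ** A j ** P x) $ k $ j + D ?v x (axis j 1) * P x $ k $ j =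
        ?v x * ((P x ** A j ** P x) $ k $ j - P x $ k $ j * (\<Omega> x *v Y x) $ j
          - 1/2 * (P x $ k $ j * (\<Sum>l\<in>UNIV. (P x ** A j) $ l $ l)))" for j
        by (simp add: vol_derivative[OF x ks(2,1)] A_def inner_axis left_diff_distrib right_diff_distrib)
      then show ?thesis
        by (simp only: sum_distrib_left[symmetric] sum_subtractf)
    qed
    also have "(\<Sum>j\<in>UNIV. (P x ** A j ** P x) $ k $ j)
        = 1/2 * (\<Sum>j\<in>UNIV. P x $ k $ j * (\<Sum>l\<in>UNIV. (P x ** A j) $ l $ l))"
    proof (rule twisted_trace_identity[OF P_antisym[OF x]])
      show "A i $ b $ a - A a $ b $ i + A b $ a $ i = 0" for i a b
        using d\<Omega>[OF x, of "axis i 1" "axis a 1" "axis b 1"]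
        by (simp add: A_def matrix_vector_mul_component inner_axis)
    qed
    also have "(\<Sum>j\<in>UNIV. P x $ k $ j * (\<Omega> x *v Y x) $ j) = (P x *v (\<Omega> x *v Y x)) $ k"
      by (simp add: matrix_vector_mult_def)
    also have "\<dots> = - (Y x $ k)"
      by (simp add: matrix_vector_mul_assoc P_\<Omega>[OF x] matrix_vector_mult_uminus)
    finally show ?thesis using \<open>?v x \<noteq> 0\<close> by simp
  qed
  then show ?thesis by (simp add: vec_eq_iff)
qed

text \<open>Cartan's formula L_Y K = d i_Y K + i_Y dK, carried out in components: \<open>dt\<close>
  expresses d i_Y K through d \<eta>, \<open>dK\<close> replaces dK by \<open>H\<close>, and
  \<open>inv\<close> makes the left side vanish.\<close>

lemma two_form_zero:
  assumes x: "x \<in> U"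
    and inv: "lie_inv (Y x) (- transpose N) N K x"
    and N: "\<And>h. N *v h = D Y x h"
  shows "D \<eta> x u \<bullet> v - D \<eta> x v \<bullet> u = H x [Y x, u, v]"
proof -
  from inv obtain K' where "(K has_derivative K') (at x)" "K' (Y x) = - transpose N ** K x - K x ** N"
    by (auto simp: lie_inv_def)
  then have KY: "D K x (Y x) = - transpose N ** K x - K x ** N"
    by (simp add: frechet_derivative_eqI)
  have t': "D t x h = (1/2) *\<^sub>R (K x *v D Y x h + D K x h *v Y x + D \<eta> x h)" for h
  proof -
    have "(t has_derivative (\<lambda>h. (1/2) *\<^sub>R (K x *v D Y x h + D K x h *v Y x + D \<eta> x h))) (at x)"
      unfolding t_def[abs_def]
      by (intro has_derivative_scaleR_right has_derivative_add
          bounded_bilinear.FDERIV[OF bounded_bilinear_matrix_vector_mult] has_derivative_frechet diff x)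
    from frechet_derivative_eqI[OF this] show ?thesis by simp
  qed
  have "D \<eta> x u \<bullet> v - D \<eta> x v \<bullet> u =
      (K x *v (N *v v)) \<bullet> u + (D K x v *v Y x) \<bullet> u - (K x *v (N *v u)) \<bullet> v - (D K x u *v Y x) \<bullet> v"
    using dt[OF x, of u v] unfolding t' N by (simp add: inner_add_left)
  moreover have "(D K x (Y x) *v u) \<bullet> v = - ((K x *v u) \<bullet> (N *v v)) - (K x *v (N *v u)) \<bullet> v"
    unfolding KY
    by (simp add: matrix_vector_mult_diff_rdistrib matrix_mult_distribs matrix_vector_mult_uminus inner_diff_left
        matrix_vector_mul_assoc[symmetric] inner_transpose_mult dot_lmul_matrix)
  moreover have "(K x *v (N *v v)) \<bullet> u = - ((K x *v u) \<bullet> (N *v v))"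
    by (rule K_antisym[OF x])
  ultimately show ?thesis using dK[OF x, of "Y x" u v] by simp
qed

end

section \<open>Bihermitian linear algebra\<close>

lemma matrix_inv_eqI:
  fixes A B :: "real^'m::finite^'m"
  assumes "A ** B = mat 1"
  shows "invertible A" "matrix_inv A = B"
proof -
  show inv: "invertible A"
    using assms invertible_right_inverse by blast
  have "matrix_inv A = matrix_inv A ** (A ** B)" by (simp add: assms)
  also have "\<dots> = B" by (simp add: matrix_mul_assoc matrix_inv_left[OF inv])
  finally show "matrix_inv A = B" .
qed

lemma inner_eq_imp_matrix_eq:
  fixes A B :: "real^'n::finite^'m::finite"
  assumes "\<And>u v. (A *v u) \<bullet> v = (B *v u) \<bullet> v"
  shows "A = B"
  by (simp add: matrix_eq) (metis assms vector_eq_rdot)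

lemma positive_definite_invertible:
  fixes g :: "real^'m::finite^'m"
  assumes "\<And>v. v \<noteq> 0 \<Longrightarrow> (g *v v) \<bullet> v > 0"
  shows "invertible g"
proof -
  have "v = 0" if "g *v v = 0" for v
    using assms[of v] that by fastforce
  then show ?thesis
    using matrix_left_invertible_ker[of g] invertible_left_inverse[of g] by blast
qed

lemma hermitian_algebra:
  fixes g I :: "real^'m::finite^'m"
  assumes g: "invertible g" and I: "I ** I = - mat 1"
    and orth: "\<And>u v. (g *v (I *v u)) \<bullet> (I *v v) = (g *v u) \<bullet> v"
  shows "invertible (g ** I)" "matrix_inv (g ** I) = - (I ** matrix_inv g)"
    "transpose I = - (g ** I ** matrix_inv g)"
proof -
  have "(g ** I) ** (- (I ** matrix_inv g)) = - (g ** (I ** I) ** matrix_inv g)"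
    by (simp add: matrix_mul_assoc matrix_mult_distribs)
  also have "\<dots> = mat 1"
    by (simp add: I matrix_mult_distribs matrix_inv_right[OF g])
  finally have 1: "(g ** I) ** (- (I ** matrix_inv g)) = mat 1" .
  show "invertible (g ** I)" "matrix_inv (g ** I) = - (I ** matrix_inv g)"
    using matrix_inv_eqI[OF 1] by auto
  have "transpose I ** g ** I = g"
    by (rule inner_eq_imp_matrix_eq)
      (simp add: matrix_vector_mul_assoc[symmetric] inner_transpose_mult dot_lmul_matrix orth)
  then have "transpose I ** g ** I ** I = g ** I" by simp
  then have "transpose I ** g ** (I ** I) = g ** I" by (simp add: matrix_mul_assoc)
  then have "- (transpose I ** g) = g ** I" by (simp add: I matrix_mult_distribs)
  then have "- (transpose I ** g) ** matrix_inv g = g ** I ** matrix_inv g" by simp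
  then have "- transpose I = g ** I ** matrix_inv g"
    by (simp add: matrix_mult_distribs matrix_mul_assoc[symmetric] matrix_inv_right[OF g])
  then show "transpose I = - (g ** I ** matrix_inv g)" by (metis minus_minus)
qed

text \<open>The \<open>\<i>\<close>-eigenvectors \<open>Z - i\<^sub>Z \<beta>\<close>, \<open>\<beta> = K + \<i> \<Omega>\<close>, of the generalized complex structure where its
  Poisson tensor is invertible.\<close>
lemma gcs_J_eigen:
  fixes g I J :: "real^'m::finite^'m" and b :: "('m, real) form"
  defines "P \<equiv> poisson_J g I J"
  defines "K \<equiv> matrix_inv P ** ((1/2) *\<^sub>R (I - J)) - form_matrix b" and "\<Omega> \<equiv> - matrix_inv P"
  assumes g: "invertible g" and I: "I ** I = - mat 1" and J: "J ** J = - mat 1"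
    and oI: "\<And>u v. (g *v (I *v u)) \<bullet> (I *v v) = (g *v u) \<bullet> v"
    and oJ: "\<And>u v. (g *v (J *v u)) \<bullet> (J *v v) = (g *v u) \<bullet> v"
    and b: "alternating_form b" and P: "invertible P"
  shows "gcs_J g I J b (z, - (K *v z)) = (0, \<Omega> *v z)"
    and "gcs_J g I J b (0, - (\<Omega> *v z)) = (z, - (K *v z))"
proof -
  define a where "a = (1/2) *\<^sub>R (I - J)"
  define \<sigma> where "\<sigma> = (1/2) *\<^sub>R (g ** I + g ** J)"
  define Q where "Q = matrix_inv P"
  let ?gi = "matrix_inv g"
  note hI = hermitian_algebra[OF g I oI] and hJ = hermitian_algebra[OF g J oJ]
  have PQ: "P ** Q = mat 1" "Q ** P = mat 1"
    unfolding Q_def using matrix_inv_left[OF P] matrix_inv_right[OF P] by auto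
  have gg: "?gi ** (g ** M) = M" for M
    by (simp add: matrix_mul_assoc matrix_inv_left[OF g])
  have P_eq: "P = (1/2) *\<^sub>R ((I + J) ** ?gi)" by (simp add: P_def poisson_J_def)
  have "P ** \<sigma> = (1/4) *\<^sub>R ((I + J) ** (?gi ** (g ** (I + J))))"
    unfolding P_eq \<sigma>_def matrix_add_ldistrib[symmetric]
    by (simp add: matrix_mult_scaleR_left matrix_mult_scaleR_right matrix_mul_assoc)
  then have P\<sigma>: "P ** \<sigma> = (1/4) *\<^sub>R ((I + J) ** (I + J))" unfolding gg .
  \<comment> \<open>The upper left block of the statement that the structure squares to -1; the
    mixed terms IJ and JI cancel between the two squares.\<close>
  have "P ** \<sigma> + a ** a = (1/4) *\<^sub>R ((I + J) ** (I + J) + (I - J) ** (I - J))"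
    unfolding P\<sigma> a_def by (simp add: matrix_mult_scaleR_left matrix_mult_scaleR_right scaleR_add_right)
  also have "(I + J) ** (I + J) + (I - J) ** (I - J) = 2 *\<^sub>R (I ** I) + 2 *\<^sub>R (J ** J)"
    by (simp add: matrix_mult_distribs matrix_add_ldistrib scaleR_2)
  also have "(1/4) *\<^sub>R \<dots> = - mat 1" by (simp add: I J scaleR_add_right[symmetric])
  finally have P\<sigma>a: "P ** \<sigma> + a ** a = - mat 1" .
  have ta: "transpose a = - ((1/2) *\<^sub>R (g ** (I - J) ** ?gi))"
  proof -
    have "transpose a = (1/2) *\<^sub>R (transpose I - transpose J)"
      by (simp add: a_def transpose_def vec_eq_iff)
    then show ?thesis by (simp add: hI(3) hJ(3) matrix_mult_distribs scaleR_diff_right)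
  qed
  \<comment> \<open>The upper right block of the same statement. It rests on the fact that I + J and
    I - J anticommute.\<close>
  have "P ** transpose a = - ((1/4) *\<^sub>R ((I + J) ** (?gi ** (g ** ((I - J) ** ?gi)))))"
    unfolding P_eq ta by (simp add: matrix_mult_scaleR_left matrix_mult_scaleR_right matrix_mult_uminus_right matrix_mul_assoc)
  also have "\<dots> = (- (1/4)) *\<^sub>R ((I + J) ** (I - J) ** ?gi)" unfolding gg by (simp add: matrix_mul_assoc)
  also have "(- (1/4)) *\<^sub>R ((I + J) ** (I - J) ** ?gi) = (1/4) *\<^sub>R ((I - J) ** (I + J) ** ?gi)"
  proof -
    have "(I - J) ** (I + J) = - ((I + J) ** (I - J))"
      by (simp add: matrix_mult_distribs matrix_add_ldistrib I J)
    then show ?thesis by (simp only: matrix_mult_uminus_left scaleR_minus_left scaleR_minus_right)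
  qed
  also have "\<dots> = a ** P"
    unfolding P_eq a_def by (simp add: matrix_mult_scaleR_left matrix_mult_scaleR_right matrix_mul_assoc)
  finally have "Q ** (P ** transpose a) ** Q = Q ** (a ** P) ** Q" by simp
  then have taQ: "transpose a ** Q = Q ** a"
    by (simp add: matrix_mul_assoc PQ) (simp add: matrix_mul_assoc[symmetric] PQ)
  have pi: "- ((1/2) *\<^sub>R (matrix_inv (g ** I) + matrix_inv (g ** J))) = P"
    unfolding P_eq hI(2) hJ(2) by (simp add: matrix_mult_distribs scaleR_add_right scaleR_diff_right)
  have eq: "gcs_J g I J b (v, \<xi>) = (let \<xi>0 = \<xi> - form_matrix b *v v; p = a *v v + P *v \<xi>0
      in (p, \<sigma> *v v - transpose a *v \<xi>0 + form_matrix b *v p))" for v \<xi>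
  proof -
    have "transpose a = - ((1/2) *\<^sub>R (- (transpose I - transpose J)))"
      by (simp add: a_def transpose_def vec_eq_iff algebra_simps)
    then have "transpose a *v w = - ((1/2) *\<^sub>R ((- (transpose I - transpose J)) *v w))" for w
      by (simp only: scaleR_matrix_vector_assoc[symmetric] matrix_vector_mult_uminus_left)
    moreover have "P *v w = (1/2) *\<^sub>R ((- (matrix_inv (g ** I) + matrix_inv (g ** J))) *v w)" for w
      unfolding pi[symmetric] by (simp only: scaleR_matrix_vector_assoc[symmetric] matrix_vector_mult_uminus_left scaleR_minus_right)
    moreover have "a *v w = (1/2) *\<^sub>R ((I - J) *v w)" "\<sigma> *v w = (1/2) *\<^sub>R ((g ** I + g ** J) *v w)" for w
      by (simp_all only: a_def \<sigma>_def scaleR_matrix_vector_assoc)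
    ultimately show ?thesis
      unfolding gcs_J_def exp_b_eq[OF b] exp_b_uminus_eq[OF b] block_def Let_def
      by (simp add: scaleR_add_right)
  qed
  have K: "K = Q ** a - form_matrix b" by (simp add: K_def Q_def a_def)
  have \<Omega>: "\<Omega> = - Q" by (simp add: \<Omega>_def Q_def)
  have "Q ** (P ** \<sigma> + a ** a) = - Q" by (simp add: P\<sigma>a matrix_mult_distribs)
  then have \<sigma>: "\<sigma> + Q ** a ** a = - Q"
    by (simp add: matrix_add_ldistrib matrix_mul_assoc PQ)
  then have \<sigma>z: "\<sigma> *v z + transpose a *v (Q *v (a *v z)) = - (Q *v z)"
    by (simp add: matrix_vector_mul_assoc matrix_mul_assoc taQ matrix_vector_mult_add_rdistrib[symmetric]
        matrix_vector_mult_uminus del: transpose_matrix_vector)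
  have taQv: "transpose a *v (Q *v v) = Q *v (a *v v)" for v
    by (simp add: matrix_vector_mul_assoc taQ del: transpose_matrix_vector)
  have PQv: "P *v (Q *v v) = v" for v by (simp add: matrix_vector_mul_assoc PQ)
  \<comment> \<open>The eigenvector has real part (z, - K z) and imaginary part (0, - \<Omega> z).
    The two claims are the real and the imaginary part of the equation for the eigenvalue i.\<close>
  show "gcs_J g I J b (z, - (K *v z)) = (0, \<Omega> *v z)"
  proof -
    have "- (K *v z) - form_matrix b *v z = - (Q *v (a *v z))"
      by (simp add: K matrix_vector_mult_diff_rdistrib matrix_vector_mul_assoc)
    then show ?thesis using \<sigma>z unfolding eq
      by (simp add: \<Omega> matrix_vector_mult_uminus PQv del: transpose_matrix_vector)
  qed
  show "gcs_J g I J b (0, - (\<Omega> *v z)) = (z, - (K *v z))"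
    unfolding eq
    by (simp add: \<Omega> K matrix_vector_mult_uminus PQv matrix_vector_mult_diff_rdistrib
        matrix_vector_mul_assoc[symmetric] taQv del: transpose_matrix_vector)
qed

text \<open>The vector \<open>z\<close> minus the covector i_z \<beta> lies in the eigenspace, hence
  annihilates \<psi>; written out, this is i_z \<psi> = (i_z \<beta>) wedge \<psi>.\<close>

lemma pure_spinor_recursion:
  fixes F :: "'m::finite gt \<Rightarrow> 'm gt" and K \<Omega> :: "real^'m^'m"
  assumes "\<And>z. F (z, - (K *v z)) = (0, \<Omega> *v z)" "\<And>z. F (0, - (\<Omega> *v z)) = (z, - (K *v z))"
    and ann: "{e. \<forall>vs. clifford e \<psi> vs = 0} = {e. complexify_End F e = cscale \<i> e}"
    and alt: "alternating_form \<psi>"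
  shows "\<psi> (z # vs) = wedge1 (\<lambda>v. Complex ((K *v z) \<bullet> v) ((\<Omega> *v z) \<bullet> v)) \<psi> vs"
proof -
  define e :: "'m cgt" where "e = ((\<chi> i. complex_of_real (z $ i)),
    (\<chi> i. - Complex ((K *v z) $ i) ((\<Omega> *v z) $ i)))"
  have re: "Re_gt e = (z, - (K *v z))" "Im_gt e = (0, - (\<Omega> *v z))"
    by (simp_all add: e_def Re_gt_def Im_gt_def vec_eq_iff)
  have "complexify_End F e = cscale \<i> e"
    unfolding complexify_End_def re assms(1,2)
    by (simp add: e_def complexify_def cscale_def vec_eq_iff complex_eq_iff)
  with ann have "clifford e \<psi> vs = 0" by blast
  moreover have "wedge (cform1 (snd e)) \<psi> vs =
      wedge1 (\<lambda>v. - 1 * Complex ((K *v z) \<bullet> v) ((\<Omega> *v z) \<bullet> v)) \<psi> vs"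
  proof -
    have "wedge (cform1 (snd e)) \<psi> vs = wedge1 (\<lambda>v. cform1 (snd e) [v]) \<psi> vs"
      by (rule wedge_degree_one) (simp add: cform1_def)
    moreover have "cform1 (snd e) [v] = - 1 * Complex ((K *v z) \<bullet> v) ((\<Omega> *v z) \<bullet> v)" for v
      by (simp add: e_def cform1_def inner_vec_def complex_eq_iff sum_negf)
    ultimately show ?thesis by simp
  qed
  ultimately show ?thesis
    unfolding wedge1_cmult_left clifford_def re interior_prod_def
    by (simp add: alternating_form_0[OF alt])
qed

section \<open>Flows and pullbacks\<close>

lemma atlas_chart:
  assumes "smooth_atlas A" "c \<in> A"
  shows atlas_open_dom: "open (dom c)" and atlas_open_img: "open (img c)"
    and atlas_homeomorphism: "homeomorphism (dom c) (img c) (coord c) (param c)"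
  using assms unfolding smooth_atlas_def by auto

lemma atlas_cover:
  assumes "smooth_atlas A" obtains c where "c \<in> A" "p \<in> dom c"
proof -
  have "p \<in> (\<Union>c\<in>A. dom c)" using assms unfolding smooth_atlas_def by simp
  then show ?thesis using that by blast
qed

lemma chart_inverse:
  assumes "smooth_atlas A" "c \<in> A"
  shows param_coord: "p \<in> dom c \<Longrightarrow> param c (coord c p) = p"
    and coord_param: "x \<in> img c \<Longrightarrow> coord c (param c x) = x"
    and coord_img: "p \<in> dom c \<Longrightarrow> coord c p \<in> img c"
    and param_dom: "x \<in> img c \<Longrightarrow> param c x \<in> dom c"
  using atlas_homeomorphism[OF assms] unfolding homeomorphism_def by auto

lemma chart_rep_domain_open:
  assumes "smooth_atlas A" "c \<in> A" "c' \<in> A" "continuous_on UNIV f"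
  shows "open {x \<in> img c. f (param c x) \<in> dom c'}"
proof -
  have "continuous_on (img c) (\<lambda>x. f (param c x))"
    using atlas_homeomorphism[OF assms(1,2)] assms(4)
    by (intro continuous_on_compose2[OF assms(4)]) (auto simp: homeomorphism_def)
  then have "open ((\<lambda>x. f (param c x)) -` dom c' \<inter> img c)"
    using continuous_on_open_vimage[OF atlas_open_img[OF assms(1,2)]] atlas_open_dom[OF assms(1,3)] by blast
  moreover have "(\<lambda>x. f (param c x)) -` dom c' \<inter> img c = {x \<in> img c. f (param c x) \<in> dom c'}" by auto
  ultimately show ?thesis by simp
qed

lemma chart_rep_domain:
  assumes "smooth_atlas A" "c \<in> A"
  shows "coord c ` (dom c \<inter> f -` S) = {x \<in> img c. f (param c x) \<in> S}"
proof (intro set_eqI iffI)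
  fix x assume "x \<in> {x \<in> img c. f (param c x) \<in> S}"
  then show "x \<in> coord c ` (dom c \<inter> f -` S)"
    using param_dom[OF assms] coord_param[OF assms] by (intro image_eqI[of _ _ "param c x"]) auto
qed (auto simp: coord_img[OF assms] param_coord[OF assms])

lemma tangent_map_compose:
  assumes A: "smooth_atlas A" "c \<in> A" "c' \<in> A" "c'' \<in> A"
    and f: "continuous_on UNIV f" and p: "p \<in> dom c" "f p \<in> dom c'"
    and df: "chart_rep c c' f differentiable (at (coord c p))"
    and dh: "chart_rep c' c'' h differentiable (at (coord c' (f p)))"
  shows "tangent_map c c'' (h \<circ> f) p v = tangent_map c' c'' h (f p) (tangent_map c c' f p v)"
proof -
  let ?x = "coord c p"
  have x: "?x \<in> {x \<in> img c. f (param c x) \<in> dom c'}"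
    using p coord_img[OF A(1,2)] param_coord[OF A(1,2)] by auto
  have fx: "chart_rep c c' f ?x = coord c' (f p)"
    by (simp add: chart_rep_def param_coord[OF A(1,2) p(1)])
  have "frechet_derivative (chart_rep c c'' (h \<circ> f)) (at ?x)
      = frechet_derivative (chart_rep c' c'' h \<circ> chart_rep c c' f) (at ?x)"
    by (rule frechet_derivative_cong_open[OF chart_rep_domain_open[OF A(1-3) f] x])
      (auto simp: chart_rep_def param_coord[OF A(1,3)])
  also have "\<dots> = frechet_derivative (chart_rep c' c'' h) (at (coord c' (f p)))
      \<circ> frechet_derivative (chart_rep c c' f) (at ?x)"
    using frechet_derivative_compose[of "chart_rep c c' f" ?x "chart_rep c' c'' h"] df dh fx by simp
  finally show ?thesis by (simp add: tangent_map_def)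
qed

lemma tangent_map_id:
  assumes "smooth_atlas A" "c \<in> A" "p \<in> dom c"
  shows "tangent_map c c id p v = v"
proof -
  have "frechet_derivative (chart_rep c c id) (at (coord c p)) = frechet_derivative (\<lambda>x. x) (at (coord c p))"
    by (rule frechet_derivative_cong_open[OF atlas_open_img[OF assms(1,2)] coord_img[OF assms]])
      (simp add: chart_rep_def coord_param[OF assms(1,2)])
  then show ?thesis by (simp add: tangent_map_def)
qed

locale manifold_flow =
  fixes A :: "('a::{t2_space, second_countable_topology}, 'm::finite) chart set"
    and X :: "('a, 'm) chart \<Rightarrow> real^'m \<Rightarrow> real^'m" and \<Phi> :: "real \<Rightarrow> 'a \<Rightarrow> 'a"
  assumes atlas: "smooth_atlas A" and vf: "vector_field A X" and flow: "is_flow A X \<Phi>"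
begin

lemma flow_zero [simp]: "\<Phi> 0 = id" and flow_add: "\<Phi> (s + t) = \<Phi> s \<circ> \<Phi> t"
  using flow unfolding is_flow_def by blast+

lemma flow_continuous: "continuous_on UNIV (\<lambda>z. \<Phi> (fst z) (snd z))"
proof -
  have "continuous_on UNIV (\<lambda>(t, p). \<Phi> t p)" using flow unfolding is_flow_def by blast
  then show ?thesis by (simp only: case_prod_unfold)
qed

lemma flow_continuous_space: "continuous_on UNIV (\<Phi> t)"
  using continuous_on_compose2[OF flow_continuous, of UNIV "\<lambda>p. (t, p)"] by (simp add: continuous_on_Pair)

lemma flow_continuous_time: "continuous_on UNIV (\<lambda>t. \<Phi> t p)"
  using continuous_on_compose2[OF flow_continuous, of UNIV "\<lambda>t. (t, p)"] by (simp add: continuous_on_Pair)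

definition "dom_rep c c' = {(t, x). x \<in> img c \<and> \<Phi> t (param c x) \<in> dom c'}"

text \<open>The flow in charts as one function of time and position jointly, so that time and space
  derivatives can be interchanged as second derivatives of a single map.\<close>

definition "rep c c' = (\<lambda>(t, x). chart_rep c c' (\<Phi> t) x)"

lemma dom_rep_open:
  assumes "c \<in> A" "c' \<in> A" shows "open (dom_rep c c')"
proof -
  let ?h = "\<lambda>z. \<Phi> (fst z) (param c (snd z))"
  have "continuous_on (UNIV \<times> img c) (\<lambda>z. (fst z, param c (snd z)))"
  proof (intro continuous_on_Pair continuous_on_fst continuous_on_id)
    have "continuous_on (img c) (param c)"
      using atlas_homeomorphism[OF atlas assms(1)] unfolding homeomorphism_def by blast
    then show "continuous_on (UNIV \<times> img c) (\<lambda>z. param c (snd z))"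
      by (rule continuous_on_compose2[OF _ continuous_on_snd[OF continuous_on_id]]) auto
  qed
  from continuous_on_compose2[OF flow_continuous this]
  have "continuous_on (UNIV \<times> img c) ?h" by simp
  then have "open (?h -` dom c' \<inter> (UNIV \<times> img c))"
    using continuous_on_open_vimage[OF open_Times[OF open_UNIV atlas_open_img[OF atlas assms(1)]]]
      atlas_open_dom[OF atlas assms(2)] by blast
  moreover have "?h -` dom c' \<inter> (UNIV \<times> img c) = dom_rep c c'" by (auto simp: dom_rep_def)
  ultimately show ?thesis by simp
qed

lemma rep_smooth: "c \<in> A \<Longrightarrow> c' \<in> A \<Longrightarrow> smooth_on (dom_rep c c') (rep c c')"
  using flow unfolding is_flow_def dom_rep_def rep_def by blast

lemma chart_rep_flow_smooth:
  assumes "c \<in> A" "c' \<in> A"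
  shows "smooth_on {x \<in> img c. \<Phi> t (param c x) \<in> dom c'} (chart_rep c c' (\<Phi> t))"
proof -
  have "smooth_on {x \<in> img c. \<Phi> t (param c x) \<in> dom c'} (\<lambda>x. rep c c' ((t, 0) + (0, x)))"
    by (rule smooth_on_affine[OF rep_smooth[OF assms] chart_rep_domain_open[OF atlas assms flow_continuous_space]
          bounded_linear_Pair[OF bounded_linear_zero bounded_linear_ident]])
      (simp add: dom_rep_def)
  then show ?thesis by (simp add: rep_def)
qed

lemma flow_smooth_map: "smooth_map A (\<Phi> t)"
  unfolding smooth_map_def using flow_continuous_space chart_rep_flow_smooth
  by (simp add: chart_rep_domain[OF atlas])

lemma flow_inverse: "\<Phi> (- t) \<circ> \<Phi> t = id" "\<Phi> t \<circ> \<Phi> (- t) = id"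
  by (simp_all flip: flow_add)

lemma flow_bij: "bij (\<Phi> t)" and inv_flow: "inv (\<Phi> t) = \<Phi> (- t)"
  by (rule o_bij[OF flow_inverse]) (rule inv_unique_comp[OF flow_inverse(2,1)])

lemma tangent_flow_diff:
  assumes "c \<in> A" "c' \<in> A" "p \<in> dom c" "\<Phi> t p \<in> dom c'"
  shows "chart_rep c c' (\<Phi> t) differentiable (at (coord c p))"
  by (rule smooth_on_differentiable[OF chart_rep_flow_smooth[OF assms(1,2)]])
    (use assms coord_img[OF atlas assms(1)] param_coord[OF atlas assms(1)] in auto)

lemma time_domain_open:
  assumes "c \<in> A" shows "open {t. \<Phi> t p \<in> dom c}"
  using open_vimage[OF atlas_open_dom[OF atlas assms] flow_continuous_time[of p]] by (simp add: vimage_def)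

lemma flow_curve:
  assumes "c \<in> A" "p \<in> dom c"
  shows "((\<lambda>t. coord c (\<Phi> t p)) has_derivative (\<lambda>s. s *\<^sub>R X c (coord c p))) (at 0)"
  using flow assms unfolding is_flow_def has_vector_derivative_def by blast

lemma rep_derivative_time:
  assumes c: "c \<in> A" and y: "y \<in> img c"
  shows "frechet_derivative (rep c c) (at (0, y)) (1, 0) = X c y"
proof -
  have "(0, y) \<in> dom_rep c c" using y param_dom[OF atlas c] by (simp add: dom_rep_def)
  note d = has_derivative_frechet[OF smooth_on_differentiable[OF rep_smooth[OF c c] this]]
  have "((\<lambda>t::real. (t, y)) has_derivative (\<lambda>s. (s, 0))) (at 0)"
    by (auto intro!: derivative_eq_intros)
  from has_derivative_compose[OF this, of "rep c c"] d
  have "((\<lambda>t. rep c c (t, y)) has_derivative (\<lambda>s. frechet_derivative (rep c c) (at (0, y)) (s, 0))) (at 0)"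
    by simp
  moreover have "((\<lambda>t. rep c c (t, y)) has_derivative (\<lambda>s. s *\<^sub>R X c y)) (at 0)"
    using flow_curve[OF c param_dom[OF atlas c y]]
    by (simp add: rep_def chart_rep_def coord_param[OF atlas c y])
  ultimately have "(\<lambda>s. frechet_derivative (rep c c) (at (0, y)) (s, 0)) = (\<lambda>s. s *\<^sub>R X c y)"
    by (rule has_derivative_unique)
  from fun_cong[OF this, of 1] show ?thesis by simp
qed

lemma rep_derivative_space:
  assumes c: "c \<in> A" and z: "(t, y) \<in> dom_rep c c"
  shows "frechet_derivative (rep c c) (at (t, y)) (0, v) = frechet_derivative (chart_rep c c (\<Phi> t)) (at y) v"
proof -
  note d = has_derivative_frechet[OF smooth_on_differentiable[OF rep_smooth[OF c c] z]]
  have "((\<lambda>x. (t, x)) has_derivative (\<lambda>v. (0, v))) (at y)"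
    by (auto intro!: derivative_eq_intros)
  from has_derivative_compose[OF this, of "rep c c"] d
  have "((\<lambda>x. rep c c (t, x)) has_derivative (\<lambda>v. frechet_derivative (rep c c) (at (t, y)) (0, v))) (at y)"
    by simp
  from frechet_derivative_eqI[OF this] show ?thesis by (simp add: rep_def)
qed

text \<open>The time derivative of the space derivative of the flow is the space derivative of its
  time derivative, which is \<open>X\<close>. The interchange is the symmetry of the second
  derivative of \<open>rep c c\<close> in the directions (1, 0) and (0, v).\<close>

lemma tangent_flow_derivative:
  assumes c: "c \<in> A" and q: "q \<in> dom c"
  shows "((\<lambda>t. tangent_map c c (\<Phi> t) q v) has_derivative
    (\<lambda>s. s *\<^sub>R frechet_derivative (X c) (at (coord c q)) v)) (at 0)"
proof -
  let ?x = "coord c q" and ?S = "dom_rep c c" and ?D = "\<lambda>w z. frechet_derivative (rep c c) (at z) w"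
  have x: "?x \<in> img c" by (rule coord_img[OF atlas c q])
  have z: "(0, ?x) \<in> ?S" using x q by (simp add: dom_rep_def param_coord[OF atlas c])
  note sm = smooth_on_frechet_derivative[OF rep_smooth[OF c c]]
  note D = has_derivative_frechet[OF smooth_on_differentiable[OF sm z]]
  have "((\<lambda>t::real. (t, ?x)) has_derivative (\<lambda>s. (s, 0))) (at 0)"
    by (auto intro!: derivative_eq_intros)
  from has_derivative_compose[OF this, of "?D (0, v)"] D[of "(0, v)"]
  have 1: "((\<lambda>t. ?D (0, v) (t, ?x)) has_derivative (\<lambda>s. frechet_derivative (?D (0, v)) (at (0, ?x)) (s, 0))) (at 0)"
    by simp
  have "frechet_derivative (?D (0, v)) (at (0, ?x)) (1, 0) = frechet_derivative (?D (1, 0)) (at (0, ?x)) (0, v)"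
    by (rule symmetric_second_derivative[OF rep_smooth[OF c c] dom_rep_open[OF c c] z])
  also have "\<dots> = frechet_derivative (X c) (at ?x) v"
  proof -
    have "((\<lambda>y. (0::real, y)) has_derivative (\<lambda>v. (0, v))) (at ?x)"
      by (auto intro!: derivative_eq_intros)
    from has_derivative_compose[OF this, of "?D (1, 0)"] D[of "(1, 0)"]
    have "((\<lambda>y. ?D (1, 0) (0, y)) has_derivative (\<lambda>v. frechet_derivative (?D (1, 0)) (at (0, ?x)) (0, v))) (at ?x)"
      by simp
    then have "(X c has_derivative (\<lambda>v. frechet_derivative (?D (1, 0)) (at (0, ?x)) (0, v))) (at ?x)"
      by (rule has_derivative_transform_within_open[OF _ atlas_open_img[OF atlas c] x])
        (rule rep_derivative_time[OF c])
    from frechet_derivative_eqI[OF this] show ?thesis by simp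
  qed
  finally have m: "frechet_derivative (?D (0, v)) (at (0, ?x)) (1, 0) = frechet_derivative (X c) (at ?x) v" .
  have "frechet_derivative (?D (0, v)) (at (0, ?x)) (s, 0) = s *\<^sub>R frechet_derivative (X c) (at ?x) v" for s
    using linear_scale[OF has_derivative_linear[OF D[of "(0, v)"]], of s "(1, 0)"] m by simp
  with 1 have "((\<lambda>t. ?D (0, v) (t, ?x)) has_derivative (\<lambda>s. s *\<^sub>R frechet_derivative (X c) (at ?x) v)) (at 0)"
    by simp
  then show ?thesis
  proof (rule has_derivative_transform_within_open[OF _ time_domain_open[OF c, of q]])
    fix t assume "t \<in> {t. \<Phi> t q \<in> dom c}"
    then show "?D (0, v) (t, ?x) = tangent_map c c (\<Phi> t) q v"
      using rep_derivative_space[OF c, of t ?x v] x q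
      by (simp add: tangent_map_def dom_rep_def param_coord[OF atlas c])
  qed (use q in simp)
qed

text \<open>At time 0, the derivative of the pullback of a bilinear form along the flow is its Lie
  derivative, here the matrix \<open>L\<close>. One chart suffices, since the orbit stays in it for
  small times.\<close>

lemma pullback_derivative:
  fixes K :: "real^'m \<Rightarrow> real^'m^'m"
  assumes c: "c \<in> A" and q: "q \<in> dom c"
    and K: "K differentiable (at (coord c q))"
    and N: "\<And>h. N *v h = frechet_derivative (X c) (at (coord c q)) h"
  defines "x \<equiv> coord c q"
  defines "L \<equiv> frechet_derivative K (at x) (X c x) + transpose N ** K x + K x ** N"
  shows "((\<lambda>t. (K (coord c (\<Phi> t q)) *v tangent_map c c (\<Phi> t) q u) \<bullet> tangent_map c c (\<Phi> t) q w)
    has_derivative (\<lambda>s. s * ((L *v u) \<bullet> w))) (at 0)"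
proof -
  let ?T = "\<lambda>v t. tangent_map c c (\<Phi> t) q v"
  have T0: "?T v 0 = v" for v using tangent_map_id[OF atlas c q] by simp
  have T: "(?T v has_derivative (\<lambda>s. s *\<^sub>R (N *v v))) (at 0)" for v
    using tangent_flow_derivative[OF c q] by (simp add: N)
  have "(K has_derivative frechet_derivative K (at x)) (at (coord c (\<Phi> 0 q)))"
    using has_derivative_frechet[OF K] by (simp add: x_def)
  from has_derivative_compose[OF flow_curve[OF c q] this]
  have "((\<lambda>t. K (coord c (\<Phi> t q))) has_derivative (\<lambda>s. frechet_derivative K (at x) (s *\<^sub>R X c x))) (at 0)"
    by (simp add: x_def)
  from has_derivative_inner[OF bounded_bilinear.FDERIV[OF bounded_bilinear_matrix_vector_mult this T[of u]] T[of w]]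
  have "((\<lambda>t. (K (coord c (\<Phi> t q)) *v ?T u t) \<bullet> ?T w t) has_derivative
    (\<lambda>s. (K x *v u) \<bullet> (s *\<^sub>R (N *v w)) + (K x *v (s *\<^sub>R (N *v u)) + frechet_derivative K (at x) (s *\<^sub>R X c x) *v u) \<bullet> w)) (at 0)"
    by (simp add: T0[simplified] x_def tangent_map_id[OF atlas c q])
  moreover have "(K x *v u) \<bullet> (s *\<^sub>R (N *v w)) + (K x *v (s *\<^sub>R (N *v u)) + frechet_derivative K (at x) (s *\<^sub>R X c x) *v u) \<bullet> w
      = s * ((L *v u) \<bullet> w)" for s
  proof -
    have "frechet_derivative K (at x) (s *\<^sub>R X c x) = s *\<^sub>R frechet_derivative K (at x) (X c x)"
      using linear_scale[OF linear_frechet_derivative[OF K]] by (simp add: x_def)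
    then show ?thesis
      by (simp add: L_def matrix_vector_mult_add_rdistrib inner_add_left matrix_vector_mult_scaleR
          scaleR_matrix_vector_assoc[symmetric] matrix_vector_mul_assoc[symmetric] inner_transpose_mult
          dot_lmul_matrix distrib_left)
  qed
  ultimately show ?thesis by simp
qed

text \<open>The pullback has derivative zero at every time, hence is constant. As the orbit need not
  stay in a chart, the chart at the endpoint is chosen anew for each time, which is harmless because
  the value does not depend on it.\<close>

lemma flow_preserves_bilin:
  assumes K: "\<And>c x. c \<in> A \<Longrightarrow> x \<in> img c \<Longrightarrow> K c differentiable (at x)"
    and pres: "preserves A id (\<lambda>c x. bilin (K c x))"
    and lie: "\<And>c x N. c \<in> A \<Longrightarrow> x \<in> img c \<Longrightarrow> (\<And>h. N *v h = frechet_derivative (X c) (at x) h) \<Longrightarrow>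
      frechet_derivative (K c) (at x) (X c x) + transpose N ** K c x + K c x ** N = 0"
  shows "preserves A (\<Phi> t) (\<lambda>c x. bilin (K c x))"
  unfolding preserves_def
proof (intro ballI allI)
  fix c c' p vs assume c: "c \<in> A" and c': "c' \<in> A" and p: "p \<in> dom c \<inter> \<Phi> t -` dom c'"
  show "bilin (K c' (coord c' (\<Phi> t p))) (map (tangent_map c c' (\<Phi> t) p) vs) = bilin (K c (coord c p)) vs"
  proof (cases "length vs = 2")
    case True
    then obtain u w where vs: "vs = [u, w]" by (auto simp: length_Suc_conv numeral_2_eq_2)
    define W where "W c' t = (K c' (coord c' (\<Phi> t p)) *v tangent_map c c' (\<Phi> t) p u) \<bullet> tangent_map c c' (\<Phi> t) p w"
      for c' t
    have indep: "W c1 t = W c2 t" if "c1 \<in> A" "c2 \<in> A" "\<Phi> t p \<in> dom c1" "\<Phi> t p \<in> dom c2" for c1 c2 t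
    proof -
      have id: "chart_rep c1 c2 id differentiable (at (coord c1 (\<Phi> t p)))"
        using tangent_flow_diff[OF that(1,2), of "\<Phi> t p" 0] that by simp
      have "tangent_map c c2 (id \<circ> \<Phi> t) p v = tangent_map c1 c2 id (\<Phi> t p) (tangent_map c c1 (\<Phi> t) p v)" for v
        by (rule tangent_map_compose[OF atlas c that(1,2) flow_continuous_space _ that(3)
            tangent_flow_diff[OF c that(1) _ that(3)] id]) (use p in auto)
      moreover have "bilin (K c2 (coord c2 (id (\<Phi> t p)))) (map (tangent_map c1 c2 id (\<Phi> t p)) [v1, v2])
          = bilin (K c1 (coord c1 (\<Phi> t p))) [v1, v2]" for v1 v2
        using pres[unfolded preserves_def, rule_format, OF that(1,2), of "\<Phi> t p" "[v1, v2]"] that by simp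
      ultimately show ?thesis by (simp add: W_def bilin_def)
    qed
    define ch where "ch t = (SOME c. c \<in> A \<and> \<Phi> t p \<in> dom c)" for t
    have ch: "ch t \<in> A" "\<Phi> t p \<in> dom (ch t)" for t
    proof -
      have "\<exists>c. c \<in> A \<and> \<Phi> t p \<in> dom c" using atlas_cover[OF atlas, of "\<Phi> t p"] by blast
      from someI_ex[OF this] show "ch t \<in> A" "\<Phi> t p \<in> dom (ch t)" unfolding ch_def by auto
    qed
    have "((\<lambda>t. W (ch t) t) has_real_derivative 0) (at t0)" for t0
    proof -
      let ?c = "ch t0" and ?q = "\<Phi> t0 p"
      let ?T = "tangent_map c ?c (\<Phi> t0) p"
      have q: "coord ?c ?q \<in> img ?c" by (rule coord_img[OF atlas ch])
      define N where "N = matrix (frechet_derivative (X ?c) (at (coord ?c ?q)))"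
      have "X ?c differentiable (at (coord ?c ?q))"
        using vf ch(1) smooth_on_differentiable[OF _ q] unfolding vector_field_def by blast
      then have N: "N *v h = frechet_derivative (X ?c) (at (coord ?c ?q)) h" for h
        unfolding N_def by (simp add: matrix_works linear_frechet_derivative)
      have "((\<lambda>s. (K ?c (coord ?c (\<Phi> s ?q)) *v tangent_map ?c ?c (\<Phi> s) ?q (?T u)) \<bullet>
          tangent_map ?c ?c (\<Phi> s) ?q (?T w)) has_derivative (\<lambda>s. 0)) (at 0)"
        using pullback_derivative[OF ch K[OF ch(1) q] N, of "?T u" "?T w"]
        unfolding lie[OF ch(1) q N] by simp
      then have "((\<lambda>s. W ?c (t0 + s)) has_derivative (\<lambda>s. 0)) (at 0)"
      proof (rule has_derivative_transform_within_open[OF _ time_domain_open[OF ch(1)[of t0], of ?q]])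
        fix s assume "s \<in> {s. \<Phi> s ?q \<in> dom ?c}"
        then have s: "\<Phi> s ?q \<in> dom ?c" by simp
        \<comment> \<open>By the group law the derivative at \<open>t0\<close> becomes a derivative
          at time 0 for the flow started at \<open>?q\<close>, with tangent vectors transported to
          that point.\<close>
        have "\<Phi> (t0 + s) = \<Phi> s \<circ> \<Phi> t0" using flow_add[of s t0] by (simp add: add.commute)
        moreover have "tangent_map c ?c (\<Phi> s \<circ> \<Phi> t0) p v = tangent_map ?c ?c (\<Phi> s) ?q (?T v)" for v
          by (rule tangent_map_compose[OF atlas c ch(1) ch(1) flow_continuous_space _ ch(2)
              tangent_flow_diff[OF c ch(1) _ ch(2)] tangent_flow_diff[OF ch(1) ch(1) ch(2) s]])
            (use p in auto)
        ultimately show "(K ?c (coord ?c (\<Phi> s ?q)) *v tangent_map ?c ?c (\<Phi> s) ?q (?T u)) \<bullet>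
          tangent_map ?c ?c (\<Phi> s) ?q (?T w) = W ?c (t0 + s)"
          by (simp add: W_def)
      qed (use ch in simp)
      then have "((\<lambda>s. W ?c (t0 + s)) has_real_derivative 0) (at 0)"
        by (simp add: has_field_derivative_def mult_zero_left[abs_def])
      then have "(W ?c has_real_derivative 0) (at t0)"
        using DERIV_at_within_shift[of "W ?c" 0 t0 0 UNIV] by simp
      then show ?thesis
      proof (rule has_field_derivative_transform_within_open[OF _ time_domain_open[OF ch(1)[of t0], of p]])
        show "W ?c t = W (ch t) t" if "t \<in> {t. \<Phi> t p \<in> dom ?c}" for t
          using indep[OF ch(1)[of t0] ch(1)[of t], of t] that ch(2)[of t] by simp
      qed (use ch in simp)
    qed
    then have "W (ch t) t = W (ch 0) 0"
      using DERIV_isconst_all[of "\<lambda>t. W (ch t) t" t 0] by blast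
    moreover have "W (ch t) t = W c' t" by (rule indep[OF ch(1) c' ch(2)]) (use p in simp)
    moreover have "W (ch 0) 0 = W c 0" by (rule indep[OF ch(1) c ch(2)]) (use p in simp)
    ultimately show ?thesis
      using tangent_map_id[OF atlas c] p by (simp add: vs bilin_def W_def)
  qed (simp add: bilin_def)
qed

lemma flow_in_torus:
  assumes "\<And>s. preserves A (\<Phi> s) (\<lambda>c x. bilin (g c x))"
  shows "\<Phi> t \<in> torus_generated A g \<Phi>"
proof -
  have "\<Phi> s \<in> Isom A g" for s
    using assms[of s] flow_bij[of s] flow_smooth_map[of s] flow_smooth_map[of "- s"]
    by (simp add: Isom_def inv_flow)
  moreover have "f \<in> topspace compact_open_topology" for f :: "'a \<Rightarrow> 'a"
  proof -
    \<comment> \<open>The empty compact set puts all functions into one subbasic open set, so the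
      topology lives on the whole function space.\<close>
    have "{f. f ` {} \<subseteq> (UNIV :: 'a set)} \<subseteq> topspace compact_open_topology"
      unfolding compact_open_topology_def topology_generated_by_topspace
      by (rule Union_upper) (use compact_empty open_UNIV in blast)
    then show ?thesis by auto
  qed
  ultimately have "range \<Phi> \<subseteq> topspace (subtopology compact_open_topology (Isom A g))"
    by (simp only: topspace_subtopology) blast
  from closure_of_subset[OF this] show ?thesis unfolding torus_generated_def by blast
qed

end

section \<open>Invariance of the bihermitian data\<close>

lemma matrix_frechet_derivative:
  fixes Z :: "real^'m::finite \<Rightarrow> real^'m"
  assumes "Z differentiable (at x)"
  shows "matrix (frechet_derivative Z (at x)) *v h = frechet_derivative Z (at x) h"
  by (simp add: matrix_works linear_frechet_derivative[OF assms])

text \<open>Testing on a constant field \<open>e\<close> suffices: its bracket with \<open>X\<close>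
  is minus the derivative of \<open>X\<close> in direction \<open>e\<close>, so the condition
  becomes the matrix equation applied to \<open>e\<close>.\<close>

lemma lie_End_zero_on_imp_lie_inv:
  assumes "lie_End_zero_on S X K" "x \<in> S" "K differentiable (at x)"
    and N: "\<And>h. N *v h = frechet_derivative X (at x) h"
  shows "lie_inv (X x) N N K x"
proof -
  note K = has_derivative_frechet[OF assms(3)]
  let ?K' = "frechet_derivative K (at x)"
  have "?K' (X x) *v e = (N ** K x - K x ** N) *v e" for e
  proof -
    have "((\<lambda>y. K y *v e) has_derivative (\<lambda>h. ?K' h *v e)) (at x)"
      by (rule bounded_linear.has_derivative[OF
            bounded_bilinear.bounded_linear_left[OF bounded_bilinear_matrix_vector_mult] K])
    moreover have "lie_bracket X (\<lambda>y. K y *v e) x - K x *v lie_bracket X (\<lambda>y. e) x = 0"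
      using assms(1,2) smooth_on_const unfolding lie_End_zero_on_def by blast
    ultimately show ?thesis
      by (simp add: lie_bracket_def frechet_derivative_eqI N[symmetric] matrix_vector_mult_uminus
          matrix_vector_mult_diff_rdistrib matrix_vector_mul_assoc algebra_simps)
  qed
  then have "?K' (X x) = N ** K x - K x ** N" by (simp add: matrix_eq)
  then show ?thesis unfolding lie_inv_def using K by blast
qed

lemma lie_cov_bilin:
  assumes "g differentiable (at x)" and N: "\<And>h. N *v h = frechet_derivative X (at x) h"
    and zero: "\<And>vs. lie_cov X (\<lambda>y. bilin (g y)) x vs = 0"
  shows "frechet_derivative g (at x) (X x) + transpose N ** g x + g x ** N = 0"
proof (rule inner_eq_imp_matrix_eq)
  fix u w
  have "frechet_derivative (\<lambda>y. bilin (g y) [u, w]) (at x) = (\<lambda>h. (frechet_derivative g (at x) h *v u) \<bullet> w)"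
    using has_derivative_matrix_inner[OF has_derivative_frechet[OF assms(1)], of u w]
    by (intro frechet_derivative_eqI) (simp add: bilin_def)
  then show "((frechet_derivative g (at x) (X x) + transpose N ** g x + g x ** N) *v u) \<bullet> w = (0 *v u) \<bullet> w"
    using zero[of "[u, w]"]
    by (simp add: lie_cov_def N[symmetric] numeral_2_eq_2 bilin_def matrix_vector_mult_add_rdistrib inner_add_left
        matrix_vector_mul_assoc[symmetric] inner_transpose_mult dot_lmul_matrix add.assoc)
qed

lemma lie_zero_imp_lie_inv:
  assumes "K differentiable (at x)"
    and "frechet_derivative K (at x) \<xi> + transpose N ** K x + K x ** N = 0"
  shows "lie_inv \<xi> (- transpose N) N K x"
proof -
  have "frechet_derivative K (at x) \<xi> = - transpose N ** K x - K x ** N"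
    using assms(2) by (simp add: matrix_mult_distribs eq_neg_iff_add_eq_0 algebra_simps)
  then show ?thesis unfolding lie_inv_def using has_derivative_frechet[OF assms(1)] by blast
qed

lemma differentiable_form_matrix:
  assumes "\<And>vs. (\<lambda>y. b y vs) differentiable (at x)"
  shows "(\<lambda>y. form_matrix (b y)) differentiable (at x)"
  by (intro differentiable_vec_nth) (simp add: form_matrix_def assms)

lemma (in manifold_flow) invariant_form_lie_inv:
  assumes b: "form_field A 2 b" and inv: "\<And>t. preserves A (\<Phi> t) b"
    and c: "c \<in> A" and x: "x \<in> img c"
    and N: "\<And>h. N *v h = frechet_derivative (X c) (at x) h"
  shows "lie_inv (X c x) (- transpose N) N (\<lambda>y. form_matrix (b c y)) x"
proof -
  let ?K = "\<lambda>y. form_matrix (b c y)"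
  have K: "?K differentiable (at x)"
    using b c smooth_on_differentiable[OF _ x] unfolding form_field_def
    by (intro differentiable_form_matrix) blast
  define q where "q = param c x"
  have q: "q \<in> dom c" "coord c q = x"
    using param_dom[OF atlas c x] coord_param[OF atlas c x] by (simp_all add: q_def)
  have alt: "alternating_form (b c y)" if "y \<in> img c" for y
    using b c that unfolding form_field_def k_form_def by blast
  let ?L = "frechet_derivative ?K (at x) (X c x) + transpose N ** ?K x + ?K x ** N"
  have "?L = 0"
  proof (rule inner_eq_imp_matrix_eq)
    fix u w
    let ?f = "\<lambda>t. (?K (coord c (\<Phi> t q)) *v tangent_map c c (\<Phi> t) q u) \<bullet> tangent_map c c (\<Phi> t) q w"
    have "(?f has_derivative (\<lambda>s. s * ((?L *v u) \<bullet> w))) (at 0)"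
      using pullback_derivative[OF c q(1), of ?K N u w] K N unfolding q(2) by blast
    moreover have "(?f has_derivative (\<lambda>s. 0)) (at 0)"
    proof (rule has_derivative_transform_within_open[OF has_derivative_const time_domain_open[OF c, of q]])
      fix t assume "t \<in> {t. \<Phi> t q \<in> dom c}"
      then have t: "\<Phi> t q \<in> dom c" by simp
      have "b c x [u, w] = b c (coord c (\<Phi> t q)) (map (tangent_map c c (\<Phi> t) q) [u, w])"
        using inv[of t, unfolded preserves_def, rule_format, OF c c, of q "[u, w]"] q t by simp
      then show "b c x [u, w] = ?f t"
        by (simp add: form_matrix_inner[OF alt[OF coord_img[OF atlas c t]]])
    qed (use q in simp)
    ultimately have "(\<lambda>s. s * ((?L *v u) \<bullet> w)) = (\<lambda>s. 0)" by (rule has_derivative_unique)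
    from fun_cong[OF this, of 1] show "(?L *v u) \<bullet> w = (0 *v u) \<bullet> w" by simp
  qed
  with K show ?thesis by (rule lie_zero_imp_lie_inv)
qed

text \<open>When the 2-form contracts to zero with the vector part, the action is the Lie derivative
  on both summands; on covectors its matrix is minus the transpose of the derivative of the
  field.\<close>

lemma aut_action_lie_along:
  assumes t: "lie_along (Z x) N (\<lambda>y. fst (t y)) x w1" "lie_along (Z x) (- transpose N) (\<lambda>y. snd (t y)) x w2"
    and N: "\<And>h. N *v h = frechet_derivative Z (at x) h"
    and B: "covector (interior_prod (fst (t x)) (B x)) = 0"
  shows "aut_action Z B t x = (w1, w2)"
proof -
  from t obtain D1 D2 where D1: "((\<lambda>y. fst (t y)) has_derivative D1) (at x)" "w1 = D1 (Z x) - N *v fst (t x)"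
    and D2: "((\<lambda>y. snd (t y)) has_derivative D2) (at x)" "w2 = D2 (Z x) + transpose N *v snd (t x)"
    by (auto simp: lie_along_def matrix_vector_mult_uminus)
  have "covector (lie_cov Z (\<lambda>y. form1 (snd (t y))) x) = w2"
  proof -
    have "frechet_derivative (\<lambda>y. snd (t y) \<bullet> axis j 1) (at x) = (\<lambda>h. D2 h \<bullet> axis j 1)" for j
      by (rule frechet_derivative_eqI[OF has_derivative_inner_left[OF D2(1)]])
    moreover have "snd (t x) \<bullet> (N *v axis j 1) = (transpose N *v snd (t x)) $ j" for j
      using inner_transpose_mult[of N "snd (t x)" "axis j 1"] by (simp add: inner_axis)
    ultimately show ?thesis
      by (simp add: covector_def lie_cov_def form1_def vec_eq_iff D2(2) N[symmetric] inner_axis)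
  qed
  then show ?thesis
    by (simp add: aut_action_def B lie_bracket_def frechet_derivative_eqI[OF D1(1)] D1(2) N)
qed

section \<open>Extension from the dense set where the Poisson tensor is invertible\<close>

lemma continuous_zero_dense:
  fixes f :: "'a::topological_space \<Rightarrow> 'b::real_normed_vector"
  assumes "open W" "continuous_on W f" "\<And>y. y \<in> W \<Longrightarrow> y \<in> D \<Longrightarrow> f y = 0"
    and dense: "\<And>V. open V \<Longrightarrow> V \<subseteq> W \<Longrightarrow> V \<noteq> {} \<Longrightarrow> V \<inter> D \<noteq> {}"
    and "x \<in> W"
  shows "f x = 0"
proof (rule ccontr)
  assume "f x \<noteq> 0"
  have "open (W \<inter> f -` (- {0}))"
    by (rule continuous_open_preimage[OF assms(2,1)]) auto
  from dense[OF this] \<open>f x \<noteq> 0\<close> \<open>x \<in> W\<close> obtain y where "y \<in> W" "f y \<noteq> 0" "y \<in> D" by auto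
  with assms(3) show False by blast
qed

lemma chart_dense:
  assumes "smooth_atlas A" "c \<in> A" "closure W0 = UNIV" "open V" "V \<subseteq> img c" "V \<noteq> {}"
  shows "V \<inter> {y. param c y \<in> W0} \<noteq> {}"
proof -
  have "continuous_on (dom c) (coord c)"
    using atlas_homeomorphism[OF assms(1,2)] unfolding homeomorphism_def by blast
  then have "open (dom c \<inter> coord c -` V)"
    using continuous_open_preimage atlas_open_dom[OF assms(1,2)] assms(4) by blast
  moreover from assms(5,6) obtain y where "y \<in> V" "y \<in> img c" by blast
  then have "param c y \<in> dom c \<inter> coord c -` V"
    using param_dom[OF assms(1,2)] coord_param[OF assms(1,2)] by auto
  ultimately obtain p where "p \<in> W0" "p \<in> dom c" "coord c p \<in> V"
    using assms(3) open_Int_closure_eq_empty[of "dom c \<inter> coord c -` V" W0] by blast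
  then show ?thesis using param_coord[OF assms(1,2)] by force
qed

lemma lie_inv_differentiable: "lie_inv \<xi> M' M K x \<Longrightarrow> K differentiable (at x)"
  unfolding lie_inv_def by (auto intro: differentiableI)

theorem lemma3p20:
  fixes n :: nat
    and A :: "('a::{t2_space, second_countable_topology}, 'm::finite) chart set"
    and H0 b vol :: "('a, 'm) chart \<Rightarrow> real^'m \<Rightarrow> ('m, real) form"
    and g I J :: "('a, 'm) chart \<Rightarrow> real^'m \<Rightarrow> real^'m^'m"
    and X Y :: "('a, 'm) chart \<Rightarrow> real^'m \<Rightarrow> real^'m"
    and B :: "('a, 'm) chart \<Rightarrow> real^'m \<Rightarrow> ('m, real) form"
    and \<Phi> :: "real \<Rightarrow> 'a \<Rightarrow> 'a"
  assumes "smooth_atlas A" and "compact (UNIV :: 'a set)" and "CARD('m) = 2 * n"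
    and "form_field A 3 H0" and "closed_form A H0"
    and "generalized_kaehler A H0 g I J b"
    and "adapted_volume A g I J vol"
    and "is_div_bivector A vol (\<lambda>c x. poisson_J (g c x) (I c x) (J c x)) X"
    and "is_flow A X \<Phi>"
    and "generically_symplectic A (\<lambda>c x. poisson_J (g c x) (I c x) (J c x))"
    and "\<forall>f\<in>torus_generated A g \<Phi>. preserves A f b"
    and "is_div_gcs n A H0 vol (\<lambda>c x. gcs_J (g c x) (I c x) (J c x) (b c x)) Y B"
  shows "aut_action_End_zero A Y B (\<lambda>c x. gcs_I (g c x) (I c x) (J c x) (b c x))"
proof -
  let ?P = "\<lambda>c x. poisson_J (g c x) (I c x) (J c x)"
  have vf: "vector_field A X" using assms(8) unfolding is_div_bivector_def by blast
  interpret manifold_flow A X \<Phi>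
    using assms(1,9) vf by unfold_locales
  have metric: "riemannian_metric A g" and hI: "hermitian_complex_structure A g I"
    and hJ: "hermitian_complex_structure A g J" and form_b: "form_field A 2 b"
    using assms(6) unfolding generalized_kaehler_def by blast+
  have vol_form: "volume_form A vol"
    using assms(7) unfolding adapted_volume_def by blast
  have sm: "\<forall>c\<in>A. smooth_on (img c) (g c)" "\<forall>c\<in>A. smooth_on (img c) (I c)"
    "\<forall>c\<in>A. smooth_on (img c) (J c)" "\<forall>c\<in>A. smooth_on (img c) (X c)"
    using metric hI hJ vf
    unfolding riemannian_metric_def hermitian_complex_structure_def End_field_def vector_field_def
    by simp_all
  have gdiff: "g c differentiable (at x)" and Idiff: "I c differentiable (at x)"
    and Jdiff: "J c differentiable (at x)" and Xdiff: "X c differentiable (at x)"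
    if "c \<in> A" "x \<in> img c" for c x
    using sm that smooth_on_differentiable by blast+
  have ginv: "invertible (g c x)" if "c \<in> A" "x \<in> img c" for c x
    using metric that unfolding riemannian_metric_def by (intro positive_definite_invertible) blast
  have II: "I c x ** I c x = - mat 1" "\<And>u v. (g c x *v (I c x *v u)) \<bullet> (I c x *v v) = (g c x *v u) \<bullet> v"
    and JJ: "J c x ** J c x = - mat 1" "\<And>u v. (g c x *v (J c x *v u)) \<bullet> (J c x *v v) = (g c x *v u) \<bullet> v"
    if "c \<in> A" "x \<in> img c" for c x
    using hI hJ that unfolding hermitian_complex_structure_def integrable_complex_on_def by blast+
  have alt_b: "alternating_form (b c x)" if "c \<in> A" "x \<in> img c" for c x
    using form_b that unfolding form_field_def k_form_def by blast
  have L: "(\<forall>x\<in>img c. \<forall>vs. lie_cov (X c) (\<lambda>y. bilin (g c y)) x vs = 0)"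
    "lie_End_zero_on (img c) (X c) (I c)" "lie_End_zero_on (img c) (X c) (J c)" if "c \<in> A" for c
    using assms(7,8) that unfolding adapted_volume_def by blast+
  define N where "N c x = matrix (frechet_derivative (X c) (at x))" for c x
  have N: "N c x *v h = frechet_derivative (X c) (at x) h" if "c \<in> A" "x \<in> img c" for c x h
    unfolding N_def by (rule matrix_frechet_derivative[OF Xdiff[OF that]])
  have Lg: "frechet_derivative (g c) (at x) (X c x) + transpose M ** g c x + g c x ** M = 0"
    if "c \<in> A" "x \<in> img c" "\<And>h. M *v h = frechet_derivative (X c) (at x) h" for c x M
    by (rule lie_cov_bilin[OF gdiff[OF that(1,2)] that(3)]) (use L(1) that in blast)
  have "preserves A (\<Phi> t) (\<lambda>c x. bilin (g c x))" for t
    by (rule flow_preserves_bilin[OF gdiff _ Lg]) (use metric in \<open>auto simp: riemannian_metric_def\<close>)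
  then have "\<Phi> t \<in> torus_generated A g \<Phi>" for t by (rule flow_in_torus)
  then have inv_b: "preserves A (\<Phi> t) b" for t using assms(11) by blast
  have lg: "lie_inv (X c x) (- transpose (N c x)) (N c x) (g c) x"
    and lI: "lie_inv (X c x) (N c x) (N c x) (I c) x"
    and lJ: "lie_inv (X c x) (N c x) (N c x) (J c) x"
    and lb: "lie_inv (X c x) (- transpose (N c x)) (N c x) (\<lambda>y. form_matrix (b c y)) x"
    if "c \<in> A" "x \<in> img c" for c x
  proof -
    show "lie_inv (X c x) (- transpose (N c x)) (N c x) (g c) x"
      by (rule lie_zero_imp_lie_inv[OF gdiff[OF that] Lg[OF that N[OF that]]])
    show "lie_inv (X c x) (N c x) (N c x) (I c) x"
      by (rule lie_End_zero_on_imp_lie_inv[OF L(2)[OF that(1)] that(2) Idiff[OF that] N[OF that]])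
    show "lie_inv (X c x) (N c x) (N c x) (J c) x"
      by (rule lie_End_zero_on_imp_lie_inv[OF L(3)[OF that(1)] that(2) Jdiff[OF that] N[OF that]])
    show "lie_inv (X c x) (- transpose (N c x)) (N c x) (\<lambda>y. form_matrix (b c y)) x"
      by (rule invariant_form_lie_inv[OF form_b inv_b that N[OF that]])
  qed
  have lP: "lie_inv (X c x) (N c x) (- transpose (N c x)) (?P c) x" if "c \<in> A" "x \<in> img c" for c x
    unfolding poisson_J_def
    by (rule lie_inv_scaleR[OF lie_inv_mult[OF lie_inv_add[OF lI[OF that] lJ[OF that]]
            lie_inv_matrix_inv[OF lg[OF that] atlas_open_img[OF assms(1) that(1)] that(2) ginv[OF that(1)]]]])
  obtain W0 where W0: "open W0" "closure W0 = UNIV"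
    "\<And>c p. c \<in> A \<Longrightarrow> p \<in> W0 \<Longrightarrow> p \<in> dom c \<Longrightarrow> invertible (?P c (coord c p))"
    using assms(10) unfolding generically_symplectic_def by blast
  obtain \<gamma> where \<gamma>: "form_field A (CARD('m) - 2) \<gamma>"
    "\<And>c x a vs. c \<in> A \<Longrightarrow> x \<in> img c \<Longrightarrow> interior_prod (?P c x *v a) (vol c x) vs = wedge (form1 a) (\<gamma> c x) vs"
    "\<And>c x vs. c \<in> A \<Longrightarrow> x \<in> img c \<Longrightarrow> ext_d (\<gamma> c) x vs = interior_prod (X c x) (vol c x) vs"
    using assms(8) unfolding is_div_bivector_def by blast
  \<comment> \<open>The vector part of the divergence is \<open>X\<close> and its 2-form vanishes on
    pairs of vectors. This is local, so it is proved near each point with the spinor that exists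
    there.\<close>
  have key: "Y c x = X c x" "B c x [u, v] = 0" if c: "c \<in> A" and x: "x \<in> img c" for c x u v
  proof -
    obtain W \<psi> e where W: "open W" "x \<in> W" "W \<subseteq> img c"
      and ps: "pure_spinor_on W (\<lambda>x. gcs_J (g c x) (I c x) (J c x) (b c x)) \<psi>"
      and nrm: "\<forall>y\<in>W. \<forall>vs. mukai (\<psi> y) (\<lambda>us. cnj (\<psi> y us)) vs = (2 * \<i>) ^ n * complex_of_real (vol c y vs)"
      and e: "smooth_on W e"
      and tw: "\<forall>y\<in>W. \<forall>vs. twisted_d (H0 c) \<psi> y vs = (\<i> / 2) * clifford (complexify (e y)) (\<psi> y) vs"
      and YB: "\<forall>y\<in>W. (Y c y, B c y) = Psi (H0 c) e y"
      using assms(12)[unfolded is_div_gcs_def, rule_format, OF c x] by blast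
    define D where "D = {y. param c y \<in> W0}"
    define U where "U = W \<inter> D"
    have "continuous_on (img c) (param c)"
      using atlas_homeomorphism[OF assms(1) c] unfolding homeomorphism_def by blast
    then have "continuous_on W (param c)" using W(3) continuous_on_subset by blast
    then have "open U"
      unfolding U_def D_def using continuous_open_preimage[OF _ W(1) W0(1)] by (simp add: vimage_def)
    have U: "y \<in> W" "y \<in> img c" if "y \<in> U" for y using that W(3) by (auto simp: U_def)
    have invP: "invertible (?P c y)" if "y \<in> U" for y
      using W0(3)[OF c, of "param c y"] that U(2)[OF that] param_dom[OF assms(1) c] coord_param[OF assms(1) c]
      by (simp add: U_def D_def)
    have dense: "V \<inter> D \<noteq> {}" if "open V" "V \<subseteq> W" "V \<noteq> {}" for V
      unfolding D_def by (rule chart_dense[OF assms(1) c W0(2) that(1) _ that(3)]) (use that W(3) in blast)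
    define K where "K y = matrix_inv (?P c y) ** ((1/2) *\<^sub>R (I c y - J c y)) - form_matrix (b c y)" for y
    define \<Omega> where "\<Omega> y = - matrix_inv (?P c y)" for y
    have lK: "lie_inv (X c y) (- transpose (N c y)) (N c y) K y" if "y \<in> U" for y
      unfolding K_def using U[OF that] c that
      by (intro lie_inv_diff[OF lie_inv_mult[OF lie_inv_matrix_inv[OF lP \<open>open U\<close> _ invP]
            lie_inv_scaleR[OF lie_inv_diff[OF lI lJ]]] lb]) auto
    have ediff: "(\<lambda>y. fst (e y)) differentiable (at y)" "(\<lambda>y. snd (e y)) differentiable (at y)" if "y \<in> W" for y
      using has_derivative_frechet[OF smooth_on_differentiable[OF e that]]
      by (auto intro!: differentiableI has_derivative_fst has_derivative_snd)
    interpret symplectic_spinor n U \<psi> "?P c" K \<Omega> "\<lambda>y. fst (e y)" "\<lambda>y. snd (e y)" "H0 c" "vol c"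
    proof
      show "open U" by fact
      show "smooth_on U (\<lambda>x. \<psi> x vs)" for vs
        using ps smooth_on_subset[of W _ U] unfolding pure_spinor_on_def U_def by blast
      fix y assume y: "y \<in> U"
      note yc = c U(2)[OF y]
      show alt: "alternating_form (\<psi> y)"
        using ps U(1)[OF y] unfolding pure_spinor_on_def by blast
      have ann: "{e. \<forall>vs. clifford e (\<psi> y) vs = 0} =
          {e. complexify_End (gcs_J (g c y) (I c y) (J c y) (b c y)) e = cscale \<i> e}"
        using ps U(1)[OF y] unfolding pure_spinor_on_def by blast
      note eig = gcs_J_eigen[OF ginv[OF yc] II(1)[OF yc] JJ(1)[OF yc] II(2)[OF yc] JJ(2)[OF yc]
          alt_b[OF yc] invP[OF y], folded K_def \<Omega>_def]
      show "\<psi> y (z # vs) = wedge1 (\<lambda>v. Complex ((K y *v z) \<bullet> v) ((\<Omega> y *v z) \<bullet> v)) (\<psi> y) vs" for z vs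
        by (rule pure_spinor_recursion[OF eig ann alt])
      show "mukai (\<psi> y) (\<lambda>us. cnj (\<psi> y us)) vs = (2 * \<i>) ^ n * complex_of_real (vol c y vs)" for vs
        using nrm U(1)[OF y] by blast
      have vf: "form_field A CARD('m) vol" using vol_form unfolding volume_form_def by blast
      then have kv: "k_form CARD('m) (vol c y)" using yc unfolding form_field_def by blast
      then show "alternating_form (vol c y)" unfolding k_form_def by blast
      obtain vs where "vol c y vs \<noteq> 0" using vol_form yc unfolding volume_form_def by blast
      with kv show "\<exists>vs. length vs = CARD('m) \<and> vol c y vs \<noteq> 0" unfolding k_form_def by blast
      show "twisted_d (H0 c) \<psi> y vs = (\<i> / 2) * clifford (complexify (fst (e y), snd (e y))) (\<psi> y) vs" for vs
        using tw U(1)[OF y] by simp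
      show "k_form 3 (H0 c y)" using assms(4) yc unfolding form_field_def by blast
      show "?P c y ** \<Omega> y = - mat 1"
        by (simp add: \<Omega>_def matrix_mult_distribs matrix_inv_right[OF invP[OF y]])
      show "(\<lambda>x. vol c x vs) differentiable (at y)" for vs
        using vf yc smooth_on_differentiable unfolding form_field_def by blast
      show "?P c differentiable (at y)" by (rule lie_inv_differentiable[OF lP[OF yc]])
      show "K differentiable (at y)" by (rule lie_inv_differentiable[OF lK[OF y]])
      show "\<Omega> differentiable (at y)"
        unfolding \<Omega>_def
        by (intro differentiable_minus lie_inv_differentiable[OF lie_inv_matrix_inv[OF lP[OF yc] \<open>open U\<close> y invP]])
      show "(\<lambda>y. fst (e y)) differentiable (at y)" "(\<lambda>y. snd (e y)) differentiable (at y)"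
        using ediff[OF U(1)[OF y]] by auto
    qed
    have XY: "X c y = fst (e y)" if y: "y \<in> U" for y
    proof (rule div_eq[OF y])
      show "(\<lambda>y. \<gamma> c y us) differentiable (at y)" for us
        using \<gamma>(1) c U(2)[OF y] smooth_on_differentiable unfolding form_field_def by blast
      show "interior_prod (?P c z *v a) (vol c z) vs = wedge (form1 a) (\<gamma> c z) vs" if "z \<in> U" for z a vs
        by (rule \<gamma>(2)[OF c U(2)[OF that]])
      show "ext_d (\<gamma> c) y vs = interior_prod (X c y) (vol c y) vs" for vs
        by (rule \<gamma>(3)[OF c U(2)[OF y]])
    qed
    \<comment> \<open>The value of d \<eta> - i_Y H on (u, v) in coordinates. \<open>Y\<close> and
      \<open>B\<close> are given only through \<open>Psi\<close>, so continuity is available for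
      this expression in the smooth section \<open>e\<close>, and the density argument runs on
      it.\<close>
    let ?b = "\<lambda>y. frechet_derivative (\<lambda>y. snd (e y)) (at y) u \<bullet> v
      - frechet_derivative (\<lambda>y. snd (e y)) (at y) v \<bullet> u - H0 c y [fst (e y), u, v]"
    have b0: "?b y = 0" if y: "y \<in> U" for y
    proof -
      note yc = c U(2)[OF y]
      \<comment> \<open>\<open>lK\<close> is invariance along \<open>X\<close>, whereas
        \<open>two_form_zero\<close> asks for it along the vector part of \<open>e\<close>. The two
        fields agree on the open set \<open>U\<close>, hence so do their derivatives.\<close>
      have "N c y *v h = frechet_derivative (\<lambda>y. fst (e y)) (at y) h" for h
        unfolding N[OF yc] by (rule fun_cong[OF frechet_derivative_cong_open[OF \<open>open U\<close> y XY]])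
      from two_form_zero[OF y lK[OF y, unfolded XY[OF y]] this, of u v]
      show ?thesis by simp
    qed
    have cont_e: "continuous_on W (\<lambda>y. fst (e y))"
      using smooth_on_continuous_on[OF e] by (rule continuous_on_fst)
    have "X c x - fst (e x) = 0"
    proof (rule continuous_zero_dense[OF W(1) _ _ dense W(2)])
      show "continuous_on W (\<lambda>y. X c y - fst (e y))"
        using continuous_on_subset[OF smooth_on_continuous_on[OF bspec[OF sm(4) c]] W(3)] cont_e
        by (rule continuous_on_diff)
    qed (use XY in \<open>auto simp: U_def\<close>)
    moreover have "Y c x = fst (e x)" using YB W(2) by (simp add: Psi_def)
    ultimately show "Y c x = X c x" by simp
    have "?b x = 0"
    proof (rule continuous_zero_dense[OF W(1) _ _ dense W(2)])
      have ce: "continuous_on W (\<lambda>y. frechet_derivative (\<lambda>y. snd (e y)) (at y) h)" for h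
      proof (rule continuous_on_eq)
        show "continuous_on W (\<lambda>y. snd (frechet_derivative e (at y) h))"
          by (rule continuous_on_snd[OF smooth_on_continuous_on[OF smooth_on_frechet_derivative[OF e]]])
        show "snd (frechet_derivative e (at y) h) = frechet_derivative (\<lambda>y. snd (e y)) (at y) h" if "y \<in> W" for y
          by (rule fun_cong[OF frechet_derivative_eqI[OF has_derivative_snd[OF has_derivative_frechet[OF
                    smooth_on_differentiable[OF e that]]]], symmetric])
      qed
      \<comment> \<open>Smoothness of a form is stated for fixed argument lists, but here an
        argument varies with the point; expanding it in the basis reduces to fixed lists.\<close>
      have cH: "continuous_on W (\<lambda>y. H0 c y [fst (e y), u, v])"
      proof (rule continuous_on_eq)
        have "smooth_on (img c) (\<lambda>y. H0 c y vs)" for vs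
          using assms(4) c unfolding form_field_def by blast
        then have "continuous_on W (\<lambda>y. H0 c y vs)" for vs
          by (rule continuous_on_subset[OF smooth_on_continuous_on W(3)])
        then show "continuous_on W (\<lambda>y. \<Sum>j\<in>UNIV. fst (e y) $ j *\<^sub>R H0 c y [axis j 1, u, v])"
          by (intro continuous_on_sum continuous_on_scaleR
              bounded_linear.continuous_on[OF bounded_linear_vec_nth cont_e])
        fix y assume "y \<in> W"
        then have "alternating_form (H0 c y)"
          using assms(4) c W(3) unfolding form_field_def k_form_def by blast
        from linear_basis_sum[OF alternating_linear[OF this, of "[]" "[u, v]"], of "fst (e y)"]
        show "(\<Sum>j\<in>UNIV. fst (e y) $ j *\<^sub>R H0 c y [axis j 1, u, v]) = H0 c y [fst (e y), u, v]"
          by simp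
      qed
      show "continuous_on W ?b"
        by (intro continuous_on_diff continuous_on_inner continuous_on_const ce cH)
    qed (use b0 in \<open>auto simp: U_def\<close>)
    moreover have "B c x [u, v] = ?b x"
    proof -
      have d: "frechet_derivative (\<lambda>y. snd (e y) \<bullet> w) (at x) h = frechet_derivative (\<lambda>y. snd (e y)) (at x) h \<bullet> w" for w h
        by (rule fun_cong[OF frechet_derivative_eqI[OF has_derivative_inner_left[OF
                has_derivative_frechet[OF ediff(2)[OF W(2)]]]]])
      have "B c x = (\<lambda>vs. ext_d (\<lambda>y. form1 (snd (e y))) x vs - interior_prod (fst (e x)) (H0 c x) vs)"
        using YB W(2) by (simp add: Psi_def)
      then show ?thesis
        by (simp add: ext_d_def form1_def numeral_2_eq_2 interior_prod_def d)
    qed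
    ultimately show "B c x [u, v] = 0" by simp
  qed
  show ?thesis
    unfolding aut_action_End_zero_def
  proof (intro ballI allI impI)
    fix c x and s :: "real^'m \<Rightarrow> 'm gt"
    assume c: "c \<in> A" and s: "smooth_on (img c) s" and x: "x \<in> img c"
    let ?F = "\<lambda>y. gcs_I (g c y) (I c y) (J c y) (b c y)" and ?N = "N c x"
    note op = atlas_open_img[OF assms(1) c]
    have YX: "Y c x = X c x" by (rule key(1)[OF c x])
    have N': "?N *v h = frechet_derivative (Y c) (at x) h" for h
      unfolding N[OF c x] by (rule fun_cong[OF frechet_derivative_cong_open[OF op x]]) (simp add: key(1)[OF c])
    \<comment> \<open>A contraction read as a covector only sees the values of \<open>B\<close> on
      lists of two vectors, which is all that \<open>key\<close> provides.\<close>
    have B0: "covector (interior_prod z (B c x)) = 0" for z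
      by (simp add: covector_def interior_prod_def key(2)[OF c x] vec_eq_iff)
    have ds: "((\<lambda>y. fst (s y)) has_derivative (\<lambda>h. fst (frechet_derivative s (at x) h))) (at x)"
      "((\<lambda>y. snd (s y)) has_derivative (\<lambda>h. snd (frechet_derivative s (at x) h))) (at x)"
      using has_derivative_frechet[OF smooth_on_differentiable[OF s x]]
      by (auto intro: has_derivative_fst has_derivative_snd)
    then obtain w1 w2 where w: "lie_along (X c x) ?N (\<lambda>y. fst (s y)) x w1"
      "lie_along (X c x) (- transpose ?N) (\<lambda>y. snd (s y)) x w2"
      unfolding lie_along_def by blast
    have inv: "invertible (g c y ** I c y)" "invertible (g c y ** J c y)" if "y \<in> img c" for y
      using hermitian_algebra(1)[OF ginv II] hermitian_algebra(1)[OF ginv JJ] c that by blast+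
    note F = gcs_I_lie_along[OF op x inv alt_b[OF c] lg[OF c x] lI[OF c x] lJ[OF c x] lb[OF c x] w]
    have "aut_action (Y c) (B c) s x = (w1, w2)"
      by (rule aut_action_lie_along[where Z = "Y c" and B = "B c" and t = s and N = ?N])
        (simp_all only: YX w N' B0)
    moreover have "aut_action (Y c) (B c) (\<lambda>y. ?F y (s y)) x = (fst (?F x (w1, w2)), snd (?F x (w1, w2)))"
      by (rule aut_action_lie_along[where Z = "Y c" and B = "B c" and N = ?N])
        (simp_all only: YX F N' B0)
    ultimately show "aut_action (Y c) (B c) (\<lambda>y. ?F y (s y)) x - ?F x (aut_action (Y c) (B c) s x) = 0"
      by simp
  qed
qed

end
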